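(* Let $d<p\le\infty$, $h>0$, $N\in\mathbb N$, $\varphi\in\mathcal L_p$, and let $M$ be a $d\times d$ dilation matrix. Suppose $f\in W_p^{N+1}$, and let $$\varepsilon_j(k)=\frac{m^j}{V_h}\int_{M^{-j}B_h}f(M^{-j}k+t)\,dt-Lf(M^{-j}\cdot)(k),\qquad k\in\mathbb Z^d,$$ where $$Lf=\sum_{\beta\in\Delta_{N+1}}a_\beta D^\beta f,\qquad a_\beta=\frac1{\beta!\,V_h}\int_{B_h}t^\beta\,dt .$$ Then for every positive number $\theta$ which is smaller than the modulus of every eigenvalue of $M$ there is a constant $C$ not depending on $j$ such that for all $j\in\mathbb Z_+$ $$\Big\|m^{-j/2}\sum_{k\in\mathbb Z^d}\varepsilon_j(-k)\,\varphi_{jk}\Big\|_p\le C\,\theta^{-j(N+1)}.$$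
   Context: A dilation matrix is an integer $d\times d$ matrix $M$ all of whose eigenvalues are greater than $1$ in modulus; $m=|\det M|$. $\mathbb Z_+=\{0,1,2,\dots\}$, $\mathbb T^d=[-\frac12,\frac12]^d$, $B_h=\{x\in\mathbb R^d:|x|\le h\}$, $V_h$ is the volume of $B_h$. For $\beta\in\mathbb Z_+^d$, $[\beta]=\beta_1+\dots+\beta_d$, $\beta!=\prod_i\beta_i!$, $t^\beta=\prod_it_i^{\beta_i}$, $D^\beta$ is the corresponding partial derivative; $\Delta_{n}=\{\beta\in\mathbb Z_+^d:[\beta]<n\}$. $W_p^n$ is the Sobolev space of functions on $\mathbb R^d$ whose derivatives up to order $n$ are in $L_p(\mathbb R^d)$; here $f$ is identified with its representative having continuous derivatives up to order $N$ (which exists since $p>d$). $\mathcal L_p$ is the space of $\varphi\in L_p(\mathbb R^d)$ with $\big\|\sum_{k\in\mathbb Z^d}|\varphi(\cdot+k)|\big\|_{L_p(\mathbb T^d)}<\infty$. $\varphi_{jk}(x)=m^{j/2}\varphi(M^jx+k)$. $Lf(M^{-j}\cdot)(k)$ denotes the value at the point $k$ of $L$ applied to the function $x\mapsto f(M^{-j}x)$. *)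

theory Defs
  imports "HOL-Analysis.Analysis" "HOL-Probability.Essential_Supremum"
begin

section \<open>Matrices and lattices\<close>

text \<open>The type \<open>real^'d^'d\<close> carries the componentwise product, so \<open>M ^ j\<close> is not the matrix power.\<close>

primrec mat_pow :: "real^'d^'d \<Rightarrow> nat \<Rightarrow> real^'d^'d" where
  "mat_pow M 0 = mat 1"
| "mat_pow M (Suc j) = M ** mat_pow M j"

text \<open>\<open>mat_pow_neg M j\<close> is the power of \<open>M\<close> with exponent \<open>-j\<close>.\<close>

definition mat_pow_neg :: "real^'d^'d \<Rightarrow> nat \<Rightarrow> real^'d^'d" where
  "mat_pow_neg M j = mat_pow (matrix_inv M) j"

text \<open>Eigenvalues of a real matrix are understood over the complex numbers.\<close>

definition complex_eigenvalue :: "real^'d^'d \<Rightarrow> complex \<Rightarrow> bool" where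
  "complex_eigenvalue M ev \<longleftrightarrow>
     (\<exists>v::complex^'d. v \<noteq> 0 \<and> (\<chi> i j. complex_of_real (M $ i $ j)) *v v = ev *s v)"

definition dilation_matrix :: "real^'d^'d \<Rightarrow> bool" where
  "dilation_matrix M \<longleftrightarrow>
     (\<forall>i j. M $ i $ j \<in> \<int>) \<and> (\<forall>ev. complex_eigenvalue M ev \<longrightarrow> 1 < cmod ev)"

definition abs_det :: "real^'d^'d \<Rightarrow> real" where
  "abs_det M = \<bar>det M\<bar>"

definition int_lattice :: "(real^'d) set" where
  "int_lattice = {k. \<forall>i. k $ i \<in> \<int>}"

definition torus_cube :: "(real^'d) set" where
  "torus_cube = cbox (\<chi> i. - 1/2) (\<chi> i. 1/2)"

section \<open>Multi-indices and partial derivatives\<close>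

definition mi_order :: "nat^'d \<Rightarrow> nat" where
  "mi_order \<beta> = (\<Sum>i\<in>UNIV. \<beta> $ i)"

definition mi_fact :: "nat^'d \<Rightarrow> real" where
  "mi_fact \<beta> = (\<Prod>i\<in>UNIV. fact (\<beta> $ i))"

definition mi_monom :: "nat^'d \<Rightarrow> real^'d \<Rightarrow> real" where
  "mi_monom \<beta> t = (\<Prod>i\<in>UNIV. (t $ i) ^ (\<beta> $ i))"

definition mi_Delta :: "nat \<Rightarrow> (nat^'d) set" where
  "mi_Delta n = {\<beta>. mi_order \<beta> < n}"

lemma finite_mi_Delta: "finite (mi_Delta n :: (nat^'d) set)"
proof (rule finite_subset)
  show "mi_Delta n \<subseteq> vec_lambda ` (UNIV \<rightarrow>\<^sub>E {..n} :: ('d \<Rightarrow> nat) set)"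
  proof
    fix \<beta> :: "nat^'d" assume "\<beta> \<in> mi_Delta n"
    then have "\<beta> $ i \<le> n" for i
      using member_le_sum[of i UNIV "\<lambda>i. \<beta> $ i"] by (simp add: mi_Delta_def mi_order_def)
    then show "\<beta> \<in> vec_lambda ` (UNIV \<rightarrow>\<^sub>E {..n})"
      by (intro image_eqI[of _ _ "\<lambda>i. \<beta> $ i"]) auto
  qed
  show "finite (vec_lambda ` (UNIV \<rightarrow>\<^sub>E {..n} :: ('d \<Rightarrow> nat) set))"
    by (intro finite_imageI finite_PiE) auto
qed

definition partial_deriv ::
    "'d \<Rightarrow> (real^'d \<Rightarrow> 'b::real_normed_vector) \<Rightarrow> real^'d \<Rightarrow> 'b" where
  "partial_deriv i f x = vector_derivative (\<lambda>t. f (x + t *\<^sub>R axis i 1)) (at 0)"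

definition has_partial_derivs :: "(real^'d \<Rightarrow> 'b::real_normed_vector) \<Rightarrow> bool" where
  "has_partial_derivs f \<longleftrightarrow>
     (\<forall>i x. (\<lambda>t::real. f (x + t *\<^sub>R axis i 1)) differentiable (at 0))"

primrec iter_partial ::
    "'d list \<Rightarrow> (real^'d \<Rightarrow> 'b::real_normed_vector) \<Rightarrow> real^'d \<Rightarrow> 'b" where
  "iter_partial [] f = f"
| "iter_partial (i # is) f = partial_deriv i (iter_partial is f)"

text \<open>The index type is unordered, so the order of differentiation is left to an arbitrary
  choice of a list in which each \<open>i\<close> occurs \<open>\<beta> $ i\<close> times. The operator is only applied to
  functions having continuous derivatives up to order \<open>mi_order \<beta>\<close>, where the order
  does not matter.\<close>

definition mi_deriv ::
    "nat^'d \<Rightarrow> (real^'d \<Rightarrow> 'b::real_normed_vector) \<Rightarrow> real^'d \<Rightarrow> 'b" where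
  "mi_deriv \<beta> f = iter_partial (SOME is. \<forall>i. count_list is i = \<beta> $ i) f"

lemma ex_list_mi: "\<exists>is. \<forall>i. count_list is i = (\<beta> :: nat^'d) $ i"
proof -
  have "\<exists>is. \<forall>i. count_list is i = (if i \<in> A then \<beta> $ i else 0)" if "finite A" for A
    using that
  proof (induction A rule: finite_induct)
    case empty
    then show ?case by (intro exI[of _ "[]"]) simp
  next
    case (insert a A)
    then obtain "is" where l: "\<forall>i. count_list is i = (if i \<in> A then \<beta> $ i else 0)" by blast
    have r: "count_list (replicate n a) i = (if i = a then n else 0)" for n i
      by (induction n) auto
    show ?case
      using l insert.hyps by (intro exI[of _ "replicate (\<beta> $ a) a @ is"]) (auto simp: r)
  qed
  from this[of UNIV] show ?thesis by simp
qed

text \<open>All partial derivatives of order up to \<open>n\<close> exist everywhere and are continuous.\<close>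

primrec Ck :: "nat \<Rightarrow> (real^'d \<Rightarrow> 'b::real_normed_vector) \<Rightarrow> bool" where
  "Ck 0 f \<longleftrightarrow> continuous_on UNIV f"
| "Ck (Suc n) f \<longleftrightarrow>
     continuous_on UNIV f \<and> has_partial_derivs f \<and> (\<forall>i. Ck n (partial_deriv i f))"

section \<open>Lebesgue and Sobolev spaces\<close>

definition ennpowr :: "ennreal \<Rightarrow> real \<Rightarrow> ennreal" where
  "ennpowr x r = (if x = \<infinity> then \<infinity> else ennreal (enn2real x powr r))"

text \<open>The norm is defined for functions with values in \<open>[0,\<infinity>]\<close>, so that it applies directly
  to series of non-negative terms. Only exponents \<open>p \<ge> 1\<close> are of interest.\<close>

definition Lp_enorm :: "'a measure \<Rightarrow> ennreal \<Rightarrow> ('a \<Rightarrow> ennreal) \<Rightarrow> ennreal" where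
  "Lp_enorm \<mu> p g =
     (if p = \<infinity> then esssup \<mu> g
      else ennpowr (\<integral>\<^sup>+x. ennpowr (g x) (enn2real p) \<partial>\<mu>) (1 / enn2real p))"

definition Lp_norm :: "'a measure \<Rightarrow> ennreal \<Rightarrow> ('a \<Rightarrow> 'b::real_normed_vector) \<Rightarrow> ennreal" where
  "Lp_norm \<mu> p f = Lp_enorm \<mu> p (\<lambda>x. ennreal (norm (f x)))"

definition in_Lp :: "'a measure \<Rightarrow> ennreal \<Rightarrow> ('a \<Rightarrow> 'b::real_normed_vector) \<Rightarrow> bool" where
  "in_Lp \<mu> p f \<longleftrightarrow> f \<in> borel_measurable \<mu> \<and> Lp_norm \<mu> p f < \<infinity>"

definition in_calLp :: "ennreal \<Rightarrow> (real^'d \<Rightarrow> complex) \<Rightarrow> bool" where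
  "in_calLp p \<phi> \<longleftrightarrow> in_Lp lebesgue p \<phi> \<and>
     Lp_enorm (lebesgue_on torus_cube) p
       (\<lambda>x. \<Sum>\<^sub>\<infinity>k\<in>int_lattice. ennreal (cmod (\<phi> (x + k)))) < \<infinity>"

definition test_function :: "(real^'d \<Rightarrow> real) \<Rightarrow> bool" where
  "test_function \<psi> \<longleftrightarrow> (\<forall>n. Ck n \<psi>) \<and> compact (closure {x. \<psi> x \<noteq> 0})"

text \<open>Only used for \<open>f\<close> and \<open>g\<close> in some \<open>L\<^sub>p\<close> with \<open>p \<ge> 1\<close>, so that both integrals exist.\<close>

definition is_weak_deriv ::
    "nat^'d \<Rightarrow> (real^'d \<Rightarrow> complex) \<Rightarrow> (real^'d \<Rightarrow> complex) \<Rightarrow> bool" where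
  "is_weak_deriv \<beta> f g \<longleftrightarrow>
     (\<forall>\<psi>. test_function \<psi> \<longrightarrow>
        (LINT x|lebesgue. mi_deriv \<beta> \<psi> x *\<^sub>R f x) =
          (-1) ^ mi_order \<beta> * (LINT x|lebesgue. \<psi> x *\<^sub>R g x))"

definition in_Sobolev :: "nat \<Rightarrow> ennreal \<Rightarrow> (real^'d \<Rightarrow> complex) \<Rightarrow> bool" where
  "in_Sobolev n p f \<longleftrightarrow> in_Lp lebesgue p f \<and>
     (\<forall>\<beta>. mi_order \<beta> \<le> n \<longrightarrow> (\<exists>g. in_Lp lebesgue p g \<and> is_weak_deriv \<beta> f g))"

section \<open>Averages, the differential operator and the approximation error\<close>

text \<open>The argument of type \<open>'d itself\<close> fixes the dimension.\<close>

definition ball_vol :: "'d::finite itself \<Rightarrow> real \<Rightarrow> real" where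
  "ball_vol _ h = measure lebesgue (cball (0::real^'d) h)"

definition coeff_a :: "real \<Rightarrow> nat^'d \<Rightarrow> real" where
  "coeff_a h \<beta> =
     1 / (mi_fact \<beta> * ball_vol TYPE('d) h) * (LINT t:cball 0 h|lebesgue. mi_monom \<beta> t)"

definition diff_op :: "real \<Rightarrow> nat \<Rightarrow> (real^'d \<Rightarrow> complex) \<Rightarrow> real^'d \<Rightarrow> complex" where
  "diff_op h N f x = (\<Sum>\<beta>\<in>mi_Delta (N + 1). coeff_a h \<beta> *\<^sub>R mi_deriv \<beta> f x)"

definition eps ::
    "real^'d^'d \<Rightarrow> real \<Rightarrow> nat \<Rightarrow> (real^'d \<Rightarrow> complex) \<Rightarrow> nat \<Rightarrow> real^'d \<Rightarrow> complex" where
  "eps M h N f j k =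
     (abs_det M ^ j / ball_vol TYPE('d) h) *\<^sub>R
       (LINT t:((*v) (mat_pow_neg M j) ` cball 0 h)|lebesgue. f (mat_pow_neg M j *v k + t))
     - diff_op h N (\<lambda>x. f (mat_pow_neg M j *v x)) k"

definition phi_jk ::
    "real^'d^'d \<Rightarrow> (real^'d \<Rightarrow> complex) \<Rightarrow> nat \<Rightarrow> real^'d \<Rightarrow> real^'d \<Rightarrow> complex" where
  "phi_jk M \<phi> j k x = (abs_det M powr (real j / 2)) *\<^sub>R \<phi> (mat_pow M j *v x + k)"

definition error_series ::
    "real^'d^'d \<Rightarrow> real \<Rightarrow> nat \<Rightarrow> (real^'d \<Rightarrow> complex) \<Rightarrow> (real^'d \<Rightarrow> complex) \<Rightarrow> nat \<Rightarrow> real^'d \<Rightarrow> complex" where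
  "error_series M h N f \<phi> j x =
     (abs_det M powr (- real j / 2)) *\<^sub>R
       (\<Sum>\<^sub>\<infinity>k\<in>int_lattice. eps M h N f j (- k) * phi_jk M \<phi> j k x)"

end

theory Submission
  imports Defs "HOL-Complex_Analysis.Laurent_Convergence"
begin

text \<open>Put \<open>A = M\<^sup>-\<^sup>j\<close>. Since the Taylor polynomials of \<open>f \<circ> A\<close> at \<open>k\<close> and of \<open>f\<close> at \<open>Ak\<close> correspond to each
  other, \<open>\<epsilon>\<^sub>j(k)\<close> is the mean over \<open>t \<in> B\<^sub>h\<close> of the remainder of order \<open>N\<close> of \<open>f\<close> at \<open>Ak\<close> in direction \<open>At\<close>.
  Pairing this remainder with a test function \<open>\<psi>\<close>, applying Taylor's formula to \<open>\<psi>\<close> and using the weak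
  derivatives \<open>g\<^sub>\<beta>\<close> of order \<open>N + 1\<close> bounds it by \<open>\<parallel>A\<parallel>\<^sup>N\<^sup>+\<^sup>1\<close> times an integral of \<open>G = \<Sum>|g\<^sub>\<beta>|\<close> along the segments
  \<open>sAt\<close>, \<open>0 \<le> s \<le> 1\<close>; as \<open>f\<close> is of class \<open>C\<^sup>N\<close>, concentrating \<open>\<psi>\<close> gives a pointwise bound. Because \<open>p > d\<close>, the integral over
  \<open>s\<close> and \<open>t\<close> is dominated by the \<open>L\<^sub>p\<close> norm of \<open>G \<circ> A\<close> near \<open>k\<close>, and summation over \<open>k\<close> gives
  \<open>\<parallel>\<epsilon>\<^sub>j\<parallel>\<^sub>p \<le> C \<parallel>M\<^sup>-\<^sup>j\<parallel>\<^sup>N\<^sup>+\<^sup>1 m\<^sup>j\<^sup>/\<^sup>p\<close>. The factor \<open>m\<^sup>j\<^sup>/\<^sup>p\<close> is compensated by the dilation in \<open>\<phi>\<^sub>j\<^sub>k\<close>, the sum over \<open>k\<close> is a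
  convolution controlled by \<open>\<phi> \<in> \<L>\<^sub>p\<close>, and \<open>\<parallel>M\<^sup>-\<^sup>j\<parallel> \<le> C \<theta>\<^sup>-\<^sup>j\<close> by Cauchy's inequality for the resolvent of \<open>M\<close>.\<close>

text \<open>The obstacle is that the derivatives of order \<open>N + 1\<close> exist only weakly:
  Taylor's formula with remainder cannot be written for \<open>f\<close> at a point, and
  \<open>G\<close> is determined only almost everywhere. Pairing with \<open>\<psi>\<close> puts
  these derivatives on a smooth function; translation invariance then moves the shift by
  \<open>sAt\<close> onto \<open>G\<close>, while the weight \<open>\<psi>\<close> stays fixed and
  can be concentrated. Continuity in the base point, uniform for \<open>t\<close> in the ball,
  recovers the value at \<open>Ak\<close>, so the ray integral of \<open>G\<close> has to be bounded
  on a neighbourhood of \<open>Ak\<close>. Its size does not enter the constants. It is chosen so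
  that its image under \<open>M\<^sup>j\<close> lies in the unit ball around \<open>k\<close>; this
  keeps the constants free of \<open>j\<close> and leads to balls of radius \<open>h + 1\<close>
  around lattice points, which overlap boundedly often. The strict inequality between
  \<open>\<theta>\<close> and the eigenvalues makes the resolvent holomorphic on the closed disc, so
  no polynomial factor in \<open>j\<close> appears, not even for Jordan blocks. An infinite exponent
  is treated apart, with suprema in place of powers of integrals.\<close>

unbundle no fps_syntax

section \<open>Calculus of continuously differentiable functions\<close>

text \<open>Mean value inequality, on a \<open>closed_segment\<close> so that \<open>h\<close> may
  be negative: increments along a coordinate axis have either sign.\<close>

lemma norm_diff_le_of_vector_derivative:
  fixes g :: "real \<Rightarrow> 'b::real_normed_vector"
  assumes "\<And>s. s \<in> closed_segment 0 h \<Longrightarrow> (g has_vector_derivative g' s) (at s)"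
    and "\<And>s. s \<in> closed_segment 0 h \<Longrightarrow> norm (g' s) \<le> B"
  shows "norm (g h - g 0) \<le> B * \<bar>h\<bar>"
proof -
  have "norm (g h - g 0) \<le> B * norm (h - 0)"
  proof (rule differentiable_bound[of "closed_segment 0 h" g "\<lambda>s t. t *\<^sub>R g' s"])
    fix s assume s: "s \<in> closed_segment 0 h"
    show "(g has_derivative (\<lambda>t. t *\<^sub>R g' s)) (at s within closed_segment 0 h)"
      using assms(1)[OF s] unfolding has_vector_derivative_def by (rule has_derivative_at_withinI)
    have "norm (t *\<^sub>R g' s) \<le> B * norm t" for t
      using mult_left_mono[OF assms(2)[OF s], of "\<bar>t\<bar>"] by (simp add: mult.commute)
    then show "onorm (\<lambda>t. t *\<^sub>R g' s) \<le> B" by (rule onorm_le)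
  qed auto
  then show ?thesis by simp
qed

text \<open>The definition of \<open>partial_deriv\<close> differentiates at parameter 0 only;
  moving the base point along the axis gives the derivative at every \<open>s\<close>.\<close>

lemma partial_deriv_line:
  fixes u :: "real^'d \<Rightarrow> 'b::real_normed_vector"
  assumes "has_partial_derivs u"
  shows "((\<lambda>s. u (x + s *\<^sub>R axis i 1)) has_vector_derivative
           partial_deriv i u (x + s *\<^sub>R axis i 1)) (at s)"
proof -
  let ?y = "x + s *\<^sub>R axis i 1"
  have "((\<lambda>t. u (?y + t *\<^sub>R axis i 1)) has_vector_derivative partial_deriv i u ?y) (at (s - s))"
    using assms unfolding has_partial_derivs_def partial_deriv_def
    by (simp add: vector_derivative_works[symmetric])
  moreover have d: "((\<lambda>r. r - s) has_vector_derivative 1) (at s)"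
    by (auto intro!: derivative_eq_intros)
  ultimately have "((\<lambda>r. u (?y + (r - s) *\<^sub>R axis i 1)) has_vector_derivative partial_deriv i u ?y) (at s)"
    using vector_diff_chain_at[OF d] by (simp add: o_def)
  then show ?thesis by (simp add: algebra_simps)
qed

lemma Ck_SucD:
  assumes "Ck (Suc n) u"
  shows "continuous_on UNIV u" "has_partial_derivs u" "Ck n (partial_deriv i u)"
  using assms by auto

lemma Ck_continuous: "Ck n u \<Longrightarrow> continuous_on UNIV u"
  by (cases n) auto

lemma Ck_Suc_imp: "Ck (Suc n) u \<Longrightarrow> Ck n u"
proof (induction n arbitrary: u)
  case (Suc n)
  then show ?case by simp
qed auto

lemma Ck_mono: "Ck n u \<Longrightarrow> m \<le> n \<Longrightarrow> Ck m u"
  by (induction n) (use Ck_Suc_imp le_Suc_eq in blast)+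

lemma continuous_dist_le:
  fixes v :: "real^'d \<Rightarrow> 'b::real_normed_vector"
  assumes "continuous_on UNIV v" "e > 0"
  shows "\<exists>\<delta>>0. \<forall>y. norm (y - x) < \<delta> \<longrightarrow> norm (v y - v x) \<le> e"
  using assms unfolding continuous_on_iff by (fastforce simp: dist_norm intro: less_imp_le)

text \<open>The increment is split into steps along the axes. Each step is compared with its linear
  part by the mean value inequality, and continuity of the partials makes every error small.\<close>

lemma has_derivative_of_partials:
  fixes u :: "real^'d \<Rightarrow> 'b::real_normed_vector"
  assumes "Ck 1 u"
  shows "(u has_derivative (\<lambda>t. \<Sum>i\<in>UNIV. (t $ i) *\<^sub>R partial_deriv i u x)) (at x)"
proof -
  have pd: "has_partial_derivs u" and cont: "continuous_on UNIV (partial_deriv i u)" for i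
    using assms by auto
  have lin: "bounded_linear (\<lambda>t::real^'d. \<Sum>i\<in>UNIV. (t $ i) *\<^sub>R partial_deriv i u x)"
    by (intro bounded_linear_sum bounded_linear_scaleR_const bounded_linear_vec_nth)
  have est: "\<exists>\<delta>>0. \<forall>t. norm t < \<delta> \<longrightarrow>
      norm (u (x + t) - u x - (\<Sum>i\<in>UNIV. (t $ i) *\<^sub>R partial_deriv i u x)) \<le> e * norm t"
    if "e > 0" for e
  proof -
    \<comment> \<open>Each of the \<open>CARD('d)\<close> axis steps will contribute an error of at
      most \<open>e' * norm t\<close>.\<close>
    define e' where "e' = e / CARD('d)"
    have "e' > 0" using that by (simp add: e'_def)
    have "\<forall>i. \<exists>\<delta>>0. \<forall>y. norm (y - x) < \<delta> \<longrightarrow> norm (partial_deriv i u y - partial_deriv i u x) \<le> e'"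
      using continuous_dist_le[OF cont \<open>e' > 0\<close>] by blast
    then obtain D where D: "\<And>i. D i > 0"
      "\<And>i y. norm (y - x) < D i \<Longrightarrow> norm (partial_deriv i u y - partial_deriv i u x) \<le> e'"
      by metis
    \<comment> \<open>Every intermediate point differs from \<open>x\<close> by at most
      \<open>CARD('d) * norm t\<close>, so this radius keeps it within all the
      \<open>D i\<close>.\<close>
    define \<delta> where "\<delta> = Min (range D) / CARD('d)"
    have "\<delta> > 0" using D by (simp add: \<delta>_def)
    have d: "CARD('d) * \<delta> \<le> D i" for i by (simp add: \<delta>_def)
    { fix t :: "real^'d" assume t: "norm t < \<delta>"
      define p where "p S = (\<Sum>i\<in>S. (t $ i) *\<^sub>R axis i (1::real))" for S :: "'d set"
      have near: "norm (p S + s *\<^sub>R axis a (1::real)) < D i"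
        if "a \<notin> S" "\<bar>s\<bar> \<le> \<bar>t $ a\<bar>" for S a s i
      proof -
        have "norm (p S + s *\<^sub>R axis a (1::real)) \<le> (\<Sum>i\<in>S. norm t) + norm t"
          unfolding p_def
          by (intro norm_triangle_mono sum_norm_le)
             (use component_le_norm_cart[of t] that in \<open>auto intro: order_trans\<close>)
        also have "\<dots> = card (insert a S) * norm t" using that by (simp add: algebra_simps)
        also have "\<dots> \<le> CARD('d) * norm t" by (intro mult_right_mono) (auto intro: card_mono)
        also have "\<dots> < CARD('d) * \<delta>" using t by simp
        finally show ?thesis using d[of i] by linarith
      qed
      \<comment> \<open>The induction runs over the set of coordinates already moved, so the index
        type can stay unordered.\<close>
      have "norm (u (x + p S) - u x - (\<Sum>i\<in>S. (t $ i) *\<^sub>R partial_deriv i u x)) \<le> card S * (e' * norm t)"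
        if "finite S" for S
        using that
      proof (induction S rule: finite_induct)
        case empty
        then show ?case by (simp add: p_def)
      next
        case (insert a S)
        define g where "g s = u (x + p S + s *\<^sub>R axis a 1) - s *\<^sub>R partial_deriv a u x" for s
        have "norm (g (t $ a) - g 0) \<le> e' * \<bar>t $ a\<bar>"
        proof (rule norm_diff_le_of_vector_derivative)
          fix s assume s: "s \<in> closed_segment 0 (t $ a)"
          show "(g has_vector_derivative partial_deriv a u (x + p S + s *\<^sub>R axis a 1) - partial_deriv a u x) (at s)"
            unfolding g_def by (auto intro!: derivative_eq_intros partial_deriv_line[OF pd])
          have "\<bar>s\<bar> \<le> \<bar>t $ a\<bar>" using s by (auto simp: closed_segment_eq_real_ivl split: if_splits)
          with near[OF insert(2) this] show
            "norm (partial_deriv a u (x + p S + s *\<^sub>R axis a 1) - partial_deriv a u x) \<le> e'"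
            by (intro D) (simp add: add.assoc)
        qed
        also have "\<dots> \<le> e' * norm t"
          using \<open>e' > 0\<close> component_le_norm_cart[of t a] by simp
        finally have 1: "norm (g (t $ a) - g 0) \<le> e' * norm t" .
        have p: "p (insert a S) = p S + (t $ a) *\<^sub>R axis a 1"
          using insert by (simp add: p_def)
        have "u (x + p (insert a S)) - u x - (\<Sum>i\<in>insert a S. (t $ i) *\<^sub>R partial_deriv i u x)
          = (g (t $ a) - g 0) + (u (x + p S) - u x - (\<Sum>i\<in>S. (t $ i) *\<^sub>R partial_deriv i u x))"
          using insert(1,2) unfolding g_def p by (simp add: algebra_simps)
        also have "norm \<dots> \<le> e' * norm t + card S * (e' * norm t)"
          by (intro norm_triangle_mono 1 insert.IH)
        finally show ?case using insert(1,2) by (simp add: algebra_simps)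
      qed
      from this[of UNIV] have "norm (u (x + p UNIV) - u x - (\<Sum>i\<in>UNIV. (t $ i) *\<^sub>R partial_deriv i u x)) \<le> e * norm t"
        by (simp add: e'_def)
      moreover have "p UNIV = t"
        unfolding p_def by (simp add: vec_eq_iff axis_def if_distrib[of "\<lambda>c. _ * c"] cong: if_cong)
      ultimately have "norm (u (x + t) - u x - (\<Sum>i\<in>UNIV. (t $ i) *\<^sub>R partial_deriv i u x)) \<le> e * norm t"
        by simp }
    with \<open>\<delta> > 0\<close> show ?thesis by blast
  qed
  show ?thesis
    unfolding has_derivative_at_alt
  proof (intro conjI lin allI impI)
    fix e :: real assume "e > 0"
    from est[OF this] obtain \<delta> where "\<delta> > 0" and *: "\<And>t. norm t < \<delta> \<Longrightarrow>
      norm (u (x + t) - u x - (\<Sum>i\<in>UNIV. (t $ i) *\<^sub>R partial_deriv i u x)) \<le> e * norm t" by blast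
    show "\<exists>d>0. \<forall>y. norm (y - x) < d \<longrightarrow>
      norm (u y - u x - (\<Sum>i\<in>UNIV. ((y - x) $ i) *\<^sub>R partial_deriv i u x)) \<le> e * norm (y - x)"
      using \<open>\<delta> > 0\<close> *[of "_ - x"] by (intro exI[of _ \<delta>]) simp
  qed
qed

text \<open>Schwarz's theorem: the second difference \<open>\<Delta>\<close> is symmetric in
  \<open>i\<close> and \<open>j\<close>, and divided by \<open>h * h\<close> it tends to either
  mixed derivative.\<close>

lemma partial_deriv_commute:
  fixes u :: "real^'d \<Rightarrow> 'b::real_normed_vector"
  assumes "Ck 2 u"
  shows "partial_deriv i (partial_deriv j u) = partial_deriv j (partial_deriv i u)"
proof
  fix x
  define \<Delta> where "\<Delta> i j h = (u (x + h *\<^sub>R axis i 1 + h *\<^sub>R axis j 1) - u (x + h *\<^sub>R axis i 1))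
      - (u (x + h *\<^sub>R axis j 1) - u x)" for i j h
  have pd: "has_partial_derivs u" "has_partial_derivs (partial_deriv i u)"
    "continuous_on UNIV (partial_deriv j (partial_deriv i u))" for i j
    using assms by (auto simp: numeral_2_eq_2)
  have est: "\<exists>\<delta>>0. \<forall>h. 0 < h \<and> h < \<delta> \<longrightarrow>
      norm (\<Delta> i j h - (h * h) *\<^sub>R partial_deriv j (partial_deriv i u) x) \<le> e * h * h"
    if e: "e > 0" for e i j
  proof -
    let ?D = "partial_deriv j (partial_deriv i u)"
    from continuous_dist_le[OF pd(3)[of j i] e, of x]
    obtain \<delta> where \<delta>: "\<delta> > 0" "\<And>y. norm (y - x) < \<delta> \<Longrightarrow> norm (?D y - ?D x) \<le> e" by blast
    \<comment> \<open>The points involved move by at most \<open>h\<close> along each of the two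
      axes, hence stay within \<open>2 * h\<close> of \<open>x\<close>.\<close>
    have "norm (\<Delta> i j h - (h * h) *\<^sub>R ?D x) \<le> e * h * h" if h: "0 < h" "h < \<delta> / 2" for h
    proof -
      \<comment> \<open>With the multiple of the mixed derivative subtracted, two mean value
        estimates in a row, for \<open>g\<close> in direction \<open>i\<close> and for
        \<open>k\<close> in direction \<open>j\<close>, each gain one factor
        \<open>h\<close>.\<close>
      define g where "g s = u (x + h *\<^sub>R axis j 1 + s *\<^sub>R axis i 1) - u (x + s *\<^sub>R axis i 1) - (s * h) *\<^sub>R ?D x" for s
      define g' where "g' s = partial_deriv i u (x + h *\<^sub>R axis j 1 + s *\<^sub>R axis i 1)
          - partial_deriv i u (x + s *\<^sub>R axis i 1) - h *\<^sub>R ?D x" for s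
      have "norm (g h - g 0) \<le> (e * h) * \<bar>h\<bar>"
      proof (rule norm_diff_le_of_vector_derivative)
        fix s assume "s \<in> closed_segment 0 h"
        then have s: "0 \<le> s" "s \<le> h" using h by (auto simp: closed_segment_eq_real_ivl)
        show "(g has_vector_derivative g' s) (at s)"
          unfolding g_def g'_def by (auto intro!: derivative_eq_intros partial_deriv_line[OF pd(1)])
        define k where "k r = partial_deriv i u (x + s *\<^sub>R axis i 1 + r *\<^sub>R axis j 1) - r *\<^sub>R ?D x" for r
        have "norm (k h - k 0) \<le> e * \<bar>h\<bar>"
        proof (rule norm_diff_le_of_vector_derivative)
          fix r assume "r \<in> closed_segment 0 h"
          then have r: "0 \<le> r" "r \<le> h" using h by (auto simp: closed_segment_eq_real_ivl)
          show "(k has_vector_derivative ?D (x + s *\<^sub>R axis i 1 + r *\<^sub>R axis j 1) - ?D x) (at r)"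
            unfolding k_def by (auto intro!: derivative_eq_intros partial_deriv_line[OF pd(2)])
          have "norm (s *\<^sub>R axis i 1 + r *\<^sub>R axis j (1::real)) \<le> s + r"
            using norm_triangle_ineq[of "s *\<^sub>R axis i (1::real)" "r *\<^sub>R axis j 1"] s r by simp
          then show "norm (?D (x + s *\<^sub>R axis i 1 + r *\<^sub>R axis j 1) - ?D x) \<le> e"
            using s r h by (intro \<delta>) (simp add: add.assoc)
        qed
        then show "norm (g' s) \<le> e * h"
          using h by (simp add: k_def g'_def algebra_simps)
      qed
      then show ?thesis using h by (simp add: \<Delta>_def g_def algebra_simps)
    qed
    then show ?thesis using \<delta> by (intro exI[of _ "\<delta>/2"]) auto
  qed
  have sym: "\<Delta> i j h = \<Delta> j i h" for h by (simp add: \<Delta>_def algebra_simps)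
  let ?L = "partial_deriv i (partial_deriv j u) x" and ?R = "partial_deriv j (partial_deriv i u) x"
  have "norm (?L - ?R) \<le> 0 + e" if "e > 0" for e
  proof -
    have "e/2 > 0" using that by simp
    from est[OF this, of j i] est[OF this, of i j] obtain d1 d2 where d: "d1 > 0" "d2 > 0"
      and 1: "\<And>h. 0 < h \<and> h < d1 \<Longrightarrow> norm (\<Delta> j i h - (h * h) *\<^sub>R ?L) \<le> e/2 * h * h"
      and 2: "\<And>h. 0 < h \<and> h < d2 \<Longrightarrow> norm (\<Delta> i j h - (h * h) *\<^sub>R ?R) \<le> e/2 * h * h"
      by blast
    define h where "h = min d1 d2 / 2"
    have h: "0 < h" "h < d1" "h < d2" using d by (auto simp: h_def)
    have "(h * h) * norm (?L - ?R) = norm ((h * h) *\<^sub>R (?L - ?R))" using h by simp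
    also have "(h * h) *\<^sub>R (?L - ?R) = (\<Delta> i j h - (h * h) *\<^sub>R ?R) - (\<Delta> j i h - (h * h) *\<^sub>R ?L)"
      by (simp add: sym algebra_simps)
    also have "norm \<dots> \<le> e/2 * h * h + e/2 * h * h"
      using 1[of h] 2[of h] h by (intro order_trans[OF norm_triangle_ineq4 add_mono]) auto
    also have "\<dots> = (h * h) * e" by (simp add: field_simps)
    finally show ?thesis using h by simp
  qed
  then have "norm (?L - ?R) \<le> 0" by (rule field_le_epsilon)
  then show "?L = ?R" by simp
qed

lemma has_vector_derivative_along:
  fixes u :: "real^'d \<Rightarrow> 'b::real_normed_vector"
  assumes "Ck 1 u"
  shows "((\<lambda>s. u (x + s *\<^sub>R t)) has_vector_derivative
           (\<Sum>i\<in>UNIV. (t $ i) *\<^sub>R partial_deriv i u (x + s *\<^sub>R t))) (at s)"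
proof -
  have "((\<lambda>s. x + s *\<^sub>R t) has_derivative (\<lambda>h. h *\<^sub>R t)) (at s)"
    by (auto intro!: derivative_eq_intros)
  from has_derivative_compose[OF this has_derivative_of_partials[OF assms]]
  show ?thesis
    by (simp add: has_vector_derivative_def scaleR_sum_right)
qed

lemma partial_deriv_eqI:
  assumes "\<And>x. ((\<lambda>s. u (x + s *\<^sub>R axis i 1)) has_vector_derivative v x) (at 0)"
  shows "partial_deriv i u = v"
  using assms by (auto simp: partial_deriv_def fun_eq_iff intro: vector_derivative_at)

lemma has_partial_derivsI:
  assumes "\<And>i x. ((\<lambda>s. u (x + s *\<^sub>R axis i 1)) has_vector_derivative v i x) (at 0)"
  shows "has_partial_derivs u"
  using assms unfolding has_partial_derivs_def by (metis differentiableI_vector)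

lemma partial_deriv_at0:
  assumes "has_partial_derivs u"
  shows "((\<lambda>s. u (x + s *\<^sub>R axis i 1)) has_vector_derivative partial_deriv i u x) (at 0)"
  using partial_deriv_line[OF assms, of x i 0] by simp

section \<open>Closure properties of the classes C^n\<close>

lemma Ck_const: "Ck n (\<lambda>x::real^'d. c)"
proof (induction n arbitrary: c)
  case (Suc n)
  have "partial_deriv i (\<lambda>x::real^'d. c) = (\<lambda>x. 0)" "has_partial_derivs (\<lambda>x::real^'d. c)" for i
    by (simp_all add: partial_deriv_def has_partial_derivs_def fun_eq_iff)
  then show ?case using Suc by simp
qed simp

lemma Ck_add: "Ck n u \<Longrightarrow> Ck n v \<Longrightarrow> Ck n (\<lambda>x. u x + v x)"
proof (induction n arbitrary: u v)
  case 0
  then show ?case by (auto intro: continuous_intros)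
next
  case (Suc n)
  have d: "((\<lambda>s. u (x + s *\<^sub>R axis i 1) + v (x + s *\<^sub>R axis i 1)) has_vector_derivative
      partial_deriv i u x + partial_deriv i v x) (at 0)" for i x
    using Suc.prems by (auto intro!: derivative_intros partial_deriv_at0)
  have "partial_deriv i (\<lambda>x. u x + v x) = (\<lambda>x. partial_deriv i u x + partial_deriv i v x)" for i
    by (rule partial_deriv_eqI) (rule d)
  moreover have "has_partial_derivs (\<lambda>x. u x + v x)" by (rule has_partial_derivsI) (rule d)
  ultimately show ?case using Suc by (auto intro: continuous_intros)
qed

lemma Ck_scaleR: "Ck n u \<Longrightarrow> Ck n (\<lambda>x. c *\<^sub>R u x)"
proof (induction n arbitrary: u)
  case 0
  then show ?case by (auto intro: continuous_intros)
next
  case (Suc n)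
  have d: "((\<lambda>s. c *\<^sub>R u (x + s *\<^sub>R axis i 1)) has_vector_derivative
      c *\<^sub>R partial_deriv i u x) (at 0)" for i x
    using Suc.prems partial_deriv_at0[of u x i] by (auto intro!: derivative_eq_intros)
  have "partial_deriv i (\<lambda>x. c *\<^sub>R u x) = (\<lambda>x. c *\<^sub>R partial_deriv i u x)" for i
    by (rule partial_deriv_eqI) (rule d)
  moreover have "has_partial_derivs (\<lambda>x. c *\<^sub>R u x)" by (rule has_partial_derivsI) (rule d)
  ultimately show ?case using Suc by (auto intro: continuous_intros)
qed

lemma Ck_sum: "finite S \<Longrightarrow> (\<And>i. i \<in> S \<Longrightarrow> Ck n (u i)) \<Longrightarrow> Ck n (\<lambda>x. \<Sum>i\<in>S. u i x)"
  by (induction S rule: finite_induct) (auto intro: Ck_add Ck_const)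

text \<open>By the chain rule a partial of the composition is a fixed linear combination of the
  partials of \<open>u\<close>, each composed with the same affine map, so the induction hypothesis
  applies to every term.\<close>

lemma Ck_affine:
  fixes A :: "real^'e^'d" and u :: "real^'d \<Rightarrow> 'b::real_normed_vector"
  shows "Ck n u \<Longrightarrow> Ck n (\<lambda>x. u (A *v x + c))"
proof (induction n arbitrary: u)
  case 0
  then show ?case
    by (auto intro!: continuous_on_compose2[of UNIV u] continuous_intros matrix_vector_mult_linear_continuous_on)
next
  case (Suc n)
  have cont: "continuous_on UNIV (\<lambda>x. u (A *v x + c))"
    using Suc.prems
    by (auto intro!: continuous_on_compose2[of UNIV u] continuous_intros matrix_vector_mult_linear_continuous_on)
  have C1: "Ck 1 u" using Suc.prems by (auto intro: Ck_mono Ck_continuous)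
  have e: "A *v axis i 1 = column i A" for i by (simp add: matrix_vector_mult_basis)
  have d: "((\<lambda>s. u (A *v (x + s *\<^sub>R axis i 1) + c)) has_vector_derivative
      (\<Sum>k\<in>UNIV. (A $ k $ i) *\<^sub>R partial_deriv k u (A *v x + c))) (at 0)" for i x
    using has_vector_derivative_along[OF C1, of "A *v x + c" "column i A" 0]
    by (simp add: matrix_vector_right_distrib matrix_vector_mult_scaleR e column_def algebra_simps)
  have "partial_deriv i (\<lambda>x. u (A *v x + c))
      = (\<lambda>x. \<Sum>k\<in>UNIV. (A $ k $ i) *\<^sub>R partial_deriv k u (A *v x + c))" for i
    by (rule partial_deriv_eqI) (rule d)
  moreover have "has_partial_derivs (\<lambda>x. u (A *v x + c))" by (rule has_partial_derivsI) (rule d)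
  ultimately show ?case using Suc cont by (auto intro!: Ck_sum Ck_scaleR)
qed

declare Ck.simps(2) [simp del]

lemma Ck_translate: "Ck n u \<Longrightarrow> Ck n (\<lambda>x. u (x + c))"
  using Ck_affine[of n u "mat 1" c] by simp

lemma iter_partial_translate:
  "iter_partial is (\<lambda>x. u (x + c)) = (\<lambda>x. iter_partial is u (x + c))"
  by (induction "is") (auto simp: partial_deriv_def fun_eq_iff algebra_simps)

lemma mi_deriv_translate: "mi_deriv \<beta> (\<lambda>x. u (x + c)) = (\<lambda>x. mi_deriv \<beta> u (x + c))"
  by (simp add: mi_deriv_def iter_partial_translate)

section \<open>Independence of the order of differentiation\<close>

lemma Ck_iter_partial: "Ck (length is + m) u \<Longrightarrow> Ck m (iter_partial is u)"
proof (induction "is" arbitrary: m)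
  case (Cons i "is")
  then have "Ck (Suc m) (iter_partial is u)" by simp
  then show ?case by (simp add: Ck_SucD)
qed simp

text \<open>The entry \<open>i\<close> is brought to the front by commuting it with the entries
  before it, one swap at a time.\<close>

lemma iter_partial_remove1:
  assumes "i \<in> set is" "Ck (length is) u"
  shows "iter_partial is u = partial_deriv i (iter_partial (remove1 i is) u)"
  using assms
proof (induction "is")
  case (Cons a "is")
  show ?case
  proof (cases "a = i")
    case False
    then have i: "i \<in> set is" using Cons by auto
    then have "iter_partial is u = partial_deriv i (iter_partial (remove1 i is) u)"
      using Cons Ck_Suc_imp by auto
    \<comment> \<open>Two differentiations, by \<open>a\<close> and by \<open>i\<close>, are still
      to be applied, so the function reached so far is of class C^2 and they may be swapped.\<close>
    moreover have "length (remove1 i is) + 2 = length (a # is)"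
      using i length_pos_if_in_set[OF i] by (simp add: length_remove1)
    with Cons.prems(2) have "Ck 2 (iter_partial (remove1 i is) u)"
      by (intro Ck_iter_partial) simp
    ultimately show ?thesis using False by (simp add: partial_deriv_commute[of _ a i])
  qed simp
qed simp

lemma iter_partial_mset_cong:
  assumes "mset is = mset js" "Ck (length is) u"
  shows "iter_partial is u = iter_partial js u"
  using assms
proof (induction "is" arbitrary: js)
  case (Cons a "is")
  have a: "a \<in> set js" using Cons.prems(1) by (metis list.set_intros(1) mset_eq_setD)
  have l: "length js = length (a # is)" using Cons.prems(1) by (metis mset_eq_length)
  have "iter_partial js u = partial_deriv a (iter_partial (remove1 a js) u)"
    using a Cons.prems l by (intro iter_partial_remove1) auto
  moreover have "mset is = mset (remove1 a js)" using Cons.prems(1)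
    by (metis add_mset_remove_trivial mset.simps(2) mset_remove1)
  moreover have "Ck (length is) u" using Cons.prems(2) by (simp add: Ck_Suc_imp)
  ultimately show ?case using Cons.IH[of "remove1 a js"] by simp
qed simp

lemma length_eq_mi_order:
  assumes "\<forall>i. count_list is i = (\<beta> :: nat^'d) $ i"
  shows "length is = mi_order \<beta>"
proof -
  have "length is = size (mset is)" by simp
  also have "\<dots> = (\<Sum>i\<in>set is. count_list is i)" by (simp add: sum_count_set)
  also have "\<dots> = (\<Sum>i\<in>UNIV. count_list is i)"
    by (intro sum.mono_neutral_left) (auto simp: count_list_0_iff)
  finally show ?thesis using assms by (simp add: mi_order_def)
qed

text \<open>This eliminates the arbitrary choice in \<open>mi_deriv\<close>. Later proofs take the
  list that suits them: one with an extra entry in \<open>partial_deriv_mi_deriv\<close>, a reversed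
  one in integration by parts.\<close>

lemma mi_deriv_eq_iter_partial:
  fixes \<beta> :: "nat^'d"
  assumes "\<forall>i. count_list is i = \<beta> $ i" "Ck (mi_order \<beta>) u"
  shows "mi_deriv \<beta> u = iter_partial is u"
proof -
  let ?js = "SOME js. \<forall>i. count_list js i = \<beta> $ i"
  have js: "\<forall>i. count_list ?js i = \<beta> $ i" using someI_ex[OF ex_list_mi] .
  have "mset ?js = mset is" 
    using js assms(1) by (simp add: multiset_eq_iff count_mset)
  moreover have "Ck (length ?js) u" using length_eq_mi_order[OF js] assms(2) by simp
  ultimately show ?thesis unfolding mi_deriv_def by (rule iter_partial_mset_cong)
qed

definition mi_unit :: "'d \<Rightarrow> nat^'d" where
  "mi_unit i = (\<chi> k. if k = i then 1 else 0)"

lemma mi_order_add_unit: fixes \<beta> :: "nat^'d" shows "mi_order (\<beta> + mi_unit i) = Suc (mi_order \<beta>)"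
  by (simp add: mi_order_def mi_unit_def sum.distrib)

lemma partial_deriv_mi_deriv:
  assumes "Ck (Suc (mi_order \<beta>)) u"
  shows "partial_deriv i (mi_deriv \<beta> u) = mi_deriv (\<beta> + mi_unit i) u"
proof -
  obtain "is" where l: "\<forall>i. count_list is i = \<beta> $ i" using ex_list_mi by blast
  then have 1: "mi_deriv \<beta> u = iter_partial is u"
    using Ck_Suc_imp[OF assms] by (rule mi_deriv_eq_iter_partial)
  have "mi_deriv (\<beta> + mi_unit i) u = iter_partial (i # is) u"
    using l assms by (intro mi_deriv_eq_iter_partial) (auto simp: mi_order_add_unit, auto simp: mi_unit_def)
  with 1 show ?thesis by simp
qed

lemma Ck_mi_deriv:
  assumes "Ck (mi_order \<beta> + m) u"
  shows "Ck m (mi_deriv \<beta> u)"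
proof -
  obtain "is" where l: "\<forall>i. count_list is i = \<beta> $ i" using ex_list_mi by blast
  then have 1: "mi_deriv \<beta> u = iter_partial is u"
    using assms Ck_mono[of _ u "mi_order \<beta>"] by (intro mi_deriv_eq_iter_partial) auto
  then show ?thesis using assms length_eq_mi_order[OF l] by (simp add: Ck_iter_partial)
qed

lemma mi_order_0_iff: "mi_order \<beta> = 0 \<longleftrightarrow> \<beta> = 0"
  by (auto simp: mi_order_def vec_eq_iff)

lemma mi_deriv_0: "mi_deriv (0 :: nat^'a) u = u"
proof -
  have "(SOME js. \<forall>i::'a. count_list js i = (0 :: nat^'a) $ i) = []"
    by (rule some_equality) (auto, metis count_list_0_iff list.set_intros(1) neq_Nil_conv)
  then show ?thesis by (simp add: mi_deriv_def)
qed

section \<open>Differentials along a line\<close>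

lemma finite_mi_order_eq: "finite {\<beta> :: nat^'d. mi_order \<beta> = l}"
  by (rule finite_subset[OF _ finite_mi_Delta[of "Suc l"]]) (auto simp: mi_Delta_def)

text \<open>The \<open>l\<close>-th differential of \<open>u\<close> at \<open>x\<close> evaluated on \<open>(t, \<dots>, t)\<close>.\<close>

definition dir_deriv :: "nat \<Rightarrow> (real^'d \<Rightarrow> 'b::real_normed_vector) \<Rightarrow> real^'d \<Rightarrow> real^'d \<Rightarrow> 'b" where
  "dir_deriv l u x t =
     (\<Sum>\<beta>\<in>{\<beta>. mi_order \<beta> = l}. (fact l / mi_fact \<beta> * mi_monom \<beta> t) *\<^sub>R mi_deriv \<beta> u x)"

lemma dir_deriv_0: "dir_deriv 0 u x t = u x"
  by (simp add: dir_deriv_def mi_order_0_iff mi_deriv_0 mi_fact_def mi_monom_def)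

lemma mi_monom_add_unit: "mi_monom (\<beta> + mi_unit i) t = t $ i * mi_monom \<beta> t"
proof -
  have "mi_monom (\<beta> + mi_unit i) t = (\<Prod>k\<in>UNIV. (t $ k) ^ (\<beta> $ k) * (if k = i then t $ i else 1))"
    unfolding mi_monom_def by (intro prod.cong) (auto simp: mi_unit_def)
  then show ?thesis by (simp add: prod.distrib mi_monom_def mult.commute)
qed

lemma mi_fact_add_unit: "mi_fact (\<beta> + mi_unit i) = (\<beta> $ i + 1) * mi_fact \<beta>"
proof -
  have "mi_fact (\<beta> + mi_unit i) = (\<Prod>k\<in>UNIV. fact (\<beta> $ k) * (if k = i then real (\<beta> $ i + 1) else 1))"
    unfolding mi_fact_def by (intro prod.cong) (auto simp: mi_unit_def algebra_simps)
  then show ?thesis by (simp add: prod.distrib mi_fact_def mult.commute)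
qed

lemma mi_fact_ge_1: "mi_fact \<beta> \<ge> 1"
  unfolding mi_fact_def by (intro prod_ge_1) (simp add: fact_ge_1)

text \<open>The multinomial recursion: a multi-index \<open>\<gamma>\<close> of order
  \<open>Suc l\<close> is reached from \<open>\<gamma> - mi_unit i\<close> with weight
  \<open>\<gamma> $ i\<close>, and these weights add up to \<open>Suc l\<close>, which turns
  \<open>fact l\<close> into \<open>fact (Suc l)\<close>.\<close>

lemma dir_deriv_has_vector_derivative:
  fixes u :: "real^'d \<Rightarrow> 'b::real_normed_vector"
  assumes "Ck (Suc l) u"
  shows "((\<lambda>s. dir_deriv l u (x + s *\<^sub>R t) t) has_vector_derivative dir_deriv (Suc l) u (x + s *\<^sub>R t) t) (at s)"
proof -
  let ?y = "x + s *\<^sub>R t"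
  let ?S = "\<lambda>l. {\<beta> :: nat^'d. mi_order \<beta> = l}"
  let ?c = "\<lambda>l (\<beta> :: nat^'d). fact l / mi_fact \<beta> * mi_monom \<beta> t :: real"
  have "((\<lambda>s. dir_deriv l u (x + s *\<^sub>R t) t) has_vector_derivative
      (\<Sum>\<beta>\<in>?S l. ?c l \<beta> *\<^sub>R (\<Sum>i\<in>UNIV. (t $ i) *\<^sub>R mi_deriv (\<beta> + mi_unit i) u ?y))) (at s)"
    unfolding dir_deriv_def
  proof (intro has_vector_derivative_sum)
    fix \<beta> :: "nat^'d" assume b: "\<beta> \<in> ?S l"
    then have "Ck 1 (mi_deriv \<beta> u)" using assms by (intro Ck_mi_deriv) simp
    from has_vector_derivative_along[OF this, of x t s]
    have "((\<lambda>s. mi_deriv \<beta> u (x + s *\<^sub>R t)) has_vector_derivative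
        (\<Sum>i\<in>UNIV. (t $ i) *\<^sub>R mi_deriv (\<beta> + mi_unit i) u ?y)) (at s)"
      using partial_deriv_mi_deriv[of \<beta> u] assms b by simp
    from bounded_linear.has_vector_derivative[OF bounded_linear_scaleR_right this]
    show "((\<lambda>s. ?c l \<beta> *\<^sub>R mi_deriv \<beta> u (x + s *\<^sub>R t)) has_vector_derivative
        ?c l \<beta> *\<^sub>R (\<Sum>i\<in>UNIV. (t $ i) *\<^sub>R mi_deriv (\<beta> + mi_unit i) u ?y)) (at s)" .
  qed
  also have "(\<Sum>\<beta>\<in>?S l. ?c l \<beta> *\<^sub>R (\<Sum>i\<in>UNIV. (t $ i) *\<^sub>R mi_deriv (\<beta> + mi_unit i) u ?y))
     = (\<Sum>i\<in>UNIV. \<Sum>\<beta>\<in>?S l. (?c l \<beta> * t $ i) *\<^sub>R mi_deriv (\<beta> + mi_unit i) u ?y)"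
    by (subst sum.swap) (simp add: scaleR_sum_right)
  also have "\<dots> = (\<Sum>i\<in>UNIV. \<Sum>\<gamma>\<in>?S (Suc l). (real (\<gamma> $ i) * fact l / mi_fact \<gamma> * mi_monom \<gamma> t) *\<^sub>R mi_deriv \<gamma> u ?y)"
  proof (rule sum.cong[OF refl])
    fix i
    have inj: "inj_on (\<lambda>\<beta>. \<beta> + mi_unit i) (?S l)" by (auto simp: inj_on_def)
    have sub: "(\<lambda>\<beta>. \<beta> + mi_unit i) ` ?S l \<subseteq> ?S (Suc l)" by (auto simp: mi_order_add_unit)
    \<comment> \<open>A multi-index that does not arise by adding \<open>mi_unit i\<close> has zero
      \<open>i\<close>-th entry, hence zero weight, and may be included in the sum.\<close>
    have zero: "\<gamma> $ i = 0" if g: "\<gamma> \<in> ?S (Suc l) - (\<lambda>\<beta>. \<beta> + mi_unit i) ` ?S l" for \<gamma>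
    proof (rule ccontr)
      assume "\<gamma> $ i \<noteq> 0"
      then have e: "\<gamma> = (\<chi> k. \<gamma> $ k - mi_unit i $ k) + mi_unit i"
        by (auto simp: vec_eq_iff mi_unit_def)
      then have "mi_order (\<chi> k. \<gamma> $ k - mi_unit i $ k) = l"
        using g mi_order_add_unit[of "\<chi> k. \<gamma> $ k - mi_unit i $ k" i] by simp
      with e g show False by blast
    qed
    have "(\<Sum>\<beta>\<in>?S l. (?c l \<beta> * t $ i) *\<^sub>R mi_deriv (\<beta> + mi_unit i) u ?y)
      = (\<Sum>\<beta>\<in>?S l. (real ((\<beta> + mi_unit i) $ i) * fact l / mi_fact (\<beta> + mi_unit i) * mi_monom (\<beta> + mi_unit i) t)
            *\<^sub>R mi_deriv (\<beta> + mi_unit i) u ?y)"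
    proof (intro sum.cong refl arg_cong2[where f="(*\<^sub>R)"])
      fix \<beta> :: "nat^'d"
      have "mi_fact \<beta> \<noteq> 0" using mi_fact_ge_1[of \<beta>] by linarith
      moreover have "a / F * m * x = (b + 1) * a / ((b + 1) * F) * (x * m)"
        if "b \<ge> 0" "F \<noteq> 0" for a b F m x :: real
        using that by (simp add: add_nonneg_eq_0_iff)
      ultimately show "?c l \<beta> * t $ i = real ((\<beta> + mi_unit i) $ i) * fact l / mi_fact (\<beta> + mi_unit i) * mi_monom (\<beta> + mi_unit i) t"
        by (simp add: mi_fact_add_unit mi_monom_add_unit add.commute[of 1]) (simp add: mi_unit_def add.commute[of 1] del: times_divide_eq_left times_divide_eq_right)
    qed
    also have "\<dots> = (\<Sum>\<gamma>\<in>(\<lambda>\<beta>. \<beta> + mi_unit i) ` ?S l. (real (\<gamma> $ i) * fact l / mi_fact \<gamma> * mi_monom \<gamma> t) *\<^sub>R mi_deriv \<gamma> u ?y)"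
      by (simp add: sum.reindex[OF inj])
    also have "\<dots> = (\<Sum>\<gamma>\<in>?S (Suc l). (real (\<gamma> $ i) * fact l / mi_fact \<gamma> * mi_monom \<gamma> t) *\<^sub>R mi_deriv \<gamma> u ?y)"
      using zero by (intro sum.mono_neutral_left finite_mi_order_eq sub) auto
    finally show "(\<Sum>\<beta>\<in>?S l. (?c l \<beta> * t $ i) *\<^sub>R mi_deriv (\<beta> + mi_unit i) u ?y)
      = (\<Sum>\<gamma>\<in>?S (Suc l). (real (\<gamma> $ i) * fact l / mi_fact \<gamma> * mi_monom \<gamma> t) *\<^sub>R mi_deriv \<gamma> u ?y)" .
  qed
  also have "\<dots> = (\<Sum>\<gamma>\<in>?S (Suc l). (real (\<Sum>i\<in>UNIV. \<gamma> $ i) * fact l / mi_fact \<gamma> * mi_monom \<gamma> t) *\<^sub>R mi_deriv \<gamma> u ?y)"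
    by (subst sum.swap) (simp add: scaleR_sum_left[symmetric] sum_distrib_right sum_divide_distrib)
  also have "\<dots> = dir_deriv (Suc l) u ?y t"
    unfolding dir_deriv_def by (intro sum.cong refl) (auto simp: mi_order_def)
  finally show ?thesis .
qed

text \<open>Both sides are the \<open>l\<close>-th derivative of one function of a real variable,
  the restriction of \<open>f\<close> to the line through \<open>A *v k\<close> in direction
  \<open>A *v t\<close>. Uniqueness of derivatives thus replaces a chain rule for
  multi-indices.\<close>

lemma dir_deriv_linear_comp:
  fixes f :: "real^'d \<Rightarrow> 'b::real_normed_vector" and A :: "real^'e^'d"
  assumes "Ck n f" "l \<le> n"
  shows "dir_deriv l (\<lambda>x. f (A *v x)) k t = dir_deriv l f (A *v k) (A *v t)"
proof -
  \<comment> \<open>The equation is proved at all points of the line, because the induction step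
    differentiates it in \<open>s\<close>.\<close>
  have "dir_deriv l (\<lambda>x. f (A *v x)) (k + s *\<^sub>R t) t = dir_deriv l f (A *v k + s *\<^sub>R (A *v t)) (A *v t)" for s
    using assms(2)
  proof (induction l arbitrary: s)
    case 0
    then show ?case by (simp add: dir_deriv_0 matrix_vector_right_distrib matrix_vector_mult_scaleR)
  next
    case (Suc l)
    have "Ck (Suc l) f" using assms(1) Suc.prems by (rule Ck_mono)
    moreover from Ck_affine[OF this, of A 0] have "Ck (Suc l) (\<lambda>x. f (A *v x))" by simp
    ultimately show ?case
      using dir_deriv_has_vector_derivative[of l "\<lambda>x. f (A *v x)" k t s]
        dir_deriv_has_vector_derivative[of l f "A *v k" "A *v t" s] Suc
      by (simp add: vector_derivative_unique_at)
  qed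
  from this[of 0] show ?thesis by simp
qed

lemma abs_mi_monom_le: "\<bar>mi_monom \<beta> t\<bar> \<le> norm t ^ mi_order \<beta>"
  unfolding mi_monom_def mi_order_def abs_prod power_sum
  by (intro prod_mono) (auto simp: power_abs intro!: power_mono component_le_norm_cart)

section \<open>Mollifiers\<close>

text \<open>The flat function exp(-1/x) together with polynomial multiples in 1/x. The family
  contains its own derivatives, so smoothness of all members follows from one differentiation
  rule.\<close>

definition exp_inv_poly :: "real poly \<Rightarrow> real \<Rightarrow> real" where
  "exp_inv_poly P x = (if x > 0 then poly P (1 / x) * exp (- (1 / x)) else 0)"

lemma poly_mult_exp_minus_tendsto_0:
  "((\<lambda>y::real. poly P y * exp (- y)) \<longlongrightarrow> 0) at_top"
proof -
  have "((\<lambda>y. \<Sum>k\<le>degree P. coeff P k * (y ^ k / exp y)) \<longlongrightarrow> (\<Sum>k\<le>degree P. coeff P k * 0)) at_top"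
    by (intro tendsto_intros tendsto_power_div_exp_0)
  moreover have "poly P y * exp (- y) = (\<Sum>k\<le>degree P. coeff P k * (y ^ k / exp y))" for y :: real
    by (simp add: poly_altdef exp_minus sum_divide_distrib divide_inverse sum_distrib_right mult.assoc)
  ultimately show ?thesis by simp
qed

lemma exp_inv_poly_tendsto_0: "(exp_inv_poly P \<longlongrightarrow> 0) (at 0)"
proof -
  have "((\<lambda>x. poly P (inverse x) * exp (- (inverse x))) \<longlongrightarrow> 0) (at_right 0)"
    by (rule filterlim_compose[OF poly_mult_exp_minus_tendsto_0 filterlim_inverse_at_top_right])
  then have "(exp_inv_poly P \<longlongrightarrow> 0) (at_right 0)"
    by (rule Lim_transform_eventually)
       (auto simp: exp_inv_poly_def eventually_at_filter inverse_eq_divide)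
  moreover have "(exp_inv_poly P \<longlongrightarrow> 0) (at_left 0)"
    by (rule tendsto_eventually) (auto simp: exp_inv_poly_def eventually_at_filter)
  ultimately show ?thesis by (simp add: filterlim_split_at)
qed

lemma DERIV_exp_inv_poly:
  "(exp_inv_poly P has_real_derivative exp_inv_poly ((P - pderiv P) * [:0, 0, 1:]) x) (at x)"
proof -
  consider "x > 0" | "x < 0" | "x = 0" by linarith
  then show ?thesis
  proof cases
    case 1
    have "((\<lambda>x. poly P (1 / x) * exp (- (1 / x))) has_real_derivative
        exp_inv_poly ((P - pderiv P) * [:0, 0, 1:]) x) (at x)"
      using 1 by (auto intro!: derivative_eq_intros DERIV_chain2[OF poly_DERIV]
        simp: exp_inv_poly_def field_simps power2_eq_square)
    then show ?thesis
      by (rule has_field_derivative_transform_within_open[of _ _ _ "{0<..}"])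
         (use 1 in \<open>auto simp: exp_inv_poly_def\<close>)
  next
    case 2
    have "((\<lambda>x. 0) has_real_derivative exp_inv_poly ((P - pderiv P) * [:0, 0, 1:]) x) (at x)"
      using 2 by (simp add: exp_inv_poly_def)
    then show ?thesis
      by (rule has_field_derivative_transform_within_open[of _ _ _ "{..<0}"])
         (use 2 in \<open>auto simp: exp_inv_poly_def\<close>)
  next
    case 3
    \<comment> \<open>At 0 the difference quotient is again a member of the family, with one more
      factor 1/x, and its limit is already known.\<close>
    have "(\<lambda>h. (exp_inv_poly P (0 + h) - exp_inv_poly P 0) / h) = exp_inv_poly ([:0, 1:] * P)"
      by (auto simp: exp_inv_poly_def fun_eq_iff)
    moreover have "exp_inv_poly ((P - pderiv P) * [:0, 0, 1:]) 0 = 0" by (simp add: exp_inv_poly_def)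
    ultimately show ?thesis
      unfolding DERIV_def 3 using exp_inv_poly_tendsto_0 by (simp only:)
  qed
qed

text \<open>An algebra of functions that is closed under partial derivatives. Hence a single
  differentiation rule, \<open>smooth_gen_has_partial\<close>, gives all orders of smoothness at
  once, also for products.\<close>

inductive smooth_gen :: "(real^'d \<Rightarrow> real) \<Rightarrow> bool" where
  base: "smooth_gen (\<lambda>y. exp_inv_poly P (a * y $ i + b))"
| const: "smooth_gen (\<lambda>y. c)"
| add: "smooth_gen u \<Longrightarrow> smooth_gen v \<Longrightarrow> smooth_gen (\<lambda>y. u y + v y)"
| mult: "smooth_gen u \<Longrightarrow> smooth_gen v \<Longrightarrow> smooth_gen (\<lambda>y. u y * v y)"

lemma smooth_gen_continuous: "smooth_gen u \<Longrightarrow> continuous_on UNIV u"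
proof (induction rule: smooth_gen.induct)
  case (base P a i b)
  have "continuous_on UNIV (exp_inv_poly P)"
    by (intro continuous_at_imp_continuous_on ballI DERIV_isCont[OF DERIV_exp_inv_poly])
  then show ?case by (rule continuous_on_compose2) (auto intro!: continuous_intros)
qed (auto intro: continuous_intros)

lemma smooth_gen_has_partial:
  "smooth_gen u \<Longrightarrow>
     \<exists>v. smooth_gen v \<and> (\<forall>x. ((\<lambda>s. u (x + s *\<^sub>R axis k 1)) has_vector_derivative v x) (at 0))"
proof (induction rule: smooth_gen.induct)
  case (base P a i b)
  let ?Q = "(P - pderiv P) * [:0, 0, 1:]"
  have "((\<lambda>s. exp_inv_poly P (a * (x + s *\<^sub>R axis k 1) $ i + b)) has_real_derivative
      exp_inv_poly ?Q (a * x $ i + b) * (a * axis k 1 $ i)) (at 0)" for x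
  proof (rule DERIV_chain2[of "exp_inv_poly P" _ "\<lambda>s. a * (x + s *\<^sub>R axis k 1) $ i + b"])
    show "(exp_inv_poly P has_real_derivative exp_inv_poly ?Q (a * x $ i + b))
        (at (a * (x + 0 *\<^sub>R axis k 1) $ i + b))"
      using DERIV_exp_inv_poly[of P "a * x $ i + b"] by (simp only: scaleR_zero_left add_0_right)
  qed (auto intro!: derivative_eq_intros)
  moreover have "smooth_gen (\<lambda>x. exp_inv_poly ?Q (a * x $ i + b) * (a * axis k 1 $ i))"
    by (intro smooth_gen.intros)
  ultimately show ?case
    by (auto simp: has_real_derivative_iff_has_vector_derivative[symmetric])
next
  case (const c)
  show ?case by (intro exI[of _ "\<lambda>y. 0"]) (auto intro: smooth_gen.intros)
next
  case (add u v)
  then obtain u' v' where "smooth_gen u'" "smooth_gen v'"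
    "\<And>x. ((\<lambda>s. u (x + s *\<^sub>R axis k 1)) has_vector_derivative u' x) (at 0)"
    "\<And>x. ((\<lambda>s. v (x + s *\<^sub>R axis k 1)) has_vector_derivative v' x) (at 0)" by blast
  then show ?case
    by (intro exI[of _ "\<lambda>y. u' y + v' y"]) (auto intro!: smooth_gen.intros derivative_intros)
next
  case (mult u v)
  then obtain u' v' where *: "smooth_gen u'" "smooth_gen v'"
    "\<And>x. ((\<lambda>s. u (x + s *\<^sub>R axis k 1)) has_vector_derivative u' x) (at 0)"
    "\<And>x. ((\<lambda>s. v (x + s *\<^sub>R axis k 1)) has_vector_derivative v' x) (at 0)" by blast
  have "((\<lambda>s. u (x + s *\<^sub>R axis k 1) * v (x + s *\<^sub>R axis k 1)) has_vector_derivative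
      u x * v' x + u' x * v x) (at 0)" for x
    using has_vector_derivative_mult[OF *(3)[of x] *(4)[of x]] by simp
  then show ?case using * mult.hyps
    by (intro exI[of _ "\<lambda>y. u y * v' y + u' y * v y"]) (auto intro!: smooth_gen.intros)
qed

lemma smooth_gen_Ck: "smooth_gen u \<Longrightarrow> Ck n u"
proof (induction n arbitrary: u)
  case 0
  then show ?case by (simp add: smooth_gen_continuous)
next
  case (Suc n)
  have *: "\<exists>v. smooth_gen v \<and> (\<forall>x. ((\<lambda>s. u (x + s *\<^sub>R axis k 1)) has_vector_derivative v x) (at 0))" for k
    by (rule smooth_gen_has_partial[OF Suc.prems])
  then obtain V where V: "\<And>k. smooth_gen (V k)"
    "\<And>k x. ((\<lambda>s. u (x + s *\<^sub>R axis k 1)) has_vector_derivative V k x) (at 0)" by metis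
  have "has_partial_derivs u" by (rule has_partial_derivsI) (rule V)
  moreover have "partial_deriv k u = V k" for k by (rule partial_deriv_eqI) (rule V)
  ultimately show ?case using Suc.IH V(1) smooth_gen_continuous[OF Suc.prems] by (simp add: Ck.simps(2))
qed

lemma smooth_gen_prod: "finite S \<Longrightarrow> (\<And>i. i \<in> S \<Longrightarrow> smooth_gen (u i)) \<Longrightarrow> smooth_gen (\<lambda>y. \<Prod>i\<in>S. u i y)"
  by (induction S rule: finite_induct) (auto intro: smooth_gen.intros)

lemma integrable_continuous_bounded_support:
  fixes u :: "'a::euclidean_space \<Rightarrow> 'b::{banach,second_countable_topology}"
  assumes "continuous_on UNIV u" "\<And>x. u x \<noteq> 0 \<Longrightarrow> norm x \<le> R"
  shows "integrable lborel u"
proof -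
  have "integrable lborel (\<lambda>x. indicator (cball 0 R) x *\<^sub>R u x)"
    using assms by (intro borel_integrable_compact) (auto intro: continuous_on_subset)
  also have "(\<lambda>x. indicator (cball 0 R) x *\<^sub>R u x) = u"
    using assms(2) by (auto simp: fun_eq_iff indicator_def)
  finally show ?thesis .
qed

lemma ex_mollifier:
  fixes x :: "real^'d"
  assumes "\<delta> > 0"
  shows "\<exists>\<psi>. test_function \<psi> \<and> (\<forall>y. \<psi> y \<ge> 0) \<and> (\<forall>y. \<psi> y \<noteq> 0 \<longrightarrow> norm (y - x) \<le> \<delta>) \<and>
     integrable lborel \<psi> \<and> (LINT y|lborel. \<psi> y) = 1"
proof -
  \<comment> \<open>The norm is at most the sum of the \<open>CARD('d)\<close> coordinates, so a
    cube of half side \<open>r\<close> fits into the ball of radius \<open>\<delta>\<close>.\<close>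
  define r where "r = \<delta> / CARD('d)"
  have r: "r > 0" using assms by (simp add: r_def)
  \<comment> \<open>The two arguments are \<open>1 + (y - x) $ i / r\<close> and
    \<open>1 - (y - x) $ i / r\<close>; both are positive exactly when \<open>y\<close> lies in the
    open cube of half side \<open>r\<close> in coordinate \<open>i\<close>.\<close>
  define b where "b y = (\<Prod>i\<in>UNIV. exp_inv_poly 1 ((1/r) * y $ i + (1 - x $ i / r)) *
      exp_inv_poly 1 ((-1/r) * y $ i + (1 + x $ i / r)))" for y
  have sm: "smooth_gen b" unfolding b_def by (intro smooth_gen_prod smooth_gen.intros) auto
  have nn: "b y \<ge> 0" for y unfolding b_def by (intro prod_nonneg) (auto simp: exp_inv_poly_def)
  have pos: "exp_inv_poly 1 ((1/r) * y $ i + (1 - x $ i / r)) * exp_inv_poly 1 ((-1/r) * y $ i + (1 + x $ i / r)) \<noteq> 0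
      \<longleftrightarrow> \<bar>(y - x) $ i\<bar> < r" for y i
  proof -
    have "(1/r) * y $ i + (1 - x $ i / r) = ((y - x) $ i + r) / r"
      "(-1/r) * y $ i + (1 + x $ i / r) = (r - (y - x) $ i) / r"
      using r by (simp_all add: field_simps)
    then show ?thesis using r by (auto simp: exp_inv_poly_def zero_less_divide_iff)
  qed
  have supp: "b y \<noteq> 0 \<longleftrightarrow> (\<forall>i. \<bar>(y - x) $ i\<bar> < r)" for y
    unfolding b_def using pos by (simp add: prod_zero_iff)
  have near: "norm (y - x) \<le> \<delta>" if "b y \<noteq> 0" for y
  proof -
    have "norm (y - x) \<le> (\<Sum>i\<in>UNIV. \<bar>(y - x) $ i\<bar>)" by (rule norm_le_l1_cart)
    also have "\<dots> \<le> (\<Sum>i\<in>(UNIV::'d set). r)" using that supp by (intro sum_mono less_imp_le) blast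
    finally show ?thesis by (simp add: r_def)
  qed
  have cont: "continuous_on UNIV b" by (rule smooth_gen_continuous[OF sm])
  have int: "integrable lborel b"
  proof (rule integrable_continuous_bounded_support[OF cont])
    fix y assume "b y \<noteq> 0"
    from near[OF this] show "norm y \<le> norm x + \<delta>" by norm
  qed
  \<comment> \<open>If the integral vanished, the set where \<open>b\<close> is positive would be
    null, but it is open and contains \<open>x\<close>.\<close>
  have "(LINT y|lborel. b y) \<noteq> 0"
  proof
    assume "(LINT y|lborel. b y) = 0"
    then have "AE y in lborel. b y = 0" using integral_nonneg_eq_0_iff_AE[OF int] nn by auto
    moreover have "{y. b y \<noteq> 0} \<in> sets lborel"
      using open_Collect_neq[OF cont continuous_on_const, of 0] by simp
    ultimately have "{y. b y \<noteq> 0} \<in> null_sets lborel"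
      by (simp add: AE_iff_null_sets)
    then have "negligible {y. b y \<noteq> 0}"
      by (simp add: negligible_iff_null_sets null_sets_completionI)
    moreover have "open {y. b y \<noteq> 0}" by (intro open_Collect_neq cont continuous_on_const)
    moreover have "x \<in> {y. b y \<noteq> 0}" using supp[of x] r by simp
    ultimately show False using open_not_negligible by blast
  qed
  then have I: "(LINT y|lborel. b y) > 0" using nn by (simp add: less_le)
  let ?I = "LINT y|lborel. b y"
  let ?\<psi> = "\<lambda>y. (1 / ?I) *\<^sub>R b y"
  have "compact (closure {y. ?\<psi> y \<noteq> 0})"
  proof -
    have "{y. ?\<psi> y \<noteq> 0} \<subseteq> cball x \<delta>" using near by (auto simp: dist_norm norm_minus_commute)
    then show ?thesis by (meson bounded_cball bounded_subset compact_closure)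
  qed
  then have "test_function ?\<psi>" unfolding test_function_def
    by (intro conjI allI Ck_scaleR smooth_gen_Ck sm)
  moreover have "(LINT y|lborel. ?\<psi> y) = 1" using I by simp
  ultimately show ?thesis using near nn I int
    by (intro exI[of _ ?\<psi>]) auto
qed

section \<open>Integration by parts and Taylor's formula\<close>

lemma lborel_integral_translate:
  fixes u :: "'a::euclidean_space \<Rightarrow> 'b::{banach,second_countable_topology}"
  assumes "u \<in> borel_measurable borel"
  shows "(LINT x|lborel. u (x + c)) = (LINT x|lborel. u x)"
proof -
  have "(LINT x|lborel. u x) = (LINT x|distr lborel borel ((+) c). u x)"
    by (subst lborel_distr_plus) simp
  also have "\<dots> = (LINT x|lborel. u (c + x))"
    using assms by (subst integral_distr) auto
  finally show ?thesis by (simp add: add.commute)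
qed

lemma nn_integral_lborel_translate:
  fixes u :: "'a::euclidean_space \<Rightarrow> ennreal"
  assumes "u \<in> borel_measurable borel"
  shows "(\<integral>\<^sup>+x. u (x + c) \<partial>lborel) = (\<integral>\<^sup>+x. u x \<partial>lborel)"
proof -
  have "(\<integral>\<^sup>+x. u x \<partial>lborel) = (\<integral>\<^sup>+x. u x \<partial>distr lborel borel ((+) c))"
    by (subst lborel_distr_plus) simp
  also have "\<dots> = (\<integral>\<^sup>+x. u (c + x) \<partial>lborel)"
    using assms by (subst nn_integral_distr) auto
  finally show ?thesis by (simp add: add.commute)
qed

text \<open>Continuity and the compact support make the integrand integrable on the product space,
  so Fubini applies.\<close>

lemma integral_swap_unit_interval:
  fixes F :: "real \<Rightarrow> 'a::euclidean_space \<Rightarrow> 'b::{banach,second_countable_topology}"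
  assumes cont: "continuous_on UNIV (\<lambda>z. F (fst z) (snd z))"
    and supp: "\<And>s x. s \<in> {0..1} \<Longrightarrow> F s x \<noteq> 0 \<Longrightarrow> norm x \<le> R"
  shows "(LINT x|lborel. LINT s|lborel. indicator {0..1} s *\<^sub>R F s x)
    = (LINT s|lborel. indicator {0..1} s *\<^sub>R (LINT x|lborel. F s x))"
proof -
  let ?G = "\<lambda>(x, s). indicator {0..1} s *\<^sub>R F s x"
  have "continuous_on UNIV (\<lambda>(x, s). F s x)"
    using continuous_on_compose2[OF cont, of UNIV "\<lambda>z. (snd z, fst z)"]
    by (simp add: split_beta continuous_on_Pair continuous_on_fst continuous_on_snd continuous_on_id)
  then have "integrable lborel (\<lambda>z. indicator (cball 0 R \<times> {0..1::real}) z *\<^sub>R (\<lambda>(x, s). F s x) z)"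
    by (intro borel_integrable_compact compact_Times) (auto intro: continuous_on_subset)
  also have "(\<lambda>z. indicator (cball 0 R \<times> {0..1::real}) z *\<^sub>R (\<lambda>(x, s). F s x) z) = ?G"
    using supp by (force simp: fun_eq_iff indicator_def)
  finally have "integrable (lborel \<Otimes>\<^sub>M lborel) ?G" by (simp add: lborel_prod)
  from lborel_pair.Fubini_integral[OF this] show ?thesis by simp
qed

lemma partial_deriv_eq_0:
  assumes "\<And>x. u x \<noteq> 0 \<Longrightarrow> norm x \<le> R" "norm x > R"
  shows "partial_deriv i u x = 0"
proof -
  have z: "u y = 0" if "norm y > R" for y using assms(1)[of y] that by force
  have "((\<lambda>t::real. 0) has_vector_derivative 0) (at 0)" by simp
  moreover have "open ((\<lambda>t::real. norm (x + t *\<^sub>R axis i 1)) -` {R<..})"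
    by (intro open_vimage continuous_intros)
  ultimately have "((\<lambda>t. u (x + t *\<^sub>R axis i 1)) has_vector_derivative 0) (at 0)"
    by (rule has_vector_derivative_transform_within_open) (use z assms(2) in auto)
  then show ?thesis unfolding partial_deriv_def by (rule vector_derivative_at)
qed

lemma iter_partial_support:
  assumes "\<And>x. u x \<noteq> 0 \<Longrightarrow> norm x \<le> R"
  shows "iter_partial is u x \<noteq> 0 \<Longrightarrow> norm x \<le> R"
proof (induction "is" arbitrary: x)
  case (Cons i "is")
  then show ?case using partial_deriv_eq_0[of "iter_partial is u" R x i] by force
qed (use assms in auto)

lemma mi_deriv_support:
  assumes "\<And>x. u x \<noteq> 0 \<Longrightarrow> norm x \<le> R"
  shows "mi_deriv \<beta> u x \<noteq> 0 \<Longrightarrow> norm x \<le> R"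
  unfolding mi_deriv_def by (rule iter_partial_support[OF assms])

text \<open>By translation invariance the integral equals its mean over the shifts \<open>s\<close>
  in [0,1] along the axis. Integrating in \<open>s\<close> first leaves
  \<open>w (x + axis i 1) - w x\<close>, whose integral vanishes, again by translation invariance.
  No space integral has to be split into coordinates.\<close>

lemma integral_partial_deriv_eq_0:
  fixes w :: "real^'d \<Rightarrow> 'b::euclidean_space"
  assumes C: "Ck 1 w" and supp: "\<And>x. w x \<noteq> 0 \<Longrightarrow> norm x \<le> R"
  shows "(LINT x|lborel. partial_deriv i w x) = 0"
proof -
  let ?e = "axis i 1 :: real^'d"
  have c: "continuous_on UNIV (partial_deriv i w)" and cw: "continuous_on UNIV w"
    and pd: "has_partial_derivs w"
    using C by (auto simp: Ck.simps(2))
  have [measurable]: "w \<in> borel_measurable borel" "partial_deriv i w \<in> borel_measurable borel"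
    using c cw by (auto intro: borel_measurable_continuous_onI)
  have intw: "integrable lborel w"
    using cw supp by (rule integrable_continuous_bounded_support)
  have intw': "integrable lborel (\<lambda>x. w (x + ?e))"
  proof (rule integrable_continuous_bounded_support[where R="R + 1"])
    show "continuous_on UNIV (\<lambda>x. w (x + ?e))"
      by (intro continuous_on_compose2[OF cw] continuous_intros) auto
    show "norm x \<le> R + 1" if "w (x + ?e) \<noteq> 0" for x
      using supp[OF that] norm_triangle_ineq4[of "x + ?e" ?e] by simp
  qed
  have "(LINT x|lborel. partial_deriv i w x)
    = (LINT s|lborel. indicator {0..1::real} s *\<^sub>R (LINT x|lborel. partial_deriv i w x))"
    by simp
  also have "\<dots> = (LINT s|lborel. indicator {0..1::real} s *\<^sub>R (LINT x|lborel. partial_deriv i w (x + s *\<^sub>R ?e)))"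
    by (subst lborel_integral_translate) auto
  also have "\<dots> = (LINT x|lborel. LINT s|lborel. indicator {0..1::real} s *\<^sub>R partial_deriv i w (x + s *\<^sub>R ?e))"
  proof (rule integral_swap_unit_interval[symmetric, where R="R + 1"])
    show "continuous_on UNIV (\<lambda>z. partial_deriv i w (snd z + fst z *\<^sub>R ?e))"
      by (intro continuous_on_compose2[OF c] continuous_intros) auto
    fix s :: real and x assume s: "s \<in> {0..1}" and "partial_deriv i w (x + s *\<^sub>R ?e) \<noteq> 0"
    then have "norm (x + s *\<^sub>R ?e) \<le> R" using partial_deriv_eq_0[of w R, OF supp] by force
    then show "norm x \<le> R + 1"
      using norm_triangle_ineq4[of "x + s *\<^sub>R ?e" "s *\<^sub>R ?e"] s by simp
  qed
  also have "\<dots> = (LINT x|lborel. w (x + ?e) - w x)"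
  proof (intro Bochner_Integration.integral_cong refl)
    fix x
    have "(LINT s|lborel. indicator {0..1::real} s *\<^sub>R partial_deriv i w (x + s *\<^sub>R ?e))
      = w (x + 1 *\<^sub>R ?e) - w (x + 0 *\<^sub>R ?e)"
    proof (rule integral_FTC_atLeastAtMost)
      show "((\<lambda>s. w (x + s *\<^sub>R ?e)) has_vector_derivative partial_deriv i w (x + s *\<^sub>R ?e)) (at s within {0..1})" for s
        by (rule has_vector_derivative_at_within[OF partial_deriv_line[OF pd]])
      show "continuous_on {0..1} (\<lambda>s. partial_deriv i w (x + s *\<^sub>R ?e))"
        by (intro continuous_on_compose2[OF c] continuous_intros) auto
    qed simp
    then show "(LINT s|lborel. indicator {0..1::real} s *\<^sub>R partial_deriv i w (x + s *\<^sub>R ?e)) = w (x + ?e) - w x"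
      by simp
  qed
  also have "\<dots> = 0"
    using lborel_integral_translate[of w ?e] by (simp add: Bochner_Integration.integral_diff[OF intw' intw])
  finally show ?thesis .
qed

lemma integral_by_parts_partial:
  fixes \<psi> :: "real^'d \<Rightarrow> real" and f :: "real^'d \<Rightarrow> 'b::euclidean_space"
  assumes \<psi>: "Ck 1 \<psi>" and f: "Ck 1 f" and supp: "\<And>x. \<psi> x \<noteq> 0 \<Longrightarrow> norm x \<le> R"
  shows "(LINT x|lborel. partial_deriv i \<psi> x *\<^sub>R f x) = - (LINT x|lborel. \<psi> x *\<^sub>R partial_deriv i f x)"
proof -
  let ?w = "\<lambda>x. \<psi> x *\<^sub>R f x"
  have c: "continuous_on UNIV \<psi>" "continuous_on UNIV f" "has_partial_derivs \<psi>" "has_partial_derivs f"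
    "\<And>i. continuous_on UNIV (partial_deriv i \<psi>)" "\<And>i. continuous_on UNIV (partial_deriv i f)"
    using \<psi> f by (auto simp: Ck.simps(2))
  have d: "((\<lambda>s. ?w (x + s *\<^sub>R axis k 1)) has_vector_derivative
     \<psi> x *\<^sub>R partial_deriv k f x + partial_deriv k \<psi> x *\<^sub>R f x) (at 0)" for x k
    using has_vector_derivative_scaleR[of "\<lambda>s. \<psi> (x + s *\<^sub>R axis k 1)" "partial_deriv k \<psi> x" 0 UNIV
      "\<lambda>s. f (x + s *\<^sub>R axis k 1)" "partial_deriv k f x"] partial_deriv_at0[OF c(3), of x k] partial_deriv_at0[OF c(4), of x k]
    by (simp add: has_real_derivative_iff_has_vector_derivative)
  have pd: "partial_deriv k ?w = (\<lambda>x. \<psi> x *\<^sub>R partial_deriv k f x + partial_deriv k \<psi> x *\<^sub>R f x)" for k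
    by (rule partial_deriv_eqI) (rule d)
  have "has_partial_derivs ?w" by (rule has_partial_derivsI) (rule d)
  then have "Ck 1 ?w" unfolding One_nat_def Ck.simps pd using c by (auto intro!: continuous_intros)
  then have "(LINT x|lborel. partial_deriv i ?w x) = 0"
    by (rule integral_partial_deriv_eq_0[where R=R]) (use supp in auto)
  moreover have "integrable lborel (\<lambda>x. \<psi> x *\<^sub>R partial_deriv i f x)"
    by (rule integrable_continuous_bounded_support[where R=R]) (use c supp in \<open>auto intro!: continuous_intros\<close>)
  moreover have "integrable lborel (\<lambda>x. partial_deriv i \<psi> x *\<^sub>R f x)"
    by (rule integrable_continuous_bounded_support[where R=R])
       (use c partial_deriv_eq_0[of \<psi> R, OF supp] in \<open>auto intro!: continuous_intros\<close>, force)
  ultimately show ?thesis unfolding pd by (simp add: eq_neg_iff_add_eq_0 add.commute)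
qed

text \<open>The outermost differentiation of \<open>\<psi>\<close> is the first one to reach
  \<open>f\<close>, so the list arrives there reversed.\<close>

lemma integral_by_parts_iter_partial:
  fixes \<psi> :: "real^'d \<Rightarrow> real" and f :: "real^'d \<Rightarrow> 'b::euclidean_space"
  assumes "Ck (length is) \<psi>" "Ck (length is) f" and supp: "\<And>x. \<psi> x \<noteq> 0 \<Longrightarrow> norm x \<le> R"
  shows "(LINT x|lborel. iter_partial is \<psi> x *\<^sub>R f x)
    = (-1) ^ length is *\<^sub>R (LINT x|lborel. \<psi> x *\<^sub>R iter_partial (rev is) f x)"
  using assms(1,2)
proof (induction "is" arbitrary: f)
  case (Cons i "is")
  have app: "iter_partial (is @ js) f = iter_partial is (iter_partial js f)" for "is" js
    by (induction "is") auto
  have "(LINT x|lborel. iter_partial (i # is) \<psi> x *\<^sub>R f x)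
      = - (LINT x|lborel. iter_partial is \<psi> x *\<^sub>R partial_deriv i f x)"
    using Cons.prems iter_partial_support[of \<psi> R, OF supp]
    by (simp, intro integral_by_parts_partial[where R=R] Ck_iter_partial)
       (auto intro: Ck_mono)
  also have "\<dots> = - ((-1) ^ length is *\<^sub>R (LINT x|lborel. \<psi> x *\<^sub>R iter_partial (rev is) (partial_deriv i f) x))"
    using Cons by (simp add: Ck_Suc_imp Ck_SucD)
  finally show ?case by (simp add: app)
qed simp

lemma mi_deriv_continuous: "Ck (mi_order \<beta>) u \<Longrightarrow> continuous_on UNIV (mi_deriv \<beta> u)"
  using Ck_mi_deriv[of \<beta> 0 u] by simp

lemma integral_by_parts_mi_deriv:
  fixes \<psi> :: "real^'d \<Rightarrow> real" and f :: "real^'d \<Rightarrow> 'b::euclidean_space"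
  assumes "Ck (mi_order \<beta>) \<psi>" "Ck (mi_order \<beta>) f" and supp: "\<And>x. \<psi> x \<noteq> 0 \<Longrightarrow> norm x \<le> R"
  shows "(LINT x|lborel. mi_deriv \<beta> \<psi> x *\<^sub>R f x)
    = (-1) ^ mi_order \<beta> *\<^sub>R (LINT x|lborel. \<psi> x *\<^sub>R mi_deriv \<beta> f x)"
proof -
  obtain "is" where l: "\<forall>i. count_list is i = \<beta> $ i" using ex_list_mi by blast
  have l': "\<forall>i. count_list (rev is) i = \<beta> $ i" using l by (simp add: count_mset[symmetric])
  have "mi_deriv \<beta> \<psi> = iter_partial is \<psi>" "mi_deriv \<beta> f = iter_partial (rev is) f"
    using l l' assms by (auto intro: mi_deriv_eq_iter_partial)
  moreover have "length is = mi_order \<beta>" using l by (rule length_eq_mi_order)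
  ultimately show ?thesis
    using integral_by_parts_iter_partial[of "is" \<psi> f R] assms by simp
qed

lemma Taylor_dir_deriv:
  fixes u :: "real^'d \<Rightarrow> 'b::euclidean_space"
  assumes "Ck (Suc N) u"
  shows "u (x + t) - (\<Sum>l\<le>N. (1 / fact l) *\<^sub>R dir_deriv l u x t)
    = (LINT s|lborel. indicator {0..1} s *\<^sub>R (((1 - s) ^ N / fact N) *\<^sub>R dir_deriv (Suc N) u (x + s *\<^sub>R t) t))"
proof -
  define Df where "Df l s = dir_deriv l u (x + s *\<^sub>R t) t" for l and s :: real
  have "((\<lambda>s. ((1 - s) ^ (Suc N - 1) / fact (Suc N - 1)) *\<^sub>R Df (Suc N) s) has_integral
      Df 0 1 - (\<Sum>l<Suc N. ((1 - 0) ^ l / fact l) *\<^sub>R Df l 0)) {0..1}"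
  proof (rule Taylor_has_integral)
    fix m and s :: real assume "m < Suc N"
    then have "Ck (Suc m) u" using assms by (auto intro: Ck_mono)
    then show "(Df m has_vector_derivative Df (Suc m) s) (at s within {0..1})"
      unfolding Df_def by (rule has_vector_derivative_at_within[OF dir_deriv_has_vector_derivative])
  qed auto
  then have 1: "((\<lambda>s. ((1 - s) ^ N / fact N) *\<^sub>R Df (Suc N) s) has_integral
      u (x + t) - (\<Sum>l\<le>N. (1 / fact l) *\<^sub>R dir_deriv l u x t)) {0..1}"
    by (simp add: Df_def dir_deriv_0 lessThan_Suc_atMost)
  have "continuous_on {0..1} (Df (Suc N))"
    unfolding Df_def dir_deriv_def using assms
    by (intro continuous_intros continuous_on_compose2[OF mi_deriv_continuous]) auto
  then have "set_integrable lborel {0..1} (\<lambda>s. ((1 - s) ^ N / fact N) *\<^sub>R Df (Suc N) s)"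
    by (intro borel_integrable_atLeastAtMost' continuous_intros) auto
  from set_borel_integral_eq_integral(2)[OF this] integral_unique[OF 1] show ?thesis
    by (simp add: set_lebesgue_integral_def Df_def)
qed

text \<open>A non-integrable function has Bochner integral 0, so the bound is trivial for it. Weak
  derivatives can thus be estimated in \<open>ennreal\<close> before any integrability is
  discussed.\<close>

lemma norm_integral_le_nn_integral:
  fixes f :: "'a \<Rightarrow> 'b::{banach,second_countable_topology}"
  shows "ennreal (norm (integral\<^sup>L M f)) \<le> (\<integral>\<^sup>+x. ennreal (norm (f x)) \<partial>M)"
  by (cases "integrable M f") (simp_all add: integral_norm_bound_ennreal not_integrable_integral_eq)

lemma integral_sum_scaleR:
  fixes u :: "'i \<Rightarrow> 'a \<Rightarrow> 'b::{banach,second_countable_topology}"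
  assumes "\<And>i. i \<in> S \<Longrightarrow> integrable M (u i)"
  shows "(LINT x|M. (\<Sum>i\<in>S. c i *\<^sub>R u i x)) = (\<Sum>i\<in>S. c i *\<^sub>R (LINT x|M. u i x))"
  using assms by (subst Bochner_Integration.integral_sum) auto

text \<open>The step \<open>t\<close> precedes the base point \<open>x\<close>, so that
  \<open>taylor_rem N u t\<close> is a function on the whole space and can be paired with a test
  function.\<close>

definition taylor_rem :: "nat \<Rightarrow> (real^'d \<Rightarrow> 'b::real_normed_vector) \<Rightarrow> real^'d \<Rightarrow> real^'d \<Rightarrow> 'b" where
  "taylor_rem N u t x = u (x + t) - (\<Sum>l\<le>N. (1 / fact l) *\<^sub>R dir_deriv l u x t)"

lemma mi_monom_minus: "mi_monom \<beta> (- t) = (-1) ^ mi_order \<beta> * mi_monom \<beta> t"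
  unfolding mi_monom_def mi_order_def power_sum prod.distrib[symmetric]
  by (intro prod.cong refl) (simp add: power_mult_distrib[symmetric])

lemma support_translate:
  fixes c :: "'a::real_normed_vector"
  assumes "\<And>x. u x \<noteq> 0 \<Longrightarrow> norm x \<le> R" "u (x + c) \<noteq> 0"
  shows "norm x \<le> R + norm c"
  using assms(1)[OF assms(2)] norm_triangle_ineq4[of "x + c" c] by simp

lemma integrable_scaleR_bounded_support:
  fixes \<psi> :: "'a::euclidean_space \<Rightarrow> real" and f :: "'a \<Rightarrow> 'b::{banach,second_countable_topology}"
  assumes "continuous_on UNIV \<psi>" "continuous_on UNIV f" "\<And>x. \<psi> x \<noteq> 0 \<Longrightarrow> norm x \<le> R"
  shows "integrable lborel (\<lambda>x. \<psi> x *\<^sub>R f x)"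
  using assms by (intro integrable_continuous_bounded_support[where R=R] continuous_intros) auto

lemma dir_deriv_continuous: "Ck l u \<Longrightarrow> continuous_on UNIV (\<lambda>x. dir_deriv l u x t)"
  unfolding dir_deriv_def by (intro continuous_intros mi_deriv_continuous) auto

lemma dir_deriv_continuous_joint:
  assumes "Ck l u" shows "continuous_on UNIV (\<lambda>z. dir_deriv l u (fst z) (snd z))"
  unfolding dir_deriv_def mi_monom_def
  by (intro continuous_intros continuous_on_compose2[OF mi_deriv_continuous]) (use assms in auto)

lemma dir_deriv_support:
  assumes supp: "\<And>x. u x \<noteq> 0 \<Longrightarrow> norm x \<le> R" and "dir_deriv l u x t \<noteq> 0"
  shows "norm x \<le> R"
proof (rule ccontr)
  assume "\<not> norm x \<le> R"
  then have "mi_deriv \<beta> u x = 0" for \<beta> using mi_deriv_support[of u R, OF supp] by blast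
  then show False using assms(2) by (simp add: dir_deriv_def)
qed

text \<open>The sign \<open>(-1) ^ l\<close> from integration by parts is absorbed by passing from
  \<open>t\<close> to \<open>- t\<close>, because the monomials have degree
  \<open>l\<close>.\<close>

lemma integral_dir_deriv:
  fixes \<psi> :: "real^'d \<Rightarrow> real" and f :: "real^'d \<Rightarrow> 'b::euclidean_space"
  assumes C: "Ck l \<psi>" "Ck l f" and supp: "\<And>x. \<psi> x \<noteq> 0 \<Longrightarrow> norm x \<le> R"
  shows "(LINT x|lborel. \<psi> x *\<^sub>R dir_deriv l f x t) = (LINT x|lborel. dir_deriv l \<psi> x (- t) *\<^sub>R f x)"
proof -
  let ?S = "{\<beta> :: nat^'d. mi_order \<beta> = l}"
  let ?c = "\<lambda>(\<beta> :: nat^'d) t. fact l / mi_fact \<beta> * mi_monom \<beta> t"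
  have cont: "continuous_on UNIV \<psi>" "continuous_on UNIV f" using C by (auto intro: Ck_continuous)
  have cD: "continuous_on UNIV (mi_deriv \<beta> \<psi>)" "continuous_on UNIV (mi_deriv \<beta> f)" if "\<beta> \<in> ?S" for \<beta>
    using C that by (auto intro: mi_deriv_continuous)
  have "(LINT x|lborel. \<psi> x *\<^sub>R dir_deriv l f x t)
    = (LINT x|lborel. (\<Sum>\<beta>\<in>?S. ?c \<beta> t *\<^sub>R (\<psi> x *\<^sub>R mi_deriv \<beta> f x)))"
    by (simp add: dir_deriv_def scaleR_sum_right mult.commute)
  also have "\<dots> = (\<Sum>\<beta>\<in>?S. ?c \<beta> t *\<^sub>R (LINT x|lborel. \<psi> x *\<^sub>R mi_deriv \<beta> f x))"
    using cont cD supp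
    by (intro integral_sum_scaleR integrable_scaleR_bounded_support[where R=R]) auto
  also have "\<dots> = (\<Sum>\<beta>\<in>?S. ?c \<beta> (- t) *\<^sub>R (LINT x|lborel. mi_deriv \<beta> \<psi> x *\<^sub>R f x))"
  proof (intro sum.cong refl)
    fix \<beta> :: "nat^'d" assume b: "\<beta> \<in> ?S"
    have "(LINT x|lborel. mi_deriv \<beta> \<psi> x *\<^sub>R f x) = (-1) ^ l *\<^sub>R (LINT x|lborel. \<psi> x *\<^sub>R mi_deriv \<beta> f x)"
      using integral_by_parts_mi_deriv[of \<beta> \<psi> f R] b C supp by auto
    then show "?c \<beta> t *\<^sub>R (LINT x|lborel. \<psi> x *\<^sub>R mi_deriv \<beta> f x)
      = ?c \<beta> (- t) *\<^sub>R (LINT x|lborel. mi_deriv \<beta> \<psi> x *\<^sub>R f x)"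
      using b by (simp add: mi_monom_minus power_mult_distrib[symmetric])
  qed
  also have "\<dots> = (LINT x|lborel. (\<Sum>\<beta>\<in>?S. ?c \<beta> (- t) *\<^sub>R (mi_deriv \<beta> \<psi> x *\<^sub>R f x)))"
    using cont cD mi_deriv_support[of \<psi> R, OF supp]
    by (intro integral_sum_scaleR[symmetric] integrable_scaleR_bounded_support[where R=R]) auto
  also have "\<dots> = (LINT x|lborel. dir_deriv l \<psi> x (- t) *\<^sub>R f x)"
    by (simp add: dir_deriv_def scaleR_sum_left)
  finally show ?thesis .
qed

text \<open>The adjoint of the remainder in direction \<open>t\<close> is the remainder in direction
  \<open>- t\<close>: the translate is moved by a substitution, the polynomial part by
  \<open>integral_dir_deriv\<close>. The remainder of \<open>\<psi>\<close>, which is smooth, can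
  then be expanded further.\<close>

lemma integral_taylor_rem:
  fixes \<psi> :: "real^'d \<Rightarrow> real" and f :: "real^'d \<Rightarrow> 'b::euclidean_space"
  assumes C: "Ck N \<psi>" "Ck N f" and supp: "\<And>x. \<psi> x \<noteq> 0 \<Longrightarrow> norm x \<le> R"
  shows "(LINT x|lborel. \<psi> x *\<^sub>R taylor_rem N f t x) = (LINT x|lborel. taylor_rem N \<psi> (- t) x *\<^sub>R f x)"
proof -
  have cont: "continuous_on UNIV \<psi>" "continuous_on UNIV f" using C by (auto intro: Ck_continuous)
  have Cl: "Ck l \<psi>" "Ck l f" if "l \<le> N" for l using C that by (auto intro: Ck_mono)
  have ct: "continuous_on UNIV (\<lambda>x. f (x + t))" "continuous_on UNIV (\<lambda>x. \<psi> (x - t))"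
    by (auto intro!: continuous_on_compose2[OF cont(1)] continuous_on_compose2[OF cont(2)] continuous_intros)
  have st: "norm x \<le> R + norm t" if "\<psi> (x - t) \<noteq> 0" for x
    using support_translate[of \<psi> R, OF supp, of x "- t"] that by simp
  have i1: "integrable lborel (\<lambda>x. \<psi> x *\<^sub>R f (x + t))"
    using cont ct supp by (intro integrable_scaleR_bounded_support)
  have i2: "integrable lborel (\<lambda>x. \<psi> x *\<^sub>R dir_deriv l f x t)" if "l \<le> N" for l
    using cont supp Cl[OF that] by (intro integrable_scaleR_bounded_support dir_deriv_continuous)
  have i3: "integrable lborel (\<lambda>x. \<psi> (x - t) *\<^sub>R f x)"
    using cont ct st by (intro integrable_scaleR_bounded_support)
  have i4: "integrable lborel (\<lambda>x. dir_deriv l \<psi> x (- t) *\<^sub>R f x)" if "l \<le> N" for l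
    using cont dir_deriv_support[of \<psi> R, OF supp] Cl[OF that]
    by (intro integrable_scaleR_bounded_support[where R=R] dir_deriv_continuous)
  have "(LINT x|lborel. \<psi> x *\<^sub>R taylor_rem N f t x)
    = (LINT x|lborel. \<psi> x *\<^sub>R f (x + t) - (\<Sum>l\<le>N. (1 / fact l) *\<^sub>R (\<psi> x *\<^sub>R dir_deriv l f x t)))"
    by (simp add: taylor_rem_def scaleR_diff_right scaleR_sum_right)
  also have "\<dots> = (LINT x|lborel. \<psi> x *\<^sub>R f (x + t))
      - (\<Sum>l\<le>N. (1 / fact l) *\<^sub>R (LINT x|lborel. \<psi> x *\<^sub>R dir_deriv l f x t))"
    using i1 i2 by (subst Bochner_Integration.integral_diff) (auto simp: integral_sum_scaleR simp del: scaleR_scaleR)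
  also have "(LINT x|lborel. \<psi> x *\<^sub>R f (x + t)) = (LINT x|lborel. \<psi> (x - t) *\<^sub>R f x)"
    using lborel_integral_translate[of "\<lambda>x. \<psi> (x - t) *\<^sub>R f x" t] i3 by (simp add: borel_measurable_integrable)
  also have "(\<Sum>l\<le>N. (1 / fact l) *\<^sub>R (LINT x|lborel. \<psi> x *\<^sub>R dir_deriv l f x t))
      = (\<Sum>l\<le>N. (1 / fact l) *\<^sub>R (LINT x|lborel. dir_deriv l \<psi> x (- t) *\<^sub>R f x))"
    using Cl supp by (intro sum.cong refl arg_cong2[where f="(*\<^sub>R)"] integral_dir_deriv) auto
  also have "(LINT x|lborel. \<psi> (x - t) *\<^sub>R f x) - \<dots>
    = (LINT x|lborel. \<psi> (x - t) *\<^sub>R f x - (\<Sum>l\<le>N. (1 / fact l) *\<^sub>R (dir_deriv l \<psi> x (- t) *\<^sub>R f x)))"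
    using i3 i4 by (subst Bochner_Integration.integral_diff) (auto simp: integral_sum_scaleR simp del: scaleR_scaleR)
  also have "\<dots> = (LINT x|lborel. taylor_rem N \<psi> (- t) x *\<^sub>R f x)"
    by (simp add: taylor_rem_def scaleR_diff_left scaleR_sum_left)
  finally show ?thesis .
qed

section \<open>Test functions and weak derivatives of top order\<close>

lemma test_function_support:
  assumes "test_function \<psi>"
  shows "\<exists>R. \<forall>x. \<psi> x \<noteq> 0 \<longrightarrow> norm x \<le> R"
proof -
  have "bounded {x. \<psi> x \<noteq> 0}"
    using assms unfolding test_function_def by (meson bounded_subset closure_subset compact_imp_bounded)
  then show ?thesis by (auto simp: bounded_iff)
qed

lemma test_function_translate:
  assumes "test_function \<psi>" shows "test_function (\<lambda>x. \<psi> (x + c))"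
proof -
  obtain R where R: "\<And>x. \<psi> x \<noteq> 0 \<Longrightarrow> norm x \<le> R" using test_function_support[OF assms] by blast
  have "{x. \<psi> (x + c) \<noteq> 0} \<subseteq> cball 0 (R + norm c)" using support_translate[of \<psi> R, OF R] by auto
  then have "compact (closure {x. \<psi> (x + c) \<noteq> 0})"
    by (meson bounded_cball bounded_subset compact_closure)
  then show ?thesis using assms by (auto simp: test_function_def intro: Ck_translate)
qed

text \<open>The values \<open>g \<beta>\<close> for multi-indices of another order are irrelevant.\<close>

definition top_weak_derivs ::
    "nat \<Rightarrow> (real^'d \<Rightarrow> complex) \<Rightarrow> (nat^'d \<Rightarrow> real^'d \<Rightarrow> complex) \<Rightarrow> bool" where
  "top_weak_derivs N f g \<longleftrightarrow> (\<forall>\<beta>. g \<beta> \<in> borel_measurable borel) \<and>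
    (\<forall>\<beta> \<psi>. mi_order \<beta> = Suc N \<longrightarrow> test_function \<psi> \<longrightarrow>
      (LINT x|lborel. mi_deriv \<beta> \<psi> x *\<^sub>R f x) = (-1) ^ Suc N * (LINT x|lborel. \<psi> x *\<^sub>R g \<beta> x))"

lemma top_weak_derivsD:
  assumes "top_weak_derivs N f g"
  shows "g \<beta> \<in> borel_measurable borel"
    and "mi_order \<beta> = Suc N \<Longrightarrow> test_function \<psi> \<Longrightarrow>
      (LINT x|lborel. mi_deriv \<beta> \<psi> x *\<^sub>R f x) = (-1) ^ Suc N * (LINT x|lborel. \<psi> x *\<^sub>R g \<beta> x)"
  using assms by (simp_all add: top_weak_derivs_def)

text \<open>The weak derivatives of top order enter only here: Taylor's formula is applied to the test
  function, and the derivatives are then moved from the test function to \<open>f\<close>.\<close>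

lemma integral_taylor_rem_weak:
  fixes \<psi> :: "real^'d \<Rightarrow> real" and f :: "real^'d \<Rightarrow> complex"
  assumes C: "Ck N f" and \<psi>: "test_function \<psi>"
    and weak: "top_weak_derivs N f g"
  shows "(LINT x|lborel. \<psi> x *\<^sub>R taylor_rem N f t x) =
    (LINT s|lborel. indicator {0..1} s *\<^sub>R (((1 - s) ^ N / fact N) *\<^sub>R
      (\<Sum>\<beta>\<in>{\<beta>. mi_order \<beta> = Suc N}. (fact (Suc N) / mi_fact \<beta> * mi_monom \<beta> t) *\<^sub>R
         (LINT x|lborel. \<psi> (x - s *\<^sub>R t) *\<^sub>R g \<beta> x))))"
proof -
  obtain R where R: "\<And>x. \<psi> x \<noteq> 0 \<Longrightarrow> norm x \<le> R" using test_function_support[OF \<psi>] by blast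
  have Ck\<psi>: "Ck n \<psi>" for n using \<psi> by (simp add: test_function_def)
  have cf: "continuous_on UNIV f" using C by (rule Ck_continuous)
  let ?S = "{\<beta> :: nat^'d. mi_order \<beta> = Suc N}"
  \<comment> \<open>Taylor's formula with step \<open>- t\<close> writes the remainder of
    \<open>\<psi>\<close> as an integral of this differential of order \<open>Suc N\<close> over
    \<open>s\<close>.\<close>
  define D where "D s x = dir_deriv (Suc N) \<psi> (x - s *\<^sub>R t) (- t)" for s x
  have cD: "continuous_on UNIV (\<lambda>z. D (fst z) (snd z))"
    unfolding D_def
    by (intro continuous_on_compose2[OF dir_deriv_continuous[OF Ck\<psi>]] continuous_intros) auto
  have cD1: "continuous_on UNIV (\<lambda>s. D s x)" for x
    using continuous_on_compose2[OF cD, of UNIV "\<lambda>s. (s, x)"]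
    by (simp add: continuous_on_Pair continuous_on_id continuous_on_const)
  have sD: "norm x \<le> R + norm t" if "s \<in> {0..1}" "D s x \<noteq> 0" for s x
  proof -
    have "norm (x - s *\<^sub>R t) \<le> R" using dir_deriv_support[of \<psi> R, OF R] that(2) by (auto simp: D_def)
    moreover have "norm (s *\<^sub>R t) \<le> 1 * norm t" unfolding norm_scaleR
      using that by (intro mult_right_mono) auto
    ultimately show ?thesis using norm_triangle_ineq[of "x - s *\<^sub>R t" "s *\<^sub>R t"] by simp
  qed
  have rem: "taylor_rem N \<psi> (- t) x *\<^sub>R f x
      = (LINT s|lborel. indicator {0..1} s *\<^sub>R (((1 - s) ^ N / fact N) *\<^sub>R D s x *\<^sub>R f x))" for x
  proof -
    have "set_integrable lborel {0..1} (\<lambda>s. ((1 - s) ^ N / fact N) *\<^sub>R D s x)"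
      by (intro borel_integrable_atLeastAtMost' continuous_intros continuous_on_subset[OF cD1]) auto
    then have i: "integrable lborel (\<lambda>s. indicator {0..1} s *\<^sub>R (((1 - s) ^ N / fact N) *\<^sub>R D s x))"
      by (simp add: set_integrable_def)
    have "taylor_rem N \<psi> (- t) x = (LINT s|lborel. indicator {0..1} s *\<^sub>R (((1 - s) ^ N / fact N) *\<^sub>R D s x))"
      using Taylor_dir_deriv[OF Ck\<psi>, of x "- t" N] by (simp add: taylor_rem_def D_def)
    then show ?thesis
      using integral_scaleR_left[of "f x" lborel, OF i] by simp
  qed
  have inner: "(LINT x|lborel. D s x *\<^sub>R f x) = (\<Sum>\<beta>\<in>?S. (fact (Suc N) / mi_fact \<beta> * mi_monom \<beta> t) *\<^sub>R
         (LINT x|lborel. \<psi> (x - s *\<^sub>R t) *\<^sub>R g \<beta> x))" for s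
  proof -
    define \<psi>' where "\<psi>' x = \<psi> (x - s *\<^sub>R t)" for x
    have t\<psi>': "test_function \<psi>'" using test_function_translate[OF \<psi>, of "- (s *\<^sub>R t)"] by (simp add: \<psi>'_def[abs_def])
    then obtain R' where R': "\<And>x. \<psi>' x \<noteq> 0 \<Longrightarrow> norm x \<le> R'" using test_function_support by blast
    have Ck\<psi>': "Ck n \<psi>'" for n using t\<psi>' by (simp add: test_function_def)
    have m: "mi_deriv \<beta> \<psi> (x - s *\<^sub>R t) = mi_deriv \<beta> \<psi>' x" for \<beta> x
      using mi_deriv_translate[of \<beta> \<psi> "- (s *\<^sub>R t)"] by (simp add: \<psi>'_def[abs_def])
    have "(LINT x|lborel. D s x *\<^sub>R f x) = (LINT x|lborel. (\<Sum>\<beta>\<in>?S.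
        (fact (Suc N) / mi_fact \<beta> * mi_monom \<beta> (- t)) *\<^sub>R (mi_deriv \<beta> \<psi>' x *\<^sub>R f x)))"
      by (simp add: D_def dir_deriv_def m scaleR_sum_left del: fact_Suc)
    also have "\<dots> = (\<Sum>\<beta>\<in>?S. (fact (Suc N) / mi_fact \<beta> * mi_monom \<beta> (- t)) *\<^sub>R (LINT x|lborel. mi_deriv \<beta> \<psi>' x *\<^sub>R f x))"
      using cf mi_deriv_support[of \<psi>' R', OF R']
      by (intro integral_sum_scaleR integrable_scaleR_bounded_support[where R=R'] mi_deriv_continuous Ck\<psi>') auto
    \<comment> \<open>The factor \<open>(-1) ^ Suc N\<close> of the weak derivative cancels the one
      that the monomial produces at \<open>- t\<close>.\<close>
    also have "\<dots> = (\<Sum>\<beta>\<in>?S. (fact (Suc N) / mi_fact \<beta> * mi_monom \<beta> t) *\<^sub>R (LINT x|lborel. \<psi>' x *\<^sub>R g \<beta> x))"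
    proof (intro sum.cong refl)
      fix \<beta> :: "nat^'d" assume "\<beta> \<in> ?S"
      then have o: "mi_order \<beta> = Suc N" by simp
      have e: "(LINT x|lborel. mi_deriv \<beta> \<psi>' x *\<^sub>R f x) = ((-1) ^ Suc N) *\<^sub>R (LINT x|lborel. \<psi>' x *\<^sub>R g \<beta> x)"
      proof -
        have "(-1) ^ k *\<^sub>R z = (-1) ^ k * z" for k and z :: complex by (simp add: scaleR_conv_of_real)
        then show ?thesis by (simp only: top_weak_derivsD(2)[OF weak o t\<psi>'])
      qed
      show "(fact (Suc N) / mi_fact \<beta> * mi_monom \<beta> (- t)) *\<^sub>R (LINT x|lborel. mi_deriv \<beta> \<psi>' x *\<^sub>R f x)
        = (fact (Suc N) / mi_fact \<beta> * mi_monom \<beta> t) *\<^sub>R (LINT x|lborel. \<psi>' x *\<^sub>R g \<beta> x)"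
        unfolding e mi_monom_minus o
        by (simp add: power_mult_distrib[symmetric] del: fact_Suc)
    qed
    finally show ?thesis by (simp add: \<psi>'_def[abs_def])
  qed
  have "(LINT x|lborel. \<psi> x *\<^sub>R taylor_rem N f t x) = (LINT x|lborel. taylor_rem N \<psi> (- t) x *\<^sub>R f x)"
    using Ck\<psi> C R by (rule integral_taylor_rem)
  also have "\<dots> = (LINT x|lborel. LINT s|lborel. indicator {0..1} s *\<^sub>R (((1 - s) ^ N / fact N) *\<^sub>R D s x *\<^sub>R f x))"
    by (simp only: rem)
  also have "\<dots> = (LINT s|lborel. indicator {0..1} s *\<^sub>R (LINT x|lborel. ((1 - s) ^ N / fact N) *\<^sub>R D s x *\<^sub>R f x))"
  proof (rule integral_swap_unit_interval)
    show "continuous_on UNIV (\<lambda>z. ((1 - fst z) ^ N / fact N) *\<^sub>R D (fst z) (snd z) *\<^sub>R f (snd z))"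
      by (intro continuous_intros cD continuous_on_compose2[OF cf]) auto
    show "norm x \<le> R + norm t" if "s \<in> {0..1}" "((1 - s) ^ N / fact N) *\<^sub>R D s x *\<^sub>R f x \<noteq> 0" for s x
      using sD[of s x] that by auto
  qed
  also have "\<dots> = (LINT s|lborel. indicator {0..1} s *\<^sub>R (((1 - s) ^ N / fact N) *\<^sub>R (LINT x|lborel. D s x *\<^sub>R f x)))"
    by (simp only: integral_scaleR_right)
  finally show ?thesis unfolding inner .
qed

text \<open>A substitution transfers the shift by \<open>s *\<^sub>R t\<close> from
  \<open>\<psi>\<close> to the weak derivatives. The weight \<open>\<psi>\<close> is then the same
  for all \<open>s\<close> and \<open>t\<close>, which the later change of the order of integration
  relies on.\<close>

lemma norm_integral_taylor_rem_le:
  fixes \<psi> :: "real^'d \<Rightarrow> real" and f :: "real^'d \<Rightarrow> complex"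
  assumes C: "Ck N f" and \<psi>: "test_function \<psi>" and nn: "\<And>x. \<psi> x \<ge> 0"
    and weak: "top_weak_derivs N f g"
  shows "ennreal (norm (LINT x|lborel. \<psi> x *\<^sub>R taylor_rem N f t x)) \<le>
    ennreal (Suc N * norm t ^ Suc N) * (\<integral>\<^sup>+s. indicator {0..1} s *
      (\<integral>\<^sup>+x. ennreal (\<psi> x) * (\<Sum>\<beta>\<in>{\<beta>. mi_order \<beta> = Suc N}. ennreal (norm (g \<beta> (x + s *\<^sub>R t)))) \<partial>lborel) \<partial>lborel)"
proof -
  let ?S = "{\<beta> :: nat^'d. mi_order \<beta> = Suc N}"
  let ?c = "\<lambda>\<beta>. fact (Suc N) / mi_fact \<beta> * mi_monom \<beta> t"
  let ?I = "\<lambda>s \<beta>. (LINT x|lborel. \<psi> (x - s *\<^sub>R t) *\<^sub>R g \<beta> x)"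
  have [measurable]: "g \<beta> \<in> borel_measurable borel" for \<beta> by (rule top_weak_derivsD(1)[OF weak])
  have [measurable]: "\<psi> \<in> borel_measurable borel"
    using \<psi> Ck_continuous by (auto simp: test_function_def intro!: borel_measurable_continuous_onI)
  have I: "ennreal (norm (?I s \<beta>)) \<le> (\<integral>\<^sup>+x. ennreal (\<psi> x) * ennreal (norm (g \<beta> (x + s *\<^sub>R t))) \<partial>lborel)" for s \<beta>
  proof -
    have "ennreal (norm (?I s \<beta>)) \<le> (\<integral>\<^sup>+x. ennreal (norm (\<psi> (x - s *\<^sub>R t) *\<^sub>R g \<beta> x)) \<partial>lborel)"
      by (rule norm_integral_le_nn_integral)
    also have "\<dots> = (\<integral>\<^sup>+x. ennreal (\<psi> (x - s *\<^sub>R t)) * ennreal (norm (g \<beta> x)) \<partial>lborel)"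
      using nn by (simp add: ennreal_mult)
    also have "\<dots> = (\<integral>\<^sup>+x. ennreal (\<psi> x) * ennreal (norm (g \<beta> (x + s *\<^sub>R t))) \<partial>lborel)"
      using nn_integral_lborel_translate[of "\<lambda>x. ennreal (\<psi> (x - s *\<^sub>R t)) * ennreal (norm (g \<beta> x))" "s *\<^sub>R t"]
      by simp
    finally show ?thesis .
  qed
  \<comment> \<open>The denominator \<open>mi_fact \<beta>\<close> is at least 1; the numerator
    \<open>fact (Suc N)\<close> will meet \<open>1 / fact N\<close> and leave the constant
    \<open>Suc N\<close>.\<close>
  have c: "\<bar>?c \<beta>\<bar> \<le> fact (Suc N) * norm t ^ Suc N" if "\<beta> \<in> ?S" for \<beta>
  proof -
    have "\<bar>?c \<beta>\<bar> = fact (Suc N) / mi_fact \<beta> * \<bar>mi_monom \<beta> t\<bar>"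
      using mi_fact_ge_1[of \<beta>] by (simp add: abs_mult)
    also have "\<dots> \<le> fact (Suc N) / 1 * norm t ^ Suc N"
      using mi_fact_ge_1[of \<beta>] abs_mi_monom_le[of \<beta> t] that
      by (intro mult_mono divide_left_mono) (auto simp del: fact_Suc)
    finally show ?thesis by simp
  qed
  have pt: "ennreal (norm (indicator {0..1} s *\<^sub>R (((1 - s) ^ N / fact N) *\<^sub>R (\<Sum>\<beta>\<in>?S. ?c \<beta> *\<^sub>R ?I s \<beta>))))
     \<le> ennreal (Suc N * norm t ^ Suc N) * (indicator {0..1} s * (\<integral>\<^sup>+x. ennreal (\<psi> x) * (\<Sum>\<beta>\<in>?S. ennreal (norm (g \<beta> (x + s *\<^sub>R t)))) \<partial>lborel))"
    for s :: real
  proof (cases "s \<in> {0..1}")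
    case True
    have "norm (((1 - s) ^ N / fact N) *\<^sub>R (\<Sum>\<beta>\<in>?S. ?c \<beta> *\<^sub>R ?I s \<beta>))
        \<le> (1 / fact N) * (\<Sum>\<beta>\<in>?S. (fact (Suc N) * norm t ^ Suc N) * norm (?I s \<beta>))"
      unfolding norm_scaleR
    proof (intro mult_mono sum_norm_le)
      show "\<bar>(1 - s) ^ N / fact N\<bar> \<le> 1 / fact N"
        using True by (simp add: divide_le_cancel power_le_one)
      show "norm (?c \<beta> *\<^sub>R ?I s \<beta>) \<le> fact (Suc N) * norm t ^ Suc N * norm (?I s \<beta>)" if "\<beta> \<in> ?S" for \<beta>
        unfolding norm_scaleR by (intro mult_right_mono c that) auto
    qed auto
    also have "\<dots> = (Suc N * norm t ^ Suc N) * (\<Sum>\<beta>\<in>?S. norm (?I s \<beta>))"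
      by (simp add: sum_distrib_left[symmetric])
    finally have "ennreal (norm (((1 - s) ^ N / fact N) *\<^sub>R (\<Sum>\<beta>\<in>?S. ?c \<beta> *\<^sub>R ?I s \<beta>)))
        \<le> ennreal (Suc N * norm t ^ Suc N) * (\<Sum>\<beta>\<in>?S. ennreal (norm (?I s \<beta>)))"
      by (simp add: ennreal_leI ennreal_mult[symmetric] sum_nonneg del: of_nat_Suc power_Suc)
    also have "\<dots> \<le> ennreal (Suc N * norm t ^ Suc N) * (\<Sum>\<beta>\<in>?S. (\<integral>\<^sup>+x. ennreal (\<psi> x) * ennreal (norm (g \<beta> (x + s *\<^sub>R t))) \<partial>lborel))"
      by (intro mult_left_mono sum_mono I) auto
    also have "(\<Sum>\<beta>\<in>?S. (\<integral>\<^sup>+x. ennreal (\<psi> x) * ennreal (norm (g \<beta> (x + s *\<^sub>R t))) \<partial>lborel))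
      = (\<integral>\<^sup>+x. ennreal (\<psi> x) * (\<Sum>\<beta>\<in>?S. ennreal (norm (g \<beta> (x + s *\<^sub>R t)))) \<partial>lborel)"
      by (simp add: sum_distrib_left nn_integral_sum del: sum_ennreal)
    finally show ?thesis using True by simp
  qed simp
  have "ennreal (norm (LINT x|lborel. \<psi> x *\<^sub>R taylor_rem N f t x)) \<le>
     (\<integral>\<^sup>+s. ennreal (norm (indicator {0..1} s *\<^sub>R (((1 - s) ^ N / fact N) *\<^sub>R (\<Sum>\<beta>\<in>?S. ?c \<beta> *\<^sub>R ?I s \<beta>)))) \<partial>lborel)"
    unfolding integral_taylor_rem_weak[OF C \<psi> weak] by (rule norm_integral_le_nn_integral)
  also have "\<dots> \<le> (\<integral>\<^sup>+s. ennreal (Suc N * norm t ^ Suc N) * (indicator {0..1} s * (\<integral>\<^sup>+x. ennreal (\<psi> x) * (\<Sum>\<beta>\<in>?S. ennreal (norm (g \<beta> (x + s *\<^sub>R t)))) \<partial>lborel)) \<partial>lborel)"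
    by (intro nn_integral_mono pt)
  also have "\<dots> = ennreal (Suc N * norm t ^ Suc N) * (\<integral>\<^sup>+s. indicator {0..1} s * (\<integral>\<^sup>+x. ennreal (\<psi> x) * (\<Sum>\<beta>\<in>?S. ennreal (norm (g \<beta> (x + s *\<^sub>R t)))) \<partial>lborel) \<partial>lborel)"
    by (intro nn_integral_cmult) measurable
  finally show ?thesis .
qed

section \<open>Linear change of variables\<close>

text \<open>The library proves this only for index types of sort \<open>wellorder\<close>.\<close>

lemma measure_linear_image_finite:
  fixes f :: "real^'n \<Rightarrow> real^'n"
  assumes "linear f" "S \<in> lmeasurable"
  shows "f ` S \<in> lmeasurable \<and> measure lebesgue (f ` S) = \<bar>det (matrix f)\<bar> * measure lebesgue S"
proof -
  let ?Q = "\<lambda>f S. f ` S \<in> lmeasurable \<and> measure lebesgue (f ` S) = \<bar>det (matrix f)\<bar> * measure lebesgue S"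
  \<comment> \<open>For a linear map whose determinant has modulus 1 it is enough to compare volumes
    on boxes.\<close>
  have suff: "?Q h S" if "linear h" "S \<in> lmeasurable" "\<bar>det (matrix h)\<bar> = 1"
    "\<And>a b. cbox a b \<noteq> {} \<Longrightarrow> measure lebesgue (h ` cbox a b) = measure lebesgue (cbox a b)"
    for h :: "real^'n \<Rightarrow> real^'n" and S
  proof -
    have "measure lebesgue (h ` cbox a b) = 1 * measure lebesgue (cbox a b)" for a b
      using that(4)[of a b] by (cases "cbox a b = {}") auto
    then show ?thesis using measure_linear_sufficient[OF that(1,2), of 1] that(3) by simp
  qed
  have "\<forall>S\<in>lmeasurable. ?Q f S"
  proof (rule induct_linear_elementary[OF assms(1)])
    fix f g :: "real^'n \<Rightarrow> real^'n"
    assume fg: "linear f" "linear g" "\<forall>S\<in>lmeasurable. ?Q f S" "\<forall>S\<in>lmeasurable. ?Q g S"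
    show "\<forall>S\<in>lmeasurable. ?Q (f \<circ> g) S"
    proof
      fix S :: "(real^'n) set" assume "S \<in> lmeasurable"
      moreover have "(f \<circ> g) ` S = f ` g ` S" by (simp add: image_comp)
      ultimately show "?Q (f \<circ> g) S"
        using fg by (simp only: matrix_compose det_mul abs_mult) simp
    qed
  next
    fix f :: "real^'n \<Rightarrow> real^'n" and i
    assume f: "linear f" and 0: "\<And>x. f x $ i = 0"
    have ni: "\<not> inj f"
    proof
      assume "inj f"
      then have "surj f" using f by (simp add: linear_injective_imp_surjective)
      then obtain x where "f x = axis i 1" by (metis surjD)
      with 0[of x] show False by simp
    qed
    then have "det (matrix f) = 0" using det_nz_iff_inj[OF f] by blast
    moreover have "negligible (f ` S)" for S
      using negligible_linear_singular_image[OF f ni] .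
    ultimately show "\<forall>S\<in>lmeasurable. ?Q f S"
      by (simp add: negligible_imp_measurable negligible_imp_measure0)
  next
    fix c :: "'n \<Rightarrow> real"
    have "matrix (\<lambda>x::real^'n. \<chi> i. c i * x $ i) $ i $ j = 0" if "i \<noteq> j" for i j
      using that by (simp add: matrix_def axis_def)
    then have "det (matrix (\<lambda>x::real^'n. \<chi> i. c i * x $ i)) = prod c UNIV"
      by (simp add: det_diagonal matrix_def axis_def)
    then show "\<forall>S\<in>lmeasurable. ?Q (\<lambda>x. \<chi> i. c i * x $ i) S"
      by (simp add: measurable_stretch measure_stretch)
  next
    fix m n :: 'n assume mn: "m \<noteq> n"
    let ?t = "Transposition.transpose m n"
    let ?h = "\<lambda>x::real^'n. \<chi> i. x $ ?t i"
    have lin: "linear ?h" by (rule linearI) (simp_all add: vec_eq_iff)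
    \<comment> \<open>The coordinate swap is an involution, so the square of its determinant is
      1.\<close>
    have hh: "?h \<circ> ?h = id" by (auto simp: fun_eq_iff vec_eq_iff)
    then have "matrix ?h ** matrix ?h = mat 1"
      using matrix_compose[OF lin lin] by (simp add: matrix_id_mat_1)
    then have "det (matrix ?h ** matrix ?h) = 1" by simp
    then have "det (matrix ?h) * det (matrix ?h) = 1" by (simp only: det_mul)
    then have 1: "\<bar>det (matrix ?h)\<bar> = 1"
      by (simp add: abs_square_eq_1[symmetric] power2_eq_square)
    have eq: "?h ` cbox a b = cbox (?h a) (?h b)" for a b
    proof (intro set_eqI iffI)
      fix y assume "y \<in> cbox (?h a) (?h b)"
      then have *: "a $ ?t i \<le> y $ i" "y $ i \<le> b $ ?t i" for i by (auto simp: mem_box_cart)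
      have "?h y \<in> cbox a b" using *[of "?t _"] by (simp add: mem_box_cart)
      moreover have "y = ?h (?h y)" by (simp add: vec_eq_iff)
      ultimately show "y \<in> ?h ` cbox a b" by blast
    qed (auto simp: mem_box_cart)
    have pr: "(\<Prod>i\<in>UNIV. ?h b $ i - ?h a $ i) = (\<Prod>i\<in>UNIV. b $ i - a $ i)" for a b
      using prod.reindex_bij_betw[of ?t UNIV UNIV "\<lambda>i. b $ i - a $ i"] by simp
    have "measure lebesgue (?h ` cbox a b) = measure lebesgue (cbox a b)" if "cbox a b \<noteq> {}" for a b
    proof -
      have "cbox (?h a) (?h b) \<noteq> {}" using that unfolding eq[symmetric] by simp
      from content_cbox_cart[OF this] content_cbox_cart[OF that] show ?thesis
        unfolding eq using pr[of b a] by simp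
    qed
    then show "\<forall>S\<in>lmeasurable. ?Q ?h S"
      using suff[OF lin _ 1] by blast
  next
    fix m n :: 'n assume mn: "m \<noteq> n"
    let ?h = "\<lambda>x::real^'n. \<chi> i. if i = m then x $ m + x $ n else x $ i"
    have lin: "linear ?h" by (rule linearI) (simp_all add: vec_eq_iff algebra_simps)
    have "matrix ?h = (\<chi> k. if k = m then row m (mat 1) + 1 *s row n (mat 1) else row k (mat 1))"
      by (auto simp: matrix_def vec_eq_iff row_def mat_def axis_def)
    then have 1: "\<bar>det (matrix ?h)\<bar> = 1" by (simp add: det_row_operation[OF mn])
    have "measure lebesgue (?h ` cbox a b) = measure lebesgue (cbox a b)" if "cbox a b \<noteq> {}" for a b
    proof -
      \<comment> \<open>The box is first translated so that its lower bound in coordinate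
        \<open>n\<close> becomes 0, since \<open>measure_shear_interval\<close> asks for a
        nonnegative one.\<close>
      let ?v = "(\<chi> i. - a $ n) :: real^'n"
      have "measure lebesgue (?h ` cbox a b) = measure lebesgue ((+) (?h ?v) ` ?h ` cbox a b)"
        by (rule measure_translation[symmetric])
      also have "(+) (?h ?v) ` ?h ` cbox a b = ?h ` (+) ?v ` cbox a b"
        unfolding image_image linear_add[OF lin] ..
      also have "(+) ?v ` cbox a b = cbox (?v + a) (?v + b)" by (rule cbox_translation[symmetric])
      also have "measure lebesgue (?h ` cbox (?v + a) (?v + b)) = measure lebesgue (cbox (?v + a) (?v + b))"
        using that by (intro measure_shear_interval mn) (simp_all add: cbox_translation)
      also have "\<dots> = measure lebesgue ((+) ?v ` cbox a b)" by (simp only: cbox_translation)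
      also have "\<dots> = measure lebesgue (cbox a b)" by (rule measure_translation)
      finally show ?thesis .
    qed
    then show "\<forall>S\<in>lmeasurable. ?Q ?h S"
      using suff[OF lin _ 1] by blast
  qed
  with assms show ?thesis by blast
qed

text \<open>Boxes determine the measure. The preimage of a box is its image under the inverse
  matrix, hence measurable, and \<open>A\<close> maps it back onto the box, which yields its
  volume.\<close>

lemma lborel_matrix:
  fixes A :: "real^'n^'n"
  assumes A: "det A \<noteq> 0"
  shows "lborel = density (distr lborel borel ((*v) A)) (\<lambda>_. ennreal \<bar>det A\<bar>)"
proof (rule lborel_eqI)
  have cont: "continuous_on UNIV ((*v) A)" by (rule matrix_vector_mult_linear_continuous_on)
  then have [measurable]: "(*v) A \<in> borel \<rightarrow>\<^sub>M borel" by (rule borel_measurable_continuous_onI)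
  obtain B where B: "A ** B = mat 1" "B ** A = mat 1"
    using A by (auto simp: invertible_det_nz[symmetric] invertible_def)
  fix l u :: "real^'n" assume le: "\<And>b. b \<in> Basis \<Longrightarrow> l \<bullet> b \<le> u \<bullet> b"
  let ?S = "(*v) A -` box l u"
  have S: "?S = (*v) B ` box l u"
    using B by (auto simp: image_iff matrix_vector_mul_assoc) (metis B(2) matrix_vector_mul_assoc matrix_vector_mul_lid)
  then have Sm: "?S \<in> lmeasurable" 
    using measure_linear_image_finite[of "(*v) B" "box l u"] by simp
  have "(*v) A ` ?S = box l u"
    unfolding S image_image by (simp add: matrix_vector_mul_assoc B)
  then have "measure lebesgue (box l u) = \<bar>det A\<bar> * measure lebesgue ?S"
    using measure_linear_image_finite[of "(*v) A", OF _ Sm] by simp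
  then have "ennreal (measure lebesgue (box l u)) = ennreal \<bar>det A\<bar> * ennreal (measure lebesgue ?S)"
    by (simp add: ennreal_mult)
  moreover have "box l u \<in> lmeasurable" by simp
  ultimately have "emeasure lebesgue (box l u) = ennreal \<bar>det A\<bar> * emeasure lebesgue ?S"
    by (simp only: emeasure_eq_measure2[OF Sm] emeasure_eq_measure2)
  also have "emeasure lebesgue (box l u) = emeasure lborel (box l u)" by simp
  also have "emeasure lebesgue ?S = emeasure lborel ?S"
    using open_vimage[OF open_box cont, of l u] by simp
  finally have "emeasure (density (distr lborel borel ((*v) A)) (\<lambda>_. ennreal \<bar>det A\<bar>)) (box l u) = emeasure lborel (box l u)"
    by (simp add: emeasure_density nn_integral_cmult nn_integral_distr emeasure_distr)
  then show "emeasure (density (distr lborel borel ((*v) A)) (\<lambda>_. ennreal \<bar>det A\<bar>)) (box l u) = (\<Prod>b\<in>Basis. (u - l) \<bullet> b)"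
    using le by (simp add: emeasure_lborel_box_eq)
qed simp

lemma borel_measurable_matrix_vector [measurable]: "(*v) (A :: real^'m^'n) \<in> borel \<rightarrow>\<^sub>M borel"
  by (intro borel_measurable_continuous_onI matrix_vector_mult_linear_continuous_on)

lemma nn_integral_matrix:
  fixes A :: "real^'n^'n"
  assumes A: "det A \<noteq> 0" and [measurable]: "u \<in> borel_measurable borel"
  shows "(\<integral>\<^sup>+x. u x \<partial>lborel) = ennreal \<bar>det A\<bar> * (\<integral>\<^sup>+x. u (A *v x) \<partial>lborel)"
  by (subst lborel_matrix[OF A]) (simp add: nn_integral_density nn_integral_distr nn_integral_cmult)

lemma integral_matrix:
  fixes A :: "real^'n^'n" and u :: "real^'n \<Rightarrow> 'b::{banach,second_countable_topology}"
  assumes A: "det A \<noteq> 0" and [measurable]: "u \<in> borel_measurable borel"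
  shows "(LINT x|lborel. u x) = \<bar>det A\<bar> *\<^sub>R (LINT x|lborel. u (A *v x))"
  by (subst lborel_matrix[OF A]) (simp add: integral_density integral_distr)

section \<open>Pointwise estimate of the Taylor remainder\<close>

definition top_deriv_sum :: "nat \<Rightarrow> (nat^'d \<Rightarrow> real^'d \<Rightarrow> complex) \<Rightarrow> real^'d \<Rightarrow> ennreal" where
  "top_deriv_sum N g y = (\<Sum>\<beta>\<in>{\<beta>. mi_order \<beta> = Suc N}. ennreal (norm (g \<beta> y)))"

lemma top_deriv_sum_measurable:
  assumes "top_weak_derivs N f g"
  shows "top_deriv_sum N g \<in> borel_measurable borel"
proof -
  have [measurable]: "g \<beta> \<in> borel_measurable borel" for \<beta> using assms by (rule top_weak_derivsD)
  show ?thesis unfolding top_deriv_sum_def[abs_def] by measurable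
qed

text \<open>The parameter \<open>s\<close> follows the segment from \<open>y\<close> to
  \<open>y + A *v t\<close>. Taylor's weight \<open>(1 - s) ^ N\<close> is at most 1 and has already
  been dropped.\<close>

abbreviation ray_integral :: "real \<Rightarrow> real^'d^'d \<Rightarrow> (real^'d \<Rightarrow> ennreal) \<Rightarrow> real^'d \<Rightarrow> ennreal" where
  "ray_integral h A G y \<equiv> (\<integral>\<^sup>+t. indicator (cball 0 h) t *
     (\<integral>\<^sup>+s. indicator {0..1::real} s * G (y + s *\<^sub>R (A *v t)) \<partial>lborel) \<partial>lborel)"

lemma taylor_rem_continuous:
  fixes f :: "real^'d \<Rightarrow> 'b::real_normed_vector" and A :: "real^'e^'d"
  assumes "Ck N f"
  shows "continuous_on UNIV (\<lambda>z. taylor_rem N f (A *v snd z) (fst z))"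
proof -
  have A: "continuous_on UNIV (\<lambda>z. A *v snd z)"
    by (intro continuous_on_compose2[OF matrix_vector_mult_linear_continuous_on] continuous_intros) auto
  have "continuous_on UNIV (\<lambda>z. dir_deriv l f (fst z) (A *v snd z))" if "l \<le> N" for l
  proof -
    have "continuous_on UNIV (\<lambda>z :: (real^'d) \<times> (real^'e). (fst z, A *v snd z))"
      by (intro continuous_intros A)
    from continuous_on_compose2[OF dir_deriv_continuous_joint[OF Ck_mono[OF assms that]] this]
    show ?thesis by simp
  qed
  then show ?thesis unfolding taylor_rem_def
    by (intro continuous_intros continuous_on_compose2[OF Ck_continuous[OF assms]] A) auto
qed

lemma uniformly_close_on_cball:
  fixes F :: "'a::euclidean_space \<times> 'b::euclidean_space \<Rightarrow> 'c::real_normed_vector"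
  assumes "continuous_on UNIV F" "e > 0"
  shows "\<exists>\<delta>>0. \<forall>y. norm (y - x) \<le> \<delta> \<longrightarrow> (\<forall>t\<in>cball 0 h. norm (F (y, t) - F (x, t)) \<le> e)"
proof -
  have "uniformly_continuous_on (cball x 1 \<times> cball 0 h) F"
    using assms(1) by (intro compact_uniformly_continuous compact_Times) (auto intro: continuous_on_subset)
  then obtain d where d: "d > 0" "\<And>z z'. z \<in> cball x 1 \<times> cball 0 h \<Longrightarrow> z' \<in> cball x 1 \<times> cball 0 h \<Longrightarrow>
      dist z' z < d \<Longrightarrow> dist (F z') (F z) < e"
    using assms(2) unfolding uniformly_continuous_on_def by metis
  have "norm (F (y, t) - F (x, t)) \<le> e" if "norm (y - x) \<le> min 1 (d/2)" "t \<in> cball 0 h" for y t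
  proof -
    have "dist (y, t) (x, t) < d" using that d(1) by (simp add: dist_Pair_Pair dist_norm)
    then have "dist (F (y, t)) (F (x, t)) < e"
      using that by (intro d) (auto simp: dist_norm norm_minus_commute)
    then show ?thesis by (simp add: dist_norm)
  qed
  then show ?thesis using d(1) by (intro exI[of _ "min 1 (d/2)"]) auto
qed

text \<open>A mollifier concentrated at \<open>x\<close> changes the remainder at \<open>x\<close>
  into a weighted mean, up to an arbitrarily small error. After Fubini the bound is a mean of ray
  integrals over the support of the mollifier, and these are at most \<open>B\<close>. The radius
  \<open>\<delta>0\<close> does not enter the result.\<close>

lemma nn_integral_taylor_rem_ball_le:
  fixes f :: "real^'d \<Rightarrow> complex" and A :: "real^'d^'d" and h K \<delta>0 :: real
  assumes C: "Ck N f"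
    and weak: "top_weak_derivs N f g"
    and K: "\<And>t. norm (A *v t) \<le> K * norm t" "0 \<le> K" and h: "h > 0" and \<delta>0: "\<delta>0 > 0"
    and B: "\<And>y. norm (y - x) \<le> \<delta>0 \<Longrightarrow>
      ray_integral h A (top_deriv_sum N g) y \<le> B"
  shows "(\<integral>\<^sup>+t. indicator (cball 0 h) t * ennreal (norm (taylor_rem N f (A *v t) x)) \<partial>lborel)
    \<le> ennreal (Suc N * (K * h) ^ Suc N) * B"
proof (rule ennreal_le_epsilon)
  fix e :: real assume "0 < e"
  let ?G = "top_deriv_sum N g"
  have [measurable]: "cball (0::real^'d) h \<in> sets borel" by simp
  have [measurable]: "?G \<in> borel_measurable borel" using weak by (rule top_deriv_sum_measurable)
  have Am [measurable]: "(*v) A \<in> borel \<rightarrow>\<^sub>M borel" by measurable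
  have cm [measurable]: "(\<lambda>t. ennreal (norm (taylor_rem N f (A *v t) y))) \<in> borel_measurable borel" for y
  proof -
    have "continuous_on UNIV (\<lambda>t. taylor_rem N f (A *v t) y)"
      using continuous_on_compose2[OF taylor_rem_continuous[OF C, of A], of UNIV "\<lambda>t. (y, t)"]
      by (simp add: continuous_on_Pair continuous_on_const continuous_on_id)
    then have [measurable]: "(\<lambda>t. taylor_rem N f (A *v t) y) \<in> borel_measurable borel"
      by (rule borel_measurable_continuous_onI)
    show ?thesis by measurable
  qed
  have cx: "continuous_on UNIV (\<lambda>y. taylor_rem N f (A *v t) y)" for t
    using continuous_on_compose2[OF taylor_rem_continuous[OF C, of A], of UNIV "\<lambda>y. (y, t)"]
    by (simp add: continuous_on_Pair continuous_on_const continuous_on_id)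
  let ?V = "measure lborel (cball (0::real^'d) h)"
  have V: "emeasure lborel (cball (0::real^'d) h) = ennreal ?V"
    using emeasure_compact_finite[OF compact_cball, of "0::real^'d" h]
    by (simp add: emeasure_eq_ennreal_measure)
  \<comment> \<open>An error \<open>e'\<close> for each \<open>t\<close> adds up to at most
    \<open>e\<close> over the ball; the summand 1 keeps the denominator positive.\<close>
  define e' where "e' = e / (?V + 1)"
  have V0: "?V \<ge> 0" by simp
  have e': "e' > 0" "e' * ?V \<le> e"
  proof -
    show e'0: "e' > 0" unfolding e'_def using \<open>0 < e\<close> V0 by (intro divide_pos_pos) linarith+
    have "e' * ?V \<le> e' * (?V + 1)" using e'0 by (intro mult_left_mono) auto
    also have "\<dots> = e" using V0 unfolding e'_def by (simp add: add_nonneg_eq_0_iff)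
    finally show "e' * ?V \<le> e" .
  qed
  \<comment> \<open>One radius serves all \<open>t\<close> in the ball, so a single mollifier can be
    used for the whole integral.\<close>
  obtain \<delta> where \<delta>: "\<delta> > 0" "\<And>y t. norm (y - x) \<le> \<delta> \<Longrightarrow> t \<in> cball 0 h \<Longrightarrow>
      norm (taylor_rem N f (A *v t) y - taylor_rem N f (A *v t) x) \<le> e'"
    using uniformly_close_on_cball[OF taylor_rem_continuous[OF C, of A] e'(1), of x h] by auto
  obtain \<psi> where \<psi>: "test_function \<psi>" "\<And>y. \<psi> y \<ge> 0" "\<And>y. \<psi> y \<noteq> 0 \<Longrightarrow> norm (y - x) \<le> min \<delta> \<delta>0"
    "integrable lborel \<psi>" "(LINT y|lborel. \<psi> y) = 1"
    using ex_mollifier[of "min \<delta> \<delta>0" x] \<delta>(1) \<delta>0 by auto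
  have [measurable]: "\<psi> \<in> borel_measurable borel" using \<psi>(4) by auto
  have \<psi>1: "(\<integral>\<^sup>+y. ennreal (\<psi> y) \<partial>lborel) = 1"
    using nn_integral_eq_integral[OF \<psi>(4)] \<psi>(2,5) by simp
  have \<psi>c: "continuous_on UNIV \<psi>" using \<psi>(1) Ck_continuous by (auto simp: test_function_def)
  let ?c = "ennreal (Suc N * (K * h) ^ Suc N)"
  let ?J = "\<lambda>t. \<integral>\<^sup>+s. indicator {0..1::real} s * (\<integral>\<^sup>+y. ennreal (\<psi> y) * ?G (y + s *\<^sub>R (A *v t)) \<partial>lborel) \<partial>lborel"
  have pt: "ennreal (norm (taylor_rem N f (A *v t) x)) \<le> ennreal e' + ?c * ?J t" if t: "t \<in> cball 0 h" for t
  proof -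
    let ?r = "taylor_rem N f (A *v t)"
    obtain R where R: "\<And>x. \<psi> x \<noteq> 0 \<Longrightarrow> norm x \<le> R" using test_function_support[OF \<psi>(1)] by blast
    have i: "integrable lborel (\<lambda>y. \<psi> y *\<^sub>R ?r y)"
      by (rule integrable_scaleR_bounded_support[OF \<psi>c cx R])
    have "norm (LINT y|lborel. \<psi> y *\<^sub>R (?r x - ?r y)) \<le> (LINT y|lborel. \<psi> y * e')"
    proof (rule Bochner_Integration.integral_norm_bound_integral)
      show "integrable lborel (\<lambda>y. \<psi> y *\<^sub>R (?r x - ?r y))"
        using \<psi>(4) i by (simp add: scaleR_diff_right)
      show "norm (\<psi> y *\<^sub>R (?r x - ?r y)) \<le> \<psi> y * e'" for y
      proof (cases "\<psi> y = 0")
        case False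
        then have "norm (?r y - ?r x) \<le> e'" using \<psi>(3)[of y] t by (intro \<delta>) auto
        then show ?thesis using \<psi>(2)[of y] by (simp add: norm_minus_commute mult_left_mono)
      qed simp
    qed (use \<psi>(4) in auto)
    moreover have "(LINT y|lborel. \<psi> y *\<^sub>R (?r x - ?r y)) = ?r x - (LINT y|lborel. \<psi> y *\<^sub>R ?r y)"
      using \<psi>(4,5) i by (simp add: scaleR_diff_right)
    ultimately have "norm (?r x) \<le> e' + norm (LINT y|lborel. \<psi> y *\<^sub>R ?r y)"
      using \<psi>(5) norm_triangle_sub[of "?r x" "LINT y|lborel. \<psi> y *\<^sub>R ?r y"] by simp
    then have "ennreal (norm (?r x)) \<le> ennreal e' + ennreal (norm (LINT y|lborel. \<psi> y *\<^sub>R ?r y))"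
      using e' by (simp add: ennreal_plus[symmetric] ennreal_leI del: ennreal_plus)
    also have "ennreal (norm (LINT y|lborel. \<psi> y *\<^sub>R ?r y)) \<le> ennreal (Suc N * norm (A *v t) ^ Suc N) * ?J t"
      unfolding top_deriv_sum_def
      by (rule norm_integral_taylor_rem_le[OF C \<psi>(1,2) weak])
    also have "\<dots> \<le> ?c * ?J t"
    proof (intro mult_right_mono ennreal_leI mult_left_mono power_mono)
      show "norm (A *v t) \<le> K * h"
        using K(1)[of t] mult_left_mono[OF _ K(2), of "norm t" h] t by simp
    qed auto
    finally show ?thesis by (simp add: add_left_mono)
  qed
  have "(\<integral>\<^sup>+t. indicator (cball 0 h) t * ennreal (norm (taylor_rem N f (A *v t) x)) \<partial>lborel)
    \<le> (\<integral>\<^sup>+t. ennreal e' * indicator (cball 0 h) t + ?c * (indicator (cball 0 h) t * ?J t) \<partial>lborel)"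
    using pt by (intro nn_integral_mono) (auto simp: indicator_def)
  also have "\<dots> = ennreal e' * ennreal ?V + ?c * (\<integral>\<^sup>+t. indicator (cball 0 h) t * ?J t \<partial>lborel)"
  proof -
    have [measurable]: "?J \<in> borel_measurable lborel" by measurable
    have [measurable]: "(\<lambda>t. indicator (cball 0 h) t * ?J t) \<in> borel_measurable lborel" by measurable
    show ?thesis
      by (subst nn_integral_add, measurable) (simp add: nn_integral_cmult nn_integral_cmult_indicator V del: power_Suc)
  qed
  also have "(\<integral>\<^sup>+t. indicator (cball 0 h) t * ?J t \<partial>lborel)
     = (\<integral>\<^sup>+t. (\<integral>\<^sup>+s. (\<integral>\<^sup>+y. ennreal (\<psi> y) * (indicator (cball 0 h) t * (indicator {0..1::real} s * ?G (y + s *\<^sub>R (A *v t)))) \<partial>lborel) \<partial>lborel) \<partial>lborel)"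
    \<comment> \<open>All factors are now under the innermost integral; two applications of Fubini
      bring the integral over \<open>y\<close> to the outside.\<close>
    by (simp add: nn_integral_cmult[symmetric] ac_simps)
  also have "\<dots> = (\<integral>\<^sup>+t. (\<integral>\<^sup>+y. (\<integral>\<^sup>+s. ennreal (\<psi> y) * (indicator (cball 0 h) t * (indicator {0..1::real} s * ?G (y + s *\<^sub>R (A *v t)))) \<partial>lborel) \<partial>lborel) \<partial>lborel)"
    by (intro nn_integral_cong lborel_pair.Fubini') measurable
  also have "\<dots> = (\<integral>\<^sup>+y. (\<integral>\<^sup>+t. (\<integral>\<^sup>+s. ennreal (\<psi> y) * (indicator (cball 0 h) t * (indicator {0..1::real} s * ?G (y + s *\<^sub>R (A *v t)))) \<partial>lborel) \<partial>lborel) \<partial>lborel)"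
    by (rule lborel_pair.Fubini') measurable
  also have "\<dots> = (\<integral>\<^sup>+y. ennreal (\<psi> y) * ray_integral h A ?G y \<partial>lborel)"
    by (simp add: nn_integral_cmult)
  also have "\<dots> \<le> (\<integral>\<^sup>+y. ennreal (\<psi> y) * B \<partial>lborel)"
  proof (rule nn_integral_mono)
    fix y
    show "ennreal (\<psi> y) * ray_integral h A ?G y
       \<le> ennreal (\<psi> y) * B"
      using \<psi>(3)[of y] B[of y] by (cases "\<psi> y = 0") (auto intro: mult_left_mono)
  qed
  also have "\<dots> = B" using \<psi>1 by (simp add: nn_integral_multc)
  also have "ennreal e' * ennreal ?V \<le> ennreal e"
    using e' by (simp add: ennreal_mult'[symmetric] ennreal_leI)
  finally show "(\<integral>\<^sup>+t. indicator (cball 0 h) t * ennreal (norm (taylor_rem N f (A *v t) x)) \<partial>lborel) \<le> ?c * B + ennreal e"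
    by (simp add: mult_left_mono add_mono add.commute)
qed

section \<open>Powers of a dilation matrix\<close>

lemma matrix_inv_left_right:
  fixes M :: "real^'d^'d"
  assumes "det M \<noteq> 0"
  shows "matrix_inv M ** M = mat 1" "M ** matrix_inv M = mat 1"
proof -
  have "\<exists>A'. M ** A' = mat 1 \<and> A' ** M = mat 1"
    using assms by (simp add: invertible_det_nz[symmetric] invertible_def)
  then have "M ** matrix_inv M = mat 1 \<and> matrix_inv M ** M = mat 1"
    unfolding matrix_inv_def by (rule someI_ex)
  then show "matrix_inv M ** M = mat 1" "M ** matrix_inv M = mat 1" by auto
qed

lemma det_mat_pow: "det (mat_pow A j) = det A ^ j"
  by (induction j) (simp_all add: det_mul)

lemma mat_pow_commute: "mat_pow A j ** A = A ** mat_pow A j"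
  by (induction j) (simp_all add: matrix_mul_assoc[symmetric])

lemma mat_pow_inverse:
  assumes "B ** A = mat 1"
  shows "mat_pow B j ** mat_pow A j = mat 1"
proof (induction j)
  case (Suc j)
  have "mat_pow B (Suc j) ** mat_pow A (Suc j) = B ** (mat_pow B j ** mat_pow A j) ** A"
    by (simp add: matrix_mul_assoc mat_pow_commute[of A, symmetric])
  then show ?case using Suc assms by simp
qed simp

abbreviation complexify :: "real^'n^'m \<Rightarrow> complex^'n^'m" where
  "complexify A \<equiv> \<chi> i j. complex_of_real (A $ i $ j)"

lemma complex_eigenvalue_iff_det:
  "complex_eigenvalue M z \<longleftrightarrow> det (complexify M - mat z) = 0"
proof -
  have "(complexify M - mat z) *v v = complexify M *v v - z *s v" for v
    by (simp add: matrix_vector_mult_diff_rdistrib)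
       (simp add: vec_eq_iff matrix_vector_mult_def mat_def if_distrib[of "\<lambda>c. c * _"] cong: if_cong)
  then have "complex_eigenvalue M z \<longleftrightarrow> (\<exists>v. v \<noteq> 0 \<and> (complexify M - mat z) *v v = 0)"
    by (simp add: complex_eigenvalue_def)
  also have "\<dots> \<longleftrightarrow> \<not> invertible (complexify M - mat z)"
    unfolding invertible_left_inverse matrix_left_invertible_ker by blast
  finally show ?thesis by (simp add: invertible_det_nz)
qed

lemma complexify_mult:
  "complexify A *v (\<chi> i. complex_of_real (v $ i)) = (\<chi> i. complex_of_real ((A *v v) $ i))"
  by (simp add: vec_eq_iff matrix_vector_mult_def)

lemma det_nonzero_if_not_eigenvalue_0:
  assumes "\<not> complex_eigenvalue M 0"
  shows "det M \<noteq> 0"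
proof
  assume "det M = 0"
  then obtain v where v: "v \<noteq> 0" "M *v v = 0"
    by (metis invertible_det_nz invertible_left_inverse matrix_left_invertible_ker)
  have "complexify M *v (\<chi> i. complex_of_real (v $ i)) = 0 *s (\<chi> i. complex_of_real (v $ i))"
    unfolding complexify_mult v by (simp add: vec_eq_iff)
  moreover have "(\<chi> i. complex_of_real (v $ i)) \<noteq> 0" using v(1) by (simp add: vec_eq_iff)
  ultimately show False using assms unfolding complex_eigenvalue_def by blast
qed

text \<open>The resolvent \<open>(M - z)\<^sup>-\<^sup>1\<close> has the power series \<open>\<Sum>j. z\<^sup>j M\<^sup>-\<^sup>j\<^sup>-\<^sup>1\<close>, and it is holomorphic
  on the closed disc of radius \<open>\<theta>\<close>, so Cauchy's inequality bounds its coefficients.\<close>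

lemma resolvent_coeff_bound:
  fixes M :: "real^'d^'d" and b :: "complex^'d"
  assumes \<theta>: "\<theta> > 0" "\<And>ev. complex_eigenvalue M ev \<Longrightarrow> \<theta> < cmod ev"
  shows "\<exists>c B. complexify M *v c 0 = b \<and> (\<forall>j. complexify M *v c (Suc j) = c j) \<and>
    (\<forall>j k. cmod (c j $ k) \<le> B / \<theta> ^ j)"
proof -
  let ?R = "\<lambda>z. complexify M - mat z"
  \<comment> \<open>By Cramer's rule \<open>X k z\<close> is the \<open>k\<close>-th component of
    the solution of \<open>(M - z) x = b\<close>; the numerator \<open>D k z\<close> and the
    denominator are determinants whose entries are holomorphic in \<open>z\<close>.\<close>
  define D where "D k z = det (\<chi> i j. if j = k then b $ i else ?R z $ i $ j)" for k z
  define X where "X k z = D k z / det (?R z)" for k z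
  have nz: "det (?R z) \<noteq> 0" if "cmod z \<le> \<theta>" for z
    using \<theta>(2)[of z] that by (auto simp: complex_eigenvalue_iff_det)
  have hol: "(\<lambda>z. ?R z $ i $ j) holomorphic_on UNIV" for i j
    by (cases "i = j") (auto simp: mat_def intro!: holomorphic_intros)
  have hdet: "(\<lambda>z. det (?R z)) holomorphic_on UNIV"
    unfolding det_def by (intro holomorphic_intros hol)
  have hD: "D k holomorphic_on UNIV" for k
    unfolding D_def det_def
  proof (intro holomorphic_intros)
    fix p and i :: 'd
    show "(\<lambda>z. (\<chi> i j. if j = k then b $ i else ?R z $ i $ j) $ i $ p i) holomorphic_on UNIV"
      using hol[of i "p i"] by (cases "p i = k") auto
  qed
  have hX: "X k holomorphic_on S" if "S \<subseteq> cball 0 \<theta>" for k S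
    unfolding X_def using nz that
    by (intro holomorphic_on_divide holomorphic_on_subset[OF hD] holomorphic_on_subset[OF hdet]) auto
  define F where "F k = fps_expansion (X k) 0" for k
  have F: "X k has_fps_expansion F k" for k
    unfolding F_def using hX[of "ball 0 \<theta>"] \<theta>(1) by (intro has_fps_expansion_fps_expansion[of "ball 0 \<theta>"]) auto
  define c where "c j = (\<chi> k. fps_nth (F k) j)" for j
  have eq: "(\<Sum>l\<in>UNIV. complex_of_real (M $ k $ l) * X l z) = b $ k + z * X k z" if "cmod z \<le> \<theta>" for z k
  proof -
    have "?R z *v (\<chi> k. X k z) = b"
      using cramer[OF nz[OF that], of "\<chi> k. X k z" b] by (simp add: X_def D_def)
    then have "(complexify M *v (\<chi> k. X k z)) - (mat z *v (\<chi> k. X k z)) = b"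
      by (simp add: matrix_vector_mult_diff_rdistrib)
    then have "(complexify M *v (\<chi> k. X k z)) $ k - (mat z *v (\<chi> k. X k z)) $ k = b $ k"
      by (metis vector_minus_component)
    moreover have "(mat z *v (\<chi> k. X k z)) $ k = z * X k z"
      by (simp add: matrix_vector_mult_def mat_def if_distrib[of "\<lambda>c. c * _"] cong: if_cong)
    ultimately show ?thesis
      by (simp add: matrix_vector_mult_def algebra_simps)
  qed
  \<comment> \<open>Near 0 the resolvent equation is an identity of functions, so it holds for the
    power series as well; comparing coefficients gives the recursion for \<open>c\<close>.\<close>
  have feq: "(\<Sum>l\<in>UNIV. fps_const (complex_of_real (M $ k $ l)) * F l) = fps_const (b $ k) + fps_X * F k" for k
  proof -
    have 1: "(\<lambda>z. \<Sum>l\<in>UNIV. complex_of_real (M $ k $ l) * X l z) has_fps_expansion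
       (\<Sum>l\<in>UNIV. fps_const (complex_of_real (M $ k $ l)) * F l)"
      by (intro fps_expansion_intros F)
    have 2: "(\<lambda>z. b $ k + z * X k z) has_fps_expansion (fps_const (b $ k) + fps_X * F k)"
      by (intro fps_expansion_intros F)
    have "eventually (\<lambda>z. z \<in> ball 0 \<theta>) (nhds (0::complex))"
      using \<theta>(1) by (intro eventually_nhds_in_open) auto
    then have ev: "eventually (\<lambda>z. (\<Sum>l\<in>UNIV. complex_of_real (M $ k $ l) * X l z) = b $ k + z * X k z) (nhds 0)"
      by eventually_elim (auto intro!: eq)
    have "(\<lambda>z. \<Sum>l\<in>UNIV. complex_of_real (M $ k $ l) * X l z) has_fps_expansion (fps_const (b $ k) + fps_X * F k)"
      by (rule iffD2[OF has_fps_expansion_cong[OF ev refl] 2])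
    with 1 show ?thesis by (rule fps_expansion_unique_complex)
  qed
  have coeff: "(\<Sum>l\<in>UNIV. complex_of_real (M $ k $ l) * fps_nth (F l) j)
      = (if j = 0 then b $ k else fps_nth (F k) (j - 1))" for j k
    using arg_cong[OF feq, of "\<lambda>G. fps_nth G j" k] by (simp add: fps_sum_nth fps_X_mult_nth)
  have "complexify M *v c 0 = b" "complexify M *v c (Suc j) = c j" for j
    unfolding c_def by (simp_all add: vec_eq_iff matrix_vector_mult_def coeff)
  moreover have "\<exists>B. \<forall>j. cmod (c j $ k) \<le> B / \<theta> ^ j" for k
  proof -
    have cont: "continuous_on (cball 0 \<theta>) (X k)"
      by (intro holomorphic_on_imp_continuous_on hX) auto
    then have "compact (X k ` cball 0 \<theta>)" by (intro compact_continuous_image) auto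
    then obtain B where B: "\<And>z. z \<in> cball 0 \<theta> \<Longrightarrow> cmod (X k z) \<le> B"
      by (metis bounded_iff compact_imp_bounded imageI)
    have "cmod ((deriv ^^ j) (X k) 0) \<le> fact j * B / \<theta> ^ j" for j
      using hX[of "ball 0 \<theta>" k] cont \<theta>(1) B by (intro Cauchy_inequality) auto
    then have "cmod (c j $ k) \<le> B / \<theta> ^ j" for j
      using fps_nth_fps_expansion[OF F[of k], of j]
      by (simp add: c_def norm_divide divide_le_eq mult.commute)
    then show ?thesis by blast
  qed
  then obtain B where "\<And>j k. cmod (c j $ k) \<le> B k / \<theta> ^ j" by metis
  then have "cmod (c j $ k) \<le> Max (range B) / \<theta> ^ j" for j k
    using \<theta>(1) by (meson Max_ge divide_right_mono finite finite_imageI order_trans rangeI zero_le_power less_imp_le)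
  ultimately show ?thesis by blast
qed

lemma mat_pow_inv_bound:
  fixes M :: "real^'d^'d"
  assumes \<theta>: "\<theta> > 0" "\<And>ev. complex_eigenvalue M ev \<Longrightarrow> \<theta> < cmod ev"
  shows "\<exists>C\<ge>0. \<forall>j t. norm (mat_pow_neg M j *v t) \<le> (C / \<theta> ^ j) * norm t"
proof -
  have "\<not> complex_eigenvalue M 0" using \<theta> by force
  then have nz: "det M \<noteq> 0" "det (complexify M - mat 0) \<noteq> 0"
    using det_nonzero_if_not_eigenvalue_0[of M] complex_eigenvalue_iff_det[of M 0] by blast+
  define A where "A = matrix_inv M"
  have MA: "M ** A = mat 1" using nz(1) unfolding A_def by (rule matrix_inv_left_right)
  have inj: "x = y" if "complexify M *v x = complexify M *v y" for x y
  proof -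
    have "invertible (complexify M)" using nz(2) by (simp add: invertible_det_nz)
    then obtain B where "B ** complexify M = mat 1" by (auto simp: invertible_def)
    then have "B *v (complexify M *v z) = z" for z by (simp add: matrix_vector_mul_assoc)
    then show ?thesis using that by metis
  qed
  have "\<exists>B. \<forall>j k. \<bar>(mat_pow A j *v axis i 1) $ k\<bar> \<le> B / \<theta> ^ j" for i
  proof -
    let ?e = "\<lambda>j. mat_pow A j *v axis i (1::real)"
    let ?c = "\<lambda>v::real^'d. (\<chi> k. complex_of_real (v $ k))"
    \<comment> \<open>With \<open>b\<close> the \<open>i\<close>-th column of \<open>M\<close>, the
      coefficient \<open>c j\<close> is the \<open>i\<close>-th column of \<open>mat_pow A j\<close>
      itself instead of the next power.\<close>
    obtain c :: "nat \<Rightarrow> complex^'d" and B where c: "complexify M *v c 0 = ?c (M *v axis i 1)"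
      "\<And>j. complexify M *v c (Suc j) = c j" "\<And>j k. cmod (c j $ k) \<le> B / \<theta> ^ j"
      using resolvent_coeff_bound[of \<theta> M "?c (M *v axis i 1)", OF \<theta>] by blast
    have "c j = ?c (?e j)" for j
    proof (induction j)
      case 0
      show ?case by (rule inj) (simp only: c(1) mat_pow.simps matrix_vector_mul_lid complexify_mult)
    next
      case (Suc j)
      have "M *v ?e (Suc j) = ?e j" by (simp add: matrix_vector_mul_assoc matrix_mul_assoc MA)
      then show ?case by (intro inj[of "c (Suc j)"]) (simp only: c(2) Suc complexify_mult)
    qed
    then have "\<bar>?e j $ k\<bar> \<le> B / \<theta> ^ j" for j k using c(3)[of j k] by simp
    then show ?thesis by blast
  qed
  then obtain B where B: "\<And>i j k. \<bar>(mat_pow A j *v axis i 1) $ k\<bar> \<le> B i / \<theta> ^ j" by metis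
  have B0: "B i \<ge> 0" for i
    using B[of 0 i undefined] abs_ge_zero order_trans by fastforce
  \<comment> \<open>The entries of each row are summed over the columns, which gives the sum of the
    \<open>B i\<close>; bounding the norm by the sum of its coordinates gives
    \<open>CARD('d)\<close>.\<close>
  have "norm (mat_pow A j *v t) \<le> (CARD('d) * (\<Sum>i\<in>UNIV. B i) / \<theta> ^ j) * norm t" for j t
  proof -
    have "\<bar>(mat_pow A j *v t) $ k\<bar> \<le> ((\<Sum>i\<in>UNIV. B i) / \<theta> ^ j) * norm t" for k
    proof -
      have e: "(mat_pow A j *v axis i 1) $ k = mat_pow A j $ k $ i" for i
        by (simp add: matrix_vector_mult_basis column_def)
      have "\<bar>(mat_pow A j *v t) $ k\<bar> \<le> (\<Sum>i\<in>UNIV. \<bar>mat_pow A j $ k $ i * t $ i\<bar>)"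
        unfolding matrix_vector_mult_def by simp
      also have "\<dots> \<le> (\<Sum>i\<in>UNIV. B i / \<theta> ^ j * norm t)"
        unfolding abs_mult using B[of j _ k] B0 \<theta>(1)
        by (intro sum_mono mult_mono) (auto simp: e component_le_norm_cart)
      finally show ?thesis by (simp add: sum_divide_distrib sum_distrib_right)
    qed
    then have "(\<Sum>k\<in>UNIV. \<bar>(mat_pow A j *v t) $ k\<bar>) \<le> (\<Sum>k\<in>(UNIV::'d set). ((\<Sum>i\<in>UNIV. B i) / \<theta> ^ j) * norm t)"
      by (rule sum_mono)
    with norm_le_l1_cart[of "mat_pow A j *v t"] show ?thesis by simp
  qed
  then show ?thesis unfolding mat_pow_neg_def A_def[symmetric]
    using B0 by (intro exI[of _ "CARD('d) * (\<Sum>i\<in>UNIV. B i)"]) (auto intro!: mult_nonneg_nonneg sum_nonneg)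
qed

section \<open>The quantities \<open>\<epsilon>\<^sub>j(k)\<close>\<close>

lemma sum_dir_deriv:
  fixes u :: "real^'d \<Rightarrow> 'b::real_normed_vector"
  shows "(\<Sum>l\<le>N. (1 / fact l) *\<^sub>R dir_deriv l u x t)
    = (\<Sum>\<beta>\<in>mi_Delta (N + 1). (mi_monom \<beta> t / mi_fact \<beta>) *\<^sub>R mi_deriv \<beta> u x)"
proof -
  have "mi_Delta (N + 1) = (\<Union>l\<in>{..N}. {\<beta> :: nat^'d. mi_order \<beta> = l})"
    by (auto simp: mi_Delta_def)
  then have "(\<Sum>\<beta>\<in>mi_Delta (N + 1). (mi_monom \<beta> t / mi_fact \<beta>) *\<^sub>R mi_deriv \<beta> u x)
    = (\<Sum>l\<le>N. \<Sum>\<beta>\<in>{\<beta>. mi_order \<beta> = l}. (mi_monom \<beta> t / mi_fact \<beta>) *\<^sub>R mi_deriv \<beta> u x)"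
    by (simp only:) (rule sum.UNION_disjoint, auto simp: finite_mi_order_eq)
  then show ?thesis by (simp add: dir_deriv_def scaleR_sum_right)
qed

lemma ball_vol_pos: "h > 0 \<Longrightarrow> ball_vol TYPE('d::finite) h > 0"
  using content_cball_pos[of h "0 :: real^'d"] by (simp add: ball_vol_def)

text \<open>The coefficients \<open>coeff_a\<close> are the means of
  \<open>mi_monom \<beta> t / mi_fact \<beta>\<close> over the ball, so averaging the Taylor
  polynomial of degree \<open>N\<close> term by term produces exactly the operator.\<close>

lemma diff_op_eq_integral:
  fixes u :: "real^'d \<Rightarrow> complex"
  shows "diff_op h N u k = (1 / ball_vol TYPE('d) h) *\<^sub>R
    (LINT t|lborel. indicator (cball 0 h) t *\<^sub>R (\<Sum>l\<le>N. (1 / fact l) *\<^sub>R dir_deriv l u k t))"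
proof -
  have cm: "continuous_on UNIV (mi_monom \<beta>)" for \<beta> :: "nat^'d"
    unfolding mi_monom_def[abs_def] by (intro continuous_intros)
  have int: "integrable lborel (\<lambda>t. indicator (cball 0 h) t * mi_monom \<beta> t)" for \<beta> :: "nat^'d"
    using borel_integrable_compact[of "cball 0 h" "mi_monom \<beta>"] continuous_on_subset[OF cm subset_UNIV] by simp
  have "(LINT t|lborel. indicator (cball 0 h) t *\<^sub>R (\<Sum>l\<le>N. (1 / fact l) *\<^sub>R dir_deriv l u k t))
    = (LINT t|lborel. (\<Sum>\<beta>\<in>mi_Delta (N + 1). (indicator (cball 0 h) t * mi_monom \<beta> t) *\<^sub>R ((1 / mi_fact \<beta>) *\<^sub>R mi_deriv \<beta> u k)))"
    by (simp add: sum_dir_deriv scaleR_sum_right)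
  also have "\<dots> = (\<Sum>\<beta>\<in>mi_Delta (N + 1). (LINT t|lborel. (indicator (cball 0 h) t * mi_monom \<beta> t) *\<^sub>R ((1 / mi_fact \<beta>) *\<^sub>R mi_deriv \<beta> u k)))"
    using int by (intro Bochner_Integration.integral_sum integrable_scaleR_left) auto
  also have "\<dots> = (\<Sum>\<beta>\<in>mi_Delta (N + 1). (LINT t|lborel. indicator (cball 0 h) t * mi_monom \<beta> t) *\<^sub>R ((1 / mi_fact \<beta>) *\<^sub>R mi_deriv \<beta> u k))"
    using int by (intro sum.cong refl integral_scaleR_left) auto
  also have "(1 / ball_vol TYPE('d) h) *\<^sub>R \<dots> = diff_op h N u k"
    unfolding diff_op_def scaleR_sum_right
  proof (intro sum.cong refl)
    fix \<beta> :: "nat^'d"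
    have "(LINT t:cball 0 h|lebesgue. mi_monom \<beta> t) = (LINT t|lborel. indicator (cball 0 h) t * mi_monom \<beta> t)"
      unfolding set_lebesgue_integral_def using int by (simp add: integral_completion borel_measurable_integrable)
    then show "(1 / ball_vol TYPE('d) h) *\<^sub>R (LINT t|lborel. indicator (cball 0 h) t * mi_monom \<beta> t) *\<^sub>R ((1 / mi_fact \<beta>) *\<^sub>R mi_deriv \<beta> u k)
      = coeff_a h \<beta> *\<^sub>R mi_deriv \<beta> u k"
      by (simp add: coeff_a_def mult.commute)
  qed
  finally show ?thesis by simp
qed

lemma det_mat_pow_neg:
  fixes M :: "real^'d^'d"
  assumes "det M \<noteq> 0"
  shows "det (mat_pow_neg M j) \<noteq> 0" "abs_det M ^ j * \<bar>det (mat_pow_neg M j)\<bar> = 1"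
proof -
  have "det M * det (matrix_inv M) = 1"
    using matrix_inv_left_right[OF assms] by (metis det_I det_mul)
  then have "det M ^ j * det (mat_pow_neg M j) = 1"
    unfolding mat_pow_neg_def det_mat_pow power_mult_distrib[symmetric] by simp
  then show "det (mat_pow_neg M j) \<noteq> 0" "abs_det M ^ j * \<bar>det (mat_pow_neg M j)\<bar> = 1"
    by (auto simp: abs_det_def power_abs[symmetric] abs_mult[symmetric])
qed

lemma mat_pow_neg_inverse:
  fixes M :: "real^'d^'d"
  assumes "det M \<noteq> 0"
  shows "mat_pow_neg M j *v (mat_pow M j *v x) = x" "mat_pow M j *v (mat_pow_neg M j *v x) = x"
  using mat_pow_inverse[OF matrix_inv_left_right(1)[OF assms]] mat_pow_inverse[OF matrix_inv_left_right(2)[OF assms]]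
  by (simp_all add: mat_pow_neg_def matrix_vector_mul_assoc)

text \<open>Pulling the integral back from the image of the ball by \<open>A\<close> gives a
  Jacobian that cancels the factor \<open>abs_det M ^ j\<close>; afterwards both parts of
  \<open>eps\<close> are means over the same ball.\<close>

lemma eps_eq_taylor_rem:
  fixes M :: "real^'d^'d" and f :: "real^'d \<Rightarrow> complex" and j :: nat
  assumes M: "det M \<noteq> 0" and C: "Ck N f"
  defines "A \<equiv> mat_pow_neg M j"
  shows "eps M h N f j k = (1 / ball_vol TYPE('d) h) *\<^sub>R
    (LINT t|lborel. indicator (cball 0 h) t *\<^sub>R taylor_rem N f (A *v t) (A *v k))"
proof -
  let ?V = "ball_vol TYPE('d) h"
  have inj: "A *v x = A *v y \<longleftrightarrow> x = y" for x y
    using mat_pow_neg_inverse(2)[OF M, of j] unfolding A_def by metis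
  have cf: "continuous_on UNIV f" using C by (rule Ck_continuous)
  have [measurable]: "f \<in> borel_measurable borel" using cf by (rule borel_measurable_continuous_onI)
  have cpt: "compact ((*v) A ` cball 0 h)"
    by (intro compact_continuous_image matrix_vector_mult_linear_continuous_on) auto
  then have [measurable]: "(*v) A ` cball 0 h \<in> sets borel" by (rule borel_compact)
  have "(LINT t:((*v) A ` cball 0 h)|lebesgue. f (A *v k + t))
    = (LINT t|lborel. indicator ((*v) A ` cball 0 h) t *\<^sub>R f (A *v k + t))"
    unfolding set_lebesgue_integral_def by (rule integral_completion) measurable
  also have "\<dots> = \<bar>det A\<bar> *\<^sub>R (LINT t|lborel. indicator ((*v) A ` cball 0 h) (A *v t) *\<^sub>R f (A *v k + A *v t))"
    by (rule integral_matrix) (use det_mat_pow_neg(1)[OF M] in \<open>simp add: A_def\<close>, measurable)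
  also have "(\<lambda>t. indicator ((*v) A ` cball 0 h) (A *v t) *\<^sub>R f (A *v k + A *v t))
     = (\<lambda>t. indicator (cball 0 h) t *\<^sub>R f (A *v k + A *v t))"
    by (auto simp: fun_eq_iff indicator_def inj)
  finally have 1: "(abs_det M ^ j / ?V) *\<^sub>R (LINT t:((*v) A ` cball 0 h)|lebesgue. f (A *v k + t))
    = (1 / ?V) *\<^sub>R (LINT t|lborel. indicator (cball 0 h) t *\<^sub>R f (A *v k + A *v t))"
    using det_mat_pow_neg(2)[OF M, of j] by (simp add: A_def)
  have "(\<Sum>l\<le>N. (1 / fact l) *\<^sub>R dir_deriv l (\<lambda>x. f (A *v x)) k t)
      = (\<Sum>l\<le>N. (1 / fact l) *\<^sub>R dir_deriv l f (A *v k) (A *v t))" for t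
    by (intro sum.cong refl) (simp add: dir_deriv_linear_comp[OF C])
  then have 2: "diff_op h N (\<lambda>x. f (A *v x)) k = (1 / ?V) *\<^sub>R
    (LINT t|lborel. indicator (cball 0 h) t *\<^sub>R (\<Sum>l\<le>N. (1 / fact l) *\<^sub>R dir_deriv l f (A *v k) (A *v t)))"
    unfolding diff_op_eq_integral by (simp only:)
  have cA: "continuous_on S ((*v) A)" for S by (rule matrix_vector_mult_linear_continuous_on)
  have int: "integrable lborel (\<lambda>t. indicator (cball 0 h) t *\<^sub>R f (A *v k + A *v t))"
    by (intro borel_integrable_compact continuous_on_compose2[OF cf] continuous_intros cA) auto
  have "continuous_on UNIV (\<lambda>t. taylor_rem N f (A *v t) (A *v k))"
    using continuous_on_compose2[OF taylor_rem_continuous[OF C, of A], of UNIV "\<lambda>t. (A *v k, t)"]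
    by (simp add: continuous_on_Pair continuous_on_const continuous_on_id)
  then have int2: "integrable lborel (\<lambda>t. indicator (cball 0 h) t *\<^sub>R taylor_rem N f (A *v t) (A *v k))"
    by (intro borel_integrable_compact) (auto intro: continuous_on_subset)
  have "(LINT t|lborel. indicator (cball 0 h) t *\<^sub>R (\<Sum>l\<le>N. (1 / fact l) *\<^sub>R dir_deriv l f (A *v k) (A *v t)))
    = (LINT t|lborel. indicator (cball 0 h) t *\<^sub>R f (A *v k + A *v t)
        - indicator (cball 0 h) t *\<^sub>R taylor_rem N f (A *v t) (A *v k))"
    by (simp add: taylor_rem_def scaleR_diff_right)
  also have "\<dots> = (LINT t|lborel. indicator (cball 0 h) t *\<^sub>R f (A *v k + A *v t))
     - (LINT t|lborel. indicator (cball 0 h) t *\<^sub>R taylor_rem N f (A *v t) (A *v k))"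
    using int int2 by (rule Bochner_Integration.integral_diff)
  finally show ?thesis unfolding eps_def A_def[symmetric] 1 2 by (simp add: scaleR_diff_right)
qed

lemma norm_eps_le:
  fixes M :: "real^'d^'d" and f :: "real^'d \<Rightarrow> complex" and j :: nat
  assumes M: "det M \<noteq> 0" and C: "Ck N f" and h: "h > 0"
  defines "A \<equiv> mat_pow_neg M j"
  shows "ennreal (norm (eps M h N f j k)) \<le> ennreal (1 / ball_vol TYPE('d) h) *
    (\<integral>\<^sup>+t. indicator (cball 0 h) t * ennreal (norm (taylor_rem N f (A *v t) (A *v k))) \<partial>lborel)"
proof -
  let ?V = "ball_vol TYPE('d) h"
  have "ennreal (norm (eps M h N f j k)) = ennreal (1 / ?V) * ennreal (norm
    (LINT t|lborel. indicator (cball 0 h) t *\<^sub>R taylor_rem N f (A *v t) (A *v k)))"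
    unfolding eps_eq_taylor_rem[OF M C] A_def[symmetric] using ball_vol_pos[OF h, where 'd='d]
    by (simp add: ennreal_mult[symmetric])
  also have "\<dots> \<le> ennreal (1 / ?V) * (\<integral>\<^sup>+t. ennreal (norm (indicator (cball 0 h) t *\<^sub>R taylor_rem N f (A *v t) (A *v k))) \<partial>lborel)"
    by (intro mult_left_mono norm_integral_le_nn_integral) auto
  also have "(\<lambda>t. ennreal (norm (indicator (cball 0 h) t *\<^sub>R taylor_rem N f (A *v t) (A *v k))))
     = (\<lambda>t. indicator (cball 0 h) t * ennreal (norm (taylor_rem N f (A *v t) (A *v k))))"
    by (auto simp: fun_eq_iff indicator_def)
  finally show ?thesis .
qed

section \<open>Powers of integrals\<close>

lemma ennpowr_ennreal: "0 \<le> a \<Longrightarrow> ennpowr (ennreal a) r = ennreal (a powr r)"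
  by (simp add: ennpowr_def)

lemma ennpowr_top [simp]: "ennpowr top r = top"
  by (simp add: ennpowr_def)

lemma ennpowr_0 [simp]: "ennpowr 0 r = 0"
  by (simp add: ennpowr_def)

lemma ennpowr_mono: "x \<le> y \<Longrightarrow> 0 \<le> r \<Longrightarrow> ennpowr x r \<le> ennpowr y r"
  by (cases x; cases y) (auto simp: ennpowr_ennreal top_unique intro!: ennreal_leI powr_mono2)

lemma ennpowr_mult: "0 < r \<Longrightarrow> ennpowr (x * y) r = ennpowr x r * ennpowr y r"
  by (cases x; cases y)
     (auto simp: ennpowr_ennreal ennreal_mult[symmetric] powr_mult ennreal_mult_top ennreal_top_mult)

lemma ennpowr_ennpowr: "ennpowr (ennpowr x r) s = ennpowr x (r * s)"
  by (cases x) (auto simp: ennpowr_ennreal powr_powr)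

lemma ennpowr_1 [simp]: "ennpowr x 1 = x"
  by (cases x) (auto simp: ennpowr_ennreal)

lemma ennpowr_inverse: "0 < r \<Longrightarrow> ennpowr (ennpowr x r) (1 / r) = x" "0 < r \<Longrightarrow> ennpowr (ennpowr x (1 / r)) r = x"
  by (simp_all add: ennpowr_ennpowr)

lemma ennpowr_add: "0 < r \<Longrightarrow> 0 < s \<Longrightarrow> ennpowr x r * ennpowr x s = ennpowr x (r + s)"
  by (cases x) (auto simp: ennpowr_ennreal ennreal_mult[symmetric] powr_add ennreal_mult_top)

lemma ennpowr_eq_0_iff: "ennpowr x r = 0 \<longleftrightarrow> x = 0"
  by (cases x) (auto simp: ennpowr_ennreal)

lemma ennpowr_less_top: "x < top \<Longrightarrow> ennpowr x r < top"
  by (cases x) (auto simp: ennpowr_ennreal)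

lemma ennpowr_measurable [measurable]:
  assumes [measurable]: "f \<in> borel_measurable M"
  shows "(\<lambda>x. ennpowr (f x) r) \<in> borel_measurable M"
  unfolding ennpowr_def by measurable

text \<open>The convex function x^q lies above its tangent at \<open>c\<close>. The inequality is
  written without subtraction so that it makes sense for infinite \<open>e\<close>.\<close>

lemma ennpowr_tangent:
  assumes q: "q > 1" and c: "c > 0"
  shows "ennreal (q * c powr (q - 1)) * e \<le> ennpowr e q + ennreal ((q - 1) * c powr q)"
proof (cases e)
  case (real r)
  have "1 / q + 1 / (q / (q - 1)) = 1" using q by (simp add: field_simps)
  moreover have "q / (q - 1) > 1" using q by (simp add: field_simps)
  ultimately have "r * c powr (q - 1) \<le> r powr q / q + (c powr (q - 1)) powr (q / (q - 1)) / (q / (q - 1))"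
    using q real by (intro Youngs_inequality) auto
  also have "(c powr (q - 1)) powr (q / (q - 1)) = c powr q" using q by (simp add: powr_powr)
  finally have "q * (r * c powr (q - 1)) \<le> q * (r powr q / q + c powr q / (q / (q - 1)))"
    using q by (intro mult_left_mono) auto
  also have "\<dots> = r powr q + (q - 1) * c powr q" using q by (simp add: field_simps)
  finally have "q * c powr (q - 1) * r \<le> r powr q + (q - 1) * c powr q" by (simp add: mult_ac)
  then show ?thesis using q c real
    by (simp add: ennpowr_ennreal ennreal_mult[symmetric] ennreal_plus[symmetric] ennreal_leI del: ennreal_plus)
qed (simp add: top_add)

text \<open>Jensen's inequality for a finite weight \<open>w\<close>, obtained by integrating the
  tangent inequality and then choosing the point of tangency.\<close>

lemma ennpowr_nn_integral_le:
  assumes q: "q > 1" and [measurable]: "w \<in> borel_measurable M" "e \<in> borel_measurable M"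
    and W: "(\<integral>\<^sup>+x. w x \<partial>M) < top"
  shows "ennpowr (\<integral>\<^sup>+x. w x * e x \<partial>M) q \<le> ennpowr (\<integral>\<^sup>+x. w x \<partial>M) (q - 1) * (\<integral>\<^sup>+x. w x * ennpowr (e x) q \<partial>M)"
proof -
  let ?I = "\<integral>\<^sup>+x. w x * e x \<partial>M" and ?W = "\<integral>\<^sup>+x. w x \<partial>M" and ?J = "\<integral>\<^sup>+x. w x * ennpowr (e x) q \<partial>M"
  have key: "ennreal (q * c powr (q - 1)) * ?I \<le> ?J + ennreal ((q - 1) * c powr q) * ?W" if "c > 0" for c
  proof -
    have "ennreal (q * c powr (q - 1)) * ?I = (\<integral>\<^sup>+x. w x * (ennreal (q * c powr (q - 1)) * e x) \<partial>M)"
      by (simp add: nn_integral_cmult[symmetric] mult_ac)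
    also have "\<dots> \<le> (\<integral>\<^sup>+x. w x * (ennpowr (e x) q + ennreal ((q - 1) * c powr q)) \<partial>M)"
      by (intro nn_integral_mono mult_left_mono ennpowr_tangent q that) auto
    also have "\<dots> = ?J + ennreal ((q - 1) * c powr q) * ?W"
      by (simp add: distrib_left nn_integral_add nn_integral_multc mult.commute)
    finally show ?thesis .
  qed
  show ?thesis
  proof (cases "?W = 0")
    case True
    then have "AE x in M. w x = 0" by (simp add: nn_integral_0_iff_AE)
    then have "?I = 0" by (subst nn_integral_0_iff_AE) auto
    then show ?thesis by simp
  next
    case W0: False
    show ?thesis
    proof (cases "?J = top")
      case True
      then show ?thesis using W0 by (simp add: ennreal_mult_top ennpowr_eq_0_iff)
    next
      case False
      then obtain J where J: "?J = ennreal J" "J \<ge> 0" by (cases ?J) auto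
      obtain W where Wr: "?W = ennreal W" "W > 0" using W0 W by (cases ?W) (auto simp: less_le)
      \<comment> \<open>The tangent at 1 already shows that the integral is finite, so that the mean
        value can be used as a real point of tangency.\<close>
      have "ennreal q * ?I \<le> ennreal J + ennreal (q - 1) * ennreal W"
        using key[of 1] J Wr by simp
      also have "\<dots> < top" by (simp add: ennreal_mult_less_top)
      finally have "?I \<noteq> top" using q by (auto simp: ennreal_mult_top)
      then obtain I where I: "?I = ennreal I" "I \<ge> 0" by (cases ?I) auto
      show ?thesis
      proof (cases "I = 0")
        case False
        \<comment> \<open>The \<open>w\<close>-mean of \<open>e\<close> is the point of tangency
          that makes the estimate sharp.\<close>
        define c where "c = I / W"
        have c: "c > 0" using False I Wr by (simp add: c_def)
        have "ennreal (q * c powr (q - 1) * I) \<le> ennreal (J + (q - 1) * c powr q * W)"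
          using key[OF c] I J Wr q by (simp add: ennreal_mult[symmetric] ennreal_plus[symmetric] del: ennreal_plus)
        then have le: "q * c powr (q - 1) * I \<le> J + (q - 1) * c powr q * W"
          using J Wr q by (subst (asm) ennreal_le_iff) auto
        have IW: "I = c * W" using Wr by (simp add: c_def)
        have cq: "c powr q = c powr (q - 1) * c" using c by (simp add: powr_diff)
        have "c powr q * W \<le> J" using le unfolding IW cq by (simp add: algebra_simps)
        then have "W powr (q - 1) * (c powr q * W) \<le> W powr (q - 1) * J" by (rule mult_left_mono) simp
        moreover have "W powr (q - 1) * (c powr q * W) = I powr q"
          unfolding IW using Wr c by (simp add: powr_mult powr_diff)
        ultimately show ?thesis using I J Wr
          by (simp add: ennpowr_ennreal ennreal_mult[symmetric] ennreal_leI)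
      qed (use I in simp)
    qed
  qed
qed

lemma nn_integral_powr_unit_interval:
  assumes "b < 1"
  shows "(\<integral>\<^sup>+s. indicator {0..1::real} s * ennreal (s powr (- b)) \<partial>lborel) = ennreal (1 / (1 - b))"
proof -
  have "((\<lambda>s. s powr (- b)) has_integral (1 powr (- b + 1) / (- b + 1))) {0..1}"
    using assms by (intro has_integral_powr_from_0) auto
  from nn_integral_has_integral_lebesgue'[OF _ this] show ?thesis by (simp add: mult.commute)
qed

text \<open>Scaling by \<open>s\<close> has inverse Jacobian \<open>s powr (- d)\<close>, with d the
  dimension, and since \<open>s\<close> is at most 1 it maps the ball into itself.\<close>

lemma nn_integral_scale_ball_le:
  fixes F :: "real^'d \<Rightarrow> ennreal"
  assumes [measurable]: "F \<in> borel_measurable borel" and s: "0 < s" "s \<le> 1"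
  shows "(\<integral>\<^sup>+t. indicator (cball 0 h) t * F (s *\<^sub>R t) \<partial>lborel)
    \<le> ennreal (s powr (- real CARD('d))) * (\<integral>\<^sup>+u. indicator (cball 0 h) u * F u \<partial>lborel)"
proof -
  let ?A = "mat s :: real^'d^'d"
  have [measurable]: "cball (0::real^'d) h \<in> sets borel" by simp
  have A: "?A *v x = s *\<^sub>R x" for x
    by (simp add: vec_eq_iff matrix_vector_mult_def mat_def if_distrib[of "\<lambda>c. c * _"] cong: if_cong)
  have det: "det ?A = s ^ CARD('d)" by (subst det_diagonal) (simp_all add: mat_def)
  have "(\<integral>\<^sup>+t. indicator (cball 0 h) t * F (s *\<^sub>R t) \<partial>lborel)
    \<le> (\<integral>\<^sup>+t. indicator (cball 0 h) (s *\<^sub>R t) * F (s *\<^sub>R t) \<partial>lborel)"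
  proof (intro nn_integral_mono mult_right_mono)
    fix t :: "real^'d"
    have "norm (s *\<^sub>R t) \<le> norm t" using s by (simp add: mult_left_le_one_le)
    then show "indicator (cball 0 h) t \<le> (indicator (cball 0 h) (s *\<^sub>R t) :: ennreal)"
      by (auto simp: indicator_def)
  qed auto
  also have "\<dots> = ennreal (s powr (- real CARD('d))) * (ennreal \<bar>det ?A\<bar> * (\<integral>\<^sup>+t. indicator (cball 0 h) (s *\<^sub>R t) * F (s *\<^sub>R t) \<partial>lborel))"
    using s by (simp add: det mult.assoc[symmetric] ennreal_mult[symmetric] powr_minus powr_realpow)
  also have "ennreal \<bar>det ?A\<bar> * (\<integral>\<^sup>+t. indicator (cball 0 h) (s *\<^sub>R t) * F (s *\<^sub>R t) \<partial>lborel)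
     = (\<integral>\<^sup>+u. indicator (cball 0 h) u * F u \<partial>lborel)"
    using nn_integral_matrix[of ?A "\<lambda>u. indicator (cball 0 h) u * F u"] s by (simp add: det A)
  finally show ?thesis .
qed

text \<open>This is where \<open>p > d\<close> is needed: by Jensen the inner average over \<open>sB\<^sub>h\<close> is of order
  \<open>s\<^sup>-\<^sup>d\<^sup>/\<^sup>q\<close>, which is integrable at \<open>0\<close>.\<close>

lemma ennpowr_ray_integral_le:
  fixes A :: "real^'d^'d"
  assumes q: "real CARD('d) < q" and h: "h > 0" and [measurable]: "G \<in> borel_measurable borel"
  shows "ennpowr (ray_integral h A G y) q
    \<le> ennreal (ball_vol TYPE('d) h powr (q - 1) * (1 / (1 - CARD('d) / q)) powr q) *
      (\<integral>\<^sup>+u. indicator (cball 0 h) u * ennpowr (G (y + A *v u)) q \<partial>lborel)"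
proof -
  let ?d = "real CARD('d)" and ?V = "ball_vol TYPE('d) h"
  let ?Q = "\<integral>\<^sup>+u. indicator (cball 0 h) u * ennpowr (G (y + A *v u)) q \<partial>lborel"
  have "?d \<ge> 1" by (simp add: Suc_le_eq)
  then have q1: "q > 1" using q by linarith
  have [measurable]: "cball (0::real^'d) h \<in> sets borel" by simp
  have [measurable]: "(\<lambda>t. A *v t) \<in> borel \<rightarrow>\<^sub>M borel" by measurable
  have V: "?V > 0" by (rule ball_vol_pos[OF h])
  have Ve: "(\<integral>\<^sup>+t. indicator (cball (0::real^'d) h) t \<partial>lborel) = ennreal ?V"
    using emeasure_compact_finite[OF compact_cball, of "0::real^'d" h]
    by (simp add: emeasure_eq_ennreal_measure ball_vol_def)
  let ?P = "ennreal (?V powr (q - 1)) * ?Q"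
  have inner: "(\<integral>\<^sup>+t. indicator (cball 0 h) t * G (y + s *\<^sub>R (A *v t)) \<partial>lborel)
    \<le> ennpowr ?P (1 / q) * ennreal (s powr (- (?d / q)))" if s: "0 < s" "s \<le> 1" for s
  proof -
    let ?K = "\<integral>\<^sup>+t. indicator (cball 0 h) t * G (y + s *\<^sub>R (A *v t)) \<partial>lborel"
    have 1: "ennpowr ?K q \<le> ennpowr (ennreal ?V) (q - 1) * (\<integral>\<^sup>+t. indicator (cball 0 h) t * ennpowr (G (y + s *\<^sub>R (A *v t))) q \<partial>lborel)"
      using ennpowr_nn_integral_le[OF q1, of "indicator (cball 0 h)" lborel "\<lambda>t. G (y + s *\<^sub>R (A *v t))"]
      by (simp add: Ve)
    have 2: "(\<integral>\<^sup>+t. indicator (cball 0 h) t * ennpowr (G (y + s *\<^sub>R (A *v t))) q \<partial>lborel)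
       \<le> ennreal (s powr (- ?d)) * ?Q"
      using nn_integral_scale_ball_le[of "\<lambda>u. ennpowr (G (y + A *v u)) q" s h] s
      by (simp add: matrix_vector_mult_scaleR)
    have "ennpowr ?K q \<le> ?P * ennreal (s powr (- ?d))"
      using order_trans[OF 1 mult_left_mono[OF 2]] V by (simp add: ennpowr_ennreal mult_ac)
    then have "ennpowr (ennpowr ?K q) (1 / q) \<le> ennpowr (?P * ennreal (s powr (- ?d))) (1 / q)"
      using q1 by (intro ennpowr_mono) auto
    then show ?thesis
      using q1 by (simp add: ennpowr_inverse ennpowr_mult ennpowr_ennreal powr_powr)
  qed
  have "(ray_integral h A G y)
    = (\<integral>\<^sup>+t. (\<integral>\<^sup>+s. indicator {0..1::real} s * (indicator (cball 0 h) t * G (y + s *\<^sub>R (A *v t))) \<partial>lborel) \<partial>lborel)"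
    by (simp add: nn_integral_cmult[symmetric] mult_ac)
  also have "\<dots> = (\<integral>\<^sup>+s. (\<integral>\<^sup>+t. indicator {0..1::real} s * (indicator (cball 0 h) t * G (y + s *\<^sub>R (A *v t))) \<partial>lborel) \<partial>lborel)"
    by (rule lborel_pair.Fubini') measurable
  also have "\<dots> = (\<integral>\<^sup>+s. indicator {0..1::real} s * (\<integral>\<^sup>+t. indicator (cball 0 h) t * G (y + s *\<^sub>R (A *v t)) \<partial>lborel) \<partial>lborel)"
    by (simp add: nn_integral_cmult)
  also have "\<dots> \<le> (\<integral>\<^sup>+s. ennpowr ?P (1 / q) * (indicator {0..1::real} s * ennreal (s powr (- (?d / q)))) \<partial>lborel)"
  proof (rule nn_integral_mono_AE)
    \<comment> \<open>Since \<open>0 powr x = 0\<close>, the right side vanishes at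
      \<open>s = 0\<close>, and the bound may fail at this single point.\<close>
    have "AE s in lborel. s \<noteq> (0::real)" by (rule AE_lborel_singleton)
    then show "AE s in lborel. indicator {0..1::real} s * (\<integral>\<^sup>+t. indicator (cball 0 h) t * G (y + s *\<^sub>R (A *v t)) \<partial>lborel)
       \<le> ennpowr ?P (1 / q) * (indicator {0..1::real} s * ennreal (s powr (- (?d / q))))"
      by eventually_elim (use inner in \<open>auto simp: indicator_def\<close>)
  qed
  also have "\<dots> = ennpowr ?P (1 / q) * ennreal (1 / (1 - ?d / q))"
    using q q1 by (subst nn_integral_cmult) (auto simp: nn_integral_powr_unit_interval)
  finally have "ennpowr (ray_integral h A G y) q
     \<le> ennpowr (ennpowr ?P (1 / q) * ennreal (1 / (1 - ?d / q))) q"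
    using q1 by (intro ennpowr_mono) auto
  also have "\<dots> = ?P * ennreal ((1 / (1 - ?d / q)) powr q)"
    using q q1 by (subst ennpowr_mult) (simp_all only: ennpowr_inverse, auto simp: ennpowr_ennreal)
  also have "\<dots> = ennreal (?V powr (q - 1) * (1 / (1 - ?d / q)) powr q) * ?Q"
    by (simp add: ennreal_mult mult_ac)
  finally show ?thesis .
qed

section \<open>Bounds on \<open>\<epsilon>\<^sub>j(k)\<close>\<close>

lemma mat_pow_bounded: "\<exists>L>0. \<forall>v. norm (mat_pow (M :: real^'d^'d) j *v v) \<le> L * norm v"
proof -
  have "bounded_linear ((*v) (mat_pow M j))" by simp
  from bounded_linear.pos_bounded[OF this] show ?thesis by (auto simp: mult.commute)
qed

text \<open>The neighbourhood of the base point is described through \<open>v\<close> in the unit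
  ball, before \<open>A\<close> is applied, and hence has the same shape for all \<open>j\<close>.
  The constant \<open>D\<close> collects the mean value factor \<open>1 / ?V\<close>, the radius
  \<open>h\<close> and the bound for the inverse powers.\<close>

lemma eps_bound_by_ray_integral:
  fixes M :: "real^'d^'d" and f :: "real^'d \<Rightarrow> complex" and N :: nat
  assumes \<theta>: "\<theta> > 0" "\<And>ev. complex_eigenvalue M ev \<Longrightarrow> \<theta> < cmod ev"
    and C: "Ck N f"
    and weak: "top_weak_derivs N f g"
    and h: "h > 0"
  shows "\<exists>D\<ge>0. \<forall>j k B. (\<forall>v. norm v \<le> 1 \<longrightarrow>
      ray_integral h (mat_pow_neg M j) (top_deriv_sum N g) (mat_pow_neg M j *v (k + v)) \<le> B) \<longrightarrow>
      ennreal (norm (eps M h N f j k)) \<le> ennreal (D * \<theta> powr (- real (j * (N + 1)))) * B"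
proof -
  let ?V = "ball_vol TYPE('d) h"
  have V: "?V > 0" by (rule ball_vol_pos[OF h])
  have "\<not> complex_eigenvalue M 0" using \<theta> by force
  then have M: "det M \<noteq> 0" by (rule det_nonzero_if_not_eigenvalue_0)
  obtain c where c: "c \<ge> 0" "\<And>j t. norm (mat_pow_neg M j *v t) \<le> (c / \<theta> ^ j) * norm t"
    using mat_pow_inv_bound[OF \<theta>] by blast
  define D where "D = (1 / ?V) * (Suc N * (c * h) ^ Suc N)"
  have D: "D \<ge> 0" using V c h by (simp add: D_def)
  have "ennreal (norm (eps M h N f j k)) \<le> ennreal (D * \<theta> powr (- real (j * (N + 1)))) * B"
    if B: "\<And>v. norm v \<le> 1 \<Longrightarrow> ray_integral h (mat_pow_neg M j) (top_deriv_sum N g) (mat_pow_neg M j *v (k + v)) \<le> B" for j k B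
  proof -
    let ?A = "mat_pow_neg M j"
    obtain L where L: "L > 0" "\<And>v. norm (mat_pow M j *v v) \<le> L * norm v"
      using mat_pow_bounded[of M j] by blast
    have "ennreal (norm (eps M h N f j k)) \<le> ennreal (1 / ?V) *
        (\<integral>\<^sup>+t. indicator (cball 0 h) t * ennreal (norm (taylor_rem N f (?A *v t) (?A *v k))) \<partial>lborel)"
      by (rule norm_eps_le[OF M C h])
    also have "\<dots> \<le> ennreal (1 / ?V) * (ennreal (Suc N * ((c / \<theta> ^ j) * h) ^ Suc N) * B)"
    proof (intro mult_left_mono nn_integral_taylor_rem_ball_le[OF C weak c(2) _ h])
      \<comment> \<open>The radius \<open>1 / L\<close> depends on \<open>j\<close>; it is such that
        \<open>mat_pow M j\<close> maps the ball of this radius into the unit ball.\<close>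
      fix y assume y: "norm (y - ?A *v k) \<le> 1 / L"
      define v where "v = mat_pow M j *v (y - ?A *v k)"
      have "norm v \<le> L * norm (y - ?A *v k)" unfolding v_def by (rule L)
      also have "\<dots> \<le> L * (1 / L)" using y L(1) by (intro mult_left_mono) auto
      finally have "norm v \<le> 1" using L(1) by simp
      moreover have "?A *v (k + v) = y"
        by (simp add: v_def matrix_vector_right_distrib mat_pow_neg_inverse[OF M])
      ultimately show "ray_integral h ?A (top_deriv_sum N g) y \<le> B"
        using B[of v] by simp
    qed (use c \<theta> L in auto)
    also have "\<dots> = ennreal ((1 / ?V) * (Suc N * ((c / \<theta> ^ j) * h) ^ Suc N)) * B"
    proof -
      have "ennreal ((1 / ?V) * Y) = ennreal (1 / ?V) * ennreal Y" for Y
        using V by (intro ennreal_mult') simp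
      then show ?thesis by (simp only: mult.assoc)
    qed
    also have "(1 / ?V) * (Suc N * ((c / \<theta> ^ j) * h) ^ Suc N) = D * \<theta> powr (- real (j * (N + 1)))"
    proof -
      have "\<theta> powr (- real (j * (N + 1))) = 1 / \<theta> ^ (j * Suc N)"
        using \<theta>(1) by (simp only: powr_minus powr_realpow inverse_eq_divide) simp
      moreover have "((c / \<theta> ^ j) * h) ^ Suc N = (c * h) ^ Suc N * (1 / \<theta> ^ (j * Suc N))"
        by (simp only: power_mult_distrib power_divide power_mult) simp
      ultimately show ?thesis by (simp only: D_def mult.assoc)
    qed
    finally show ?thesis .
  qed
  with D show ?thesis by blast
qed

text \<open>\<open>ennpowr_ray_integral_le\<close> bounds every ray integral near \<open>k\<close>
  by the same local integral, whose \<open>q\<close>-th root is then taken as \<open>B\<close>.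
  Keeping \<open>q\<close>-th powers in the statement makes it ready for summation over
  \<open>k\<close>.\<close>

lemma eps_bound_finite_exponent:
  fixes M :: "real^'d^'d" and f :: "real^'d \<Rightarrow> complex" and N :: nat
  assumes \<theta>: "\<theta> > 0" "\<And>ev. complex_eigenvalue M ev \<Longrightarrow> \<theta> < cmod ev"
    and C: "Ck N f"
    and weak: "top_weak_derivs N f g"
    and h: "h > 0" and q: "real CARD('d) < q"
  shows "\<exists>D\<ge>0. \<forall>j k. ennpowr (ennreal (norm (eps M h N f j k))) q \<le>
      ennreal (D * (\<theta> powr (- real (j * (N + 1)))) powr q) *
      (\<integral>\<^sup>+u. indicator (cball k (h + 1)) u * ennpowr (top_deriv_sum N g (mat_pow_neg M j *v u)) q \<partial>lborel)"
proof -
  let ?G = "top_deriv_sum N g"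
  have [measurable]: "?G \<in> borel_measurable borel" using weak by (rule top_deriv_sum_measurable)
  have [measurable]: "(\<lambda>u. (A :: real^'d^'d) *v u) \<in> borel \<rightarrow>\<^sub>M borel" for A by measurable
  have [measurable]: "cball (x::real^'d) r \<in> sets borel" for x r by simp
  have "real CARD('d) \<ge> 1" by (simp add: Suc_le_eq)
  then have q0: "q > 0" using q by linarith
  obtain D where D: "D \<ge> 0" "\<And>j k B. (\<And>v. norm v \<le> 1 \<Longrightarrow>
      ray_integral h (mat_pow_neg M j) ?G (mat_pow_neg M j *v (k + v)) \<le> B) \<Longrightarrow>
      ennreal (norm (eps M h N f j k)) \<le> ennreal (D * \<theta> powr (- real (j * (N + 1)))) * B"
    using eps_bound_by_ray_integral[OF \<theta> C weak h] by blast
  define c where "c = ball_vol TYPE('d) h powr (q - 1) * (1 / (1 - CARD('d) / q)) powr q"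
  have c0: "c \<ge> 0" by (simp add: c_def)
  have "ennpowr (ennreal (norm (eps M h N f j k))) q \<le>
      ennreal ((D powr q * c) * (\<theta> powr (- real (j * (N + 1)))) powr q) *
      (\<integral>\<^sup>+u. indicator (cball k (h + 1)) u * ennpowr (?G (mat_pow_neg M j *v u)) q \<partial>lborel)" for j k
  proof -
    let ?A = "mat_pow_neg M j"
    let ?Q = "\<integral>\<^sup>+u. indicator (cball k (h + 1)) u * ennpowr (?G (?A *v u)) q \<partial>lborel"
    have "ray_integral h ?A ?G (?A *v (k + v)) \<le> ennpowr (ennreal c * ?Q) (1 / q)" (is "?H \<le> _")
      if v: "norm v \<le> 1" for v
    proof -
      have "ennpowr ?H q \<le> ennreal c * (\<integral>\<^sup>+u. indicator (cball 0 h) u * ennpowr (?G (?A *v (k + v) + ?A *v u)) q \<partial>lborel)"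
        unfolding c_def by (rule ennpowr_ray_integral_le[OF q h]) measurable
      \<comment> \<open>The shift by \<open>v\<close> is traded for the larger radius
        \<open>h + 1\<close>, after which the bound no longer depends on \<open>v\<close>.\<close>
      also have "\<dots> \<le> ennreal c * (\<integral>\<^sup>+u. indicator (cball k (h + 1)) (u + (k + v)) * ennpowr (?G (?A *v (u + (k + v)))) q \<partial>lborel)"
      proof (intro mult_left_mono nn_integral_mono)
        fix u
        have "u + (k + v) \<in> cball k (h + 1)" if "u \<in> cball 0 h"
          using that v norm_triangle_ineq[of v u] by (simp add: dist_norm norm_minus_commute add.commute)
        then show "indicator (cball 0 h) u * ennpowr (?G (?A *v (k + v) + ?A *v u)) q
          \<le> indicator (cball k (h + 1)) (u + (k + v)) * ennpowr (?G (?A *v (u + (k + v)))) q"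
          by (auto simp: indicator_def matrix_vector_right_distrib add.commute)
      qed auto
      also have "(\<integral>\<^sup>+u. indicator (cball k (h + 1)) (u + (k + v)) * ennpowr (?G (?A *v (u + (k + v)))) q \<partial>lborel) = ?Q"
        by (rule nn_integral_lborel_translate[of "\<lambda>u. indicator (cball k (h + 1)) u * ennpowr (?G (?A *v u)) q"]) measurable
      finally have "ennpowr (ennpowr ?H q) (1 / q) \<le> ennpowr (ennreal c * ?Q) (1 / q)"
        using q0 by (intro ennpowr_mono) auto
      then show ?thesis using q0 by (simp only: ennpowr_inverse)
    qed
    then have "ennreal (norm (eps M h N f j k)) \<le> ennreal (D * \<theta> powr (- real (j * (N + 1)))) * ennpowr (ennreal c * ?Q) (1 / q)"
      by (rule D(2))
    then have "ennpowr (ennreal (norm (eps M h N f j k))) q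
      \<le> ennpowr (ennreal (D * \<theta> powr (- real (j * (N + 1)))) * ennpowr (ennreal c * ?Q) (1 / q)) q"
      using q0 by (intro ennpowr_mono) auto
    also have "\<dots> = ennpowr (ennreal (D * \<theta> powr (- real (j * (N + 1))))) q * (ennreal c * ?Q)"
      using q0 by (subst ennpowr_mult) (simp_all only: ennpowr_inverse)
    also have "\<dots> = ennreal ((D powr q * c) * (\<theta> powr (- real (j * (N + 1)))) powr q) * ?Q"
    proof -
      have "ennpowr (ennreal (D * P)) q * (ennreal c * Q) = ennreal ((D powr q * c) * P powr q) * Q"
        if "P \<ge> 0" for P Q
        using that D(1) c0 by (subst ennpowr_ennreal) (simp_all add: powr_mult ennreal_mult mult_ac)
      then show ?thesis by simp
    qed
    finally show ?thesis .
  qed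
  then show ?thesis using c0 by (intro exI[of _ "D powr q * c"]) auto
qed

lemma eps_bound_infinite_exponent:
  fixes M :: "real^'d^'d" and f :: "real^'d \<Rightarrow> complex" and N :: nat
  assumes \<theta>: "\<theta> > 0" "\<And>ev. complex_eigenvalue M ev \<Longrightarrow> \<theta> < cmod ev"
    and C: "Ck N f"
    and weak: "top_weak_derivs N f g"
    and h: "h > 0" and \<Gamma>: "\<And>y. top_deriv_sum N g y \<le> ennreal \<Gamma>" "\<Gamma> \<ge> 0"
  shows "\<exists>D\<ge>0. \<forall>j k. norm (eps M h N f j k) \<le> D * \<theta> powr (- real (j * (N + 1)))"
proof -
  obtain D where D: "D \<ge> 0" "\<And>j k B. (\<And>v. norm v \<le> 1 \<Longrightarrow>
      ray_integral h (mat_pow_neg M j) (top_deriv_sum N g) (mat_pow_neg M j *v (k + v)) \<le> B) \<Longrightarrow>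
      ennreal (norm (eps M h N f j k)) \<le> ennreal (D * \<theta> powr (- real (j * (N + 1)))) * B"
    using eps_bound_by_ray_integral[OF \<theta> C weak h] by blast
  let ?V = "ball_vol TYPE('d) h"
  have V: "emeasure lborel (cball (0::real^'d) h) = ennreal ?V"
    using emeasure_compact_finite[OF compact_cball, of "0::real^'d" h]
    by (simp add: emeasure_eq_ennreal_measure ball_vol_def)
  have "norm (eps M h N f j k) \<le> (D * (?V * \<Gamma>)) * \<theta> powr (- real (j * (N + 1)))" for j k
  proof -
    have "ennreal (norm (eps M h N f j k)) \<le> ennreal (D * \<theta> powr (- real (j * (N + 1)))) * (ennreal ?V * ennreal \<Gamma>)"
    proof (rule D(2))
      fix v :: "real^'d"
      have "ray_integral h (mat_pow_neg M j) (top_deriv_sum N g) (mat_pow_neg M j *v (k + v))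
        \<le> (\<integral>\<^sup>+t. indicator (cball (0::real^'d) h) t * (\<integral>\<^sup>+s. indicator {0..1::real} s * ennreal \<Gamma> \<partial>lborel) \<partial>lborel)"
        by (intro nn_integral_mono mult_left_mono \<Gamma>) auto
      also have "\<dots> = ennreal ?V * ennreal \<Gamma>"
      proof -
        have [measurable]: "cball (0::real^'d) h \<in> sets borel" by simp
        have "(\<integral>\<^sup>+t. indicator (cball (0::real^'d) h) t * ennreal \<Gamma> \<partial>lborel) = ennreal ?V * ennreal \<Gamma>"
          by (subst nn_integral_multc) (simp_all add: V)
        then show ?thesis by (simp add: nn_integral_multc)
      qed
      finally show "ray_integral h (mat_pow_neg M j) (top_deriv_sum N g) (mat_pow_neg M j *v (k + v))
        \<le> ennreal ?V * ennreal \<Gamma>" .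
    qed
    also have "\<dots> = ennreal ((D * (?V * \<Gamma>)) * \<theta> powr (- real (j * (N + 1))))"
      using D(1) \<Gamma>(2) ball_vol_pos[OF h, where 'd='d] by (simp add: ennreal_mult[symmetric] mult_ac)
    finally show ?thesis
      using D(1) \<Gamma>(2) ball_vol_pos[OF h, where 'd='d] by (subst (asm) ennreal_le_iff) auto
  qed
  moreover have "D * (?V * \<Gamma>) \<ge> 0" using D(1) \<Gamma>(2) ball_vol_pos[OF h, where 'd='d] by simp
  ultimately show ?thesis by blast
qed

section \<open>Lattice sums\<close>

lemma int_lattice_eq: "int_lattice = range (\<lambda>z::'d::finite \<Rightarrow> int. \<chi> i. of_int (z i))"
proof
  show "int_lattice \<subseteq> range (\<lambda>z::'d \<Rightarrow> int. \<chi> i. of_int (z i))"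
  proof
    fix k :: "real^'d" assume "k \<in> int_lattice"
    then have "\<forall>i. \<exists>z. k $ i = of_int z" by (auto simp: int_lattice_def Ints_def)
    then obtain z where "\<And>i. k $ i = of_int (z i)" by metis
    then have "k = (\<chi> i. of_int (z i))" by (simp add: vec_eq_iff)
    then show "k \<in> range (\<lambda>z::'d \<Rightarrow> int. \<chi> i. of_int (z i))" by blast
  qed
qed (auto simp: int_lattice_def)

lemma countable_int_lattice [simp]: "countable (int_lattice :: (real^'d) set)"
  unfolding int_lattice_eq by simp

lemma infinite_int_lattice: "infinite (int_lattice :: (real^'d) set)"
proof -
  have "inj (\<lambda>n::nat. (\<chi> i. real n) :: real^'d)" by (auto simp: inj_on_def vec_eq_iff)
  then have "infinite (range (\<lambda>n::nat. (\<chi> i. real n) :: real^'d))" by (rule range_inj_infinite)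
  moreover have "range (\<lambda>n::nat. (\<chi> i. real n) :: real^'d) \<subseteq> int_lattice" by (auto simp: int_lattice_def)
  ultimately show ?thesis by (metis finite_subset)
qed

lemma int_lattice_add: "k \<in> int_lattice \<Longrightarrow> l \<in> int_lattice \<Longrightarrow> k + l \<in> int_lattice"
  and int_lattice_diff: "k \<in> int_lattice \<Longrightarrow> l \<in> int_lattice \<Longrightarrow> k - l \<in> int_lattice"
  and int_lattice_minus: "k \<in> int_lattice \<Longrightarrow> - k \<in> int_lattice"
  by (auto simp: int_lattice_def)

lemma bij_lattice_minus: "bij_betw uminus int_lattice (int_lattice :: (real^'d) set)"
  by (rule bij_betw_byWitness[where f'=uminus]) (auto intro: int_lattice_minus)

lemma bij_lattice_add: "l \<in> int_lattice \<Longrightarrow> bij_betw (\<lambda>k. l + k) int_lattice int_lattice"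
  by (rule bij_betw_byWitness[where f'="\<lambda>k. k - l"]) (auto intro: int_lattice_add int_lattice_diff)

lemma bij_lattice_diff: "r \<in> int_lattice \<Longrightarrow> bij_betw (\<lambda>l. r - l) int_lattice int_lattice"
  by (rule bij_betw_byWitness[where f'="\<lambda>l. r - l"]) (auto intro: int_lattice_diff)

text \<open>Lattice sums are handled as integrals over \<open>count_space\<close>, where Fubini is
  available; this inequality carries the finiteness in \<open>in_calLp\<close>, which is stated with
  \<open>infsum\<close>, over to them.\<close>

lemma nn_integral_count_space_le_infsum:
  fixes F :: "'a \<Rightarrow> ennreal"
  assumes "countable L" "infinite L"
  shows "(\<integral>\<^sup>+k. F k \<partial>count_space L) \<le> infsum F L"
proof -
  have b: "bij_betw (from_nat_into L) UNIV L" using assms by (rule bij_betw_from_nat_into)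
  have "(\<integral>\<^sup>+k. F k \<partial>count_space L) = (\<Sum>n. F (from_nat_into L n))"
    by (simp add: nn_integral_bij_count_space[OF b, symmetric] nn_integral_count_space_nat)
  also have "\<dots> = (SUP n. \<Sum>i<n. F (from_nat_into L i))" by (rule suminf_eq_SUP)
  also have "\<dots> \<le> infsum F L"
  proof (rule SUP_least)
    fix n
    have "(\<Sum>i<n. F (from_nat_into L i)) = (\<Sum>k\<in>from_nat_into L ` {..<n}. F k)"
      using b by (subst sum.reindex) (auto simp: bij_betw_def intro: inj_on_subset)
    also have "\<dots> \<le> infsum F L"
      using b by (subst nonneg_infsum_complete) (auto simp: bij_betw_def intro!: SUP_upper)
    finally show "(\<Sum>i<n. F (from_nat_into L i)) \<le> infsum F L" .
  qed
  finally show ?thesis .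
qed

lemma nn_integral_lattice_swap:
  fixes F :: "'a \<Rightarrow> 'b::euclidean_space \<Rightarrow> ennreal"
  assumes L: "countable L" and F: "\<And>k. k \<in> L \<Longrightarrow> F k \<in> borel_measurable borel"
  shows "(\<integral>\<^sup>+x. (\<integral>\<^sup>+k. F k x \<partial>count_space L) \<partial>lborel) = (\<integral>\<^sup>+k. (\<integral>\<^sup>+x. F k x \<partial>lborel) \<partial>count_space L)"
    and "(\<lambda>x. \<integral>\<^sup>+k. F k x \<partial>count_space L) \<in> borel_measurable borel"
proof -
  interpret L: sigma_finite_measure "count_space L" using L by (rule sigma_finite_measure_count_space_countable)
  interpret P: pair_sigma_finite "count_space L" "lborel :: 'b measure" ..
  have "case_prod F \<in> borel_measurable (count_space L \<Otimes>\<^sub>M lborel)"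
    using L F by (intro measurable_pair_measure_countable1) auto
  then show "(\<integral>\<^sup>+x. (\<integral>\<^sup>+k. F k x \<partial>count_space L) \<partial>lborel) = (\<integral>\<^sup>+k. (\<integral>\<^sup>+x. F k x \<partial>lborel) \<partial>count_space L)"
    by (rule P.Fubini')
  have m: "case_prod F \<in> borel_measurable (count_space L \<Otimes>\<^sub>M (borel :: 'b measure))"
    using L F by (intro measurable_pair_measure_countable1) auto
  then have "(\<lambda>(x, k). F k x) \<in> borel_measurable ((borel :: 'b measure) \<Otimes>\<^sub>M count_space L)"
    using measurable_compose[OF measurable_pair_swap' m] by (simp add: split_beta comp_def)
  then show "(\<lambda>x. \<integral>\<^sup>+k. F k x \<partial>count_space L) \<in> borel_measurable borel"
    by (rule L.borel_measurable_nn_integral)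
qed

text \<open>After subtraction of the integer parts of \<open>u\<close>, the lattice points near
  \<open>u\<close> lie in a fixed finite box, whatever \<open>u\<close> is.\<close>

lemma lattice_points_in_ball:
  "\<exists>n::nat. \<forall>u::real^'d. emeasure (count_space int_lattice) {k \<in> int_lattice. u \<in> cball k r} \<le> of_nat n"
proof -
  \<comment> \<open>The summand 1 accounts for replacing each \<open>u $ i\<close> by its
    floor.\<close>
  define R where "R = \<lceil>r\<rceil> + 1"
  let ?Z = "UNIV \<rightarrow>\<^sub>E {-R..R} :: ('d \<Rightarrow> int) set"
  have fin: "finite ?Z" by (intro finite_PiE) auto
  have "emeasure (count_space int_lattice) {k \<in> int_lattice. u \<in> cball k r} \<le> of_nat (card ?Z)" for u :: "real^'d"
  proof -
    let ?s = "\<lambda>z::'d \<Rightarrow> int. (\<chi> i. of_int (z i + \<lfloor>u $ i\<rfloor>)) :: real^'d"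
    have sub: "{k \<in> int_lattice. u \<in> cball k r} \<subseteq> ?s ` ?Z"
    proof
      fix k assume k: "k \<in> {k \<in> int_lattice. u \<in> cball k r}"
      then obtain z :: "'d \<Rightarrow> int" where z: "k = (\<chi> i. of_int (z i))" unfolding int_lattice_eq by blast
      have "\<bar>of_int (z i) - u $ i\<bar> \<le> r" for i
        using k component_le_norm_cart[of "k - u" i] by (simp add: dist_norm z)
      then have "real_of_int (z i) - u $ i \<le> r" "u $ i - real_of_int (z i) \<le> r" for i
        by (simp_all add: abs_le_iff)
      then have "z i - \<lfloor>u $ i\<rfloor> \<le> \<lceil>r\<rceil> + 1" "\<lfloor>u $ i\<rfloor> - z i \<le> \<lceil>r\<rceil> + 1" for i
        using floor_correct[of "u $ i"] le_of_int_ceiling[of r] by (smt (verit) of_int_add of_int_diff of_int_le_iff of_int_1)+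
      then have "z i - \<lfloor>u $ i\<rfloor> \<in> {-R..R}" for i
        unfolding R_def by (smt (verit) atLeastAtMost_iff)
      then have "(\<lambda>i. z i - \<lfloor>u $ i\<rfloor>) \<in> ?Z" by auto
      moreover have "k = ?s (\<lambda>i. z i - \<lfloor>u $ i\<rfloor>)" by (simp add: z)
      ultimately show "k \<in> ?s ` ?Z" by (intro image_eqI)
    qed
    then have "finite {k \<in> int_lattice. u \<in> cball k r}" using fin finite_subset by blast
    moreover from this have "card {k \<in> int_lattice. u \<in> cball k r} \<le> card ?Z"
      using surj_card_le[OF fin sub] by simp
    ultimately show ?thesis by (subst emeasure_count_space_finite) auto
  qed
  then show ?thesis by blast
qed

text \<open>Bounded overlap: each \<open>u\<close> lies in at most \<open>n\<close> of the balls
  around lattice points, so after exchanging sum and integral it is counted at most \<open>n\<close>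
  times.\<close>

lemma lattice_sum_ball_integrals_le:
  "\<exists>n::nat. \<forall>F::real^'d \<Rightarrow> ennreal. F \<in> borel_measurable borel \<longrightarrow>
    (\<integral>\<^sup>+k. (\<integral>\<^sup>+u. indicator (cball k r) u * F u \<partial>lborel) \<partial>count_space int_lattice) \<le> of_nat n * (\<integral>\<^sup>+u. F u \<partial>lborel)"
proof -
  obtain n where n: "\<And>u::real^'d. emeasure (count_space int_lattice) {k \<in> int_lattice. u \<in> cball k r} \<le> of_nat n"
    using lattice_points_in_ball by blast
  have "(\<integral>\<^sup>+k. (\<integral>\<^sup>+u. indicator (cball k r) u * F u \<partial>lborel) \<partial>count_space int_lattice) \<le> of_nat n * (\<integral>\<^sup>+u. F u \<partial>lborel)"
    if [measurable]: "F \<in> borel_measurable borel" for F :: "real^'d \<Rightarrow> ennreal"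
  proof -
    have [measurable]: "cball (k::real^'d) r \<in> sets borel" for k by simp
    have "(\<integral>\<^sup>+k. (\<integral>\<^sup>+u. indicator (cball k r) u * F u \<partial>lborel) \<partial>count_space int_lattice)
      = (\<integral>\<^sup>+u. (\<integral>\<^sup>+k. indicator (cball k r) u * F u \<partial>count_space int_lattice) \<partial>lborel)"
      by (rule nn_integral_lattice_swap(1)[symmetric]) (simp, measurable)
    also have "\<dots> \<le> (\<integral>\<^sup>+u. of_nat n * F u \<partial>lborel)"
    proof (rule nn_integral_mono)
      fix u
      have "(\<integral>\<^sup>+k. indicator (cball k r) u * F u \<partial>count_space int_lattice)
        = (\<integral>\<^sup>+k. indicator {k \<in> int_lattice. u \<in> cball k r} k \<partial>count_space int_lattice) * F u"
        by (subst nn_integral_multc[symmetric]) (auto intro!: nn_integral_cong simp: indicator_def)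
      also have "\<dots> \<le> of_nat n * F u" using n[of u] by (intro mult_right_mono) auto
      finally show "(\<integral>\<^sup>+k. indicator (cball k r) u * F u \<partial>count_space int_lattice) \<le> of_nat n * F u" .
    qed
    also have "\<dots> = of_nat n * (\<integral>\<^sup>+u. F u \<partial>lborel)" by (rule nn_integral_cmult) measurable
    finally show ?thesis .
  qed
  then show ?thesis by blast
qed

lemma ex_lattice_translate_in_torus: "\<exists>l\<in>int_lattice. x - l \<in> (torus_cube :: (real^'d) set)"
proof -
  let ?l = "(\<chi> i. of_int (round (x $ i))) :: real^'d"
  have *: "\<bar>x $ i - of_int (round (x $ i))\<bar> \<le> 1/2" for i
    using of_int_round_abs_le[of "x $ i"] by (simp add: abs_minus_commute)
  have "- 1/2 \<le> x $ i - of_int (round (x $ i)) \<and> x $ i - of_int (round (x $ i)) \<le> 1/2" for i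
    using *[of i] unfolding abs_le_iff by (intro conjI) linarith+
  then have "x - ?l \<in> torus_cube"
    unfolding torus_cube_def mem_box_cart by simp
  then show ?thesis by (intro bexI[of _ ?l]) (auto simp: int_lattice_def)
qed

lemma torus_cube_borel [measurable]: "torus_cube \<in> sets borel"
  by (simp add: torus_cube_def)

text \<open>The lattice translates of \<open>torus_cube\<close> cover the space. The closed cubes
  share their faces, which an inequality tolerates.\<close>

lemma nn_integral_le_sum_translates:
  fixes F :: "real^'d \<Rightarrow> ennreal"
  assumes [measurable]: "F \<in> borel_measurable borel"
  shows "(\<integral>\<^sup>+x. F x \<partial>lborel) \<le> (\<integral>\<^sup>+x. indicator torus_cube x * (\<integral>\<^sup>+l. F (x + l) \<partial>count_space int_lattice) \<partial>lborel)"
proof -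
  have "F x \<le> (\<integral>\<^sup>+l. indicator torus_cube (x - l) * F x \<partial>count_space int_lattice)" for x
  proof -
    obtain l where l: "l \<in> int_lattice" "x - l \<in> torus_cube" using ex_lattice_translate_in_torus by blast
    have "F x = indicator torus_cube (x - l) * F x" using l by simp
    also have "\<dots> \<le> (\<integral>\<^sup>+l. indicator torus_cube (x - l) * F x \<partial>count_space int_lattice)"
      using l(1) by (rule nn_integral_ge_point)
    finally show ?thesis .
  qed
  then have "(\<integral>\<^sup>+x. F x \<partial>lborel) \<le> (\<integral>\<^sup>+x. (\<integral>\<^sup>+l. indicator torus_cube (x - l) * F x \<partial>count_space int_lattice) \<partial>lborel)"
    by (intro nn_integral_mono)
  also have "\<dots> = (\<integral>\<^sup>+l. (\<integral>\<^sup>+x. indicator torus_cube (x - l) * F x \<partial>lborel) \<partial>count_space int_lattice)"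
    by (rule nn_integral_lattice_swap(1)) (simp, measurable)
  also have "\<dots> = (\<integral>\<^sup>+l. (\<integral>\<^sup>+x. indicator torus_cube x * F (x + l) \<partial>lborel) \<partial>count_space int_lattice)"
  proof (rule nn_integral_cong)
    fix l :: "real^'d"
    show "(\<integral>\<^sup>+x. indicator torus_cube (x - l) * F x \<partial>lborel) = (\<integral>\<^sup>+x. indicator torus_cube x * F (x + l) \<partial>lborel)"
      using nn_integral_lborel_translate[of "\<lambda>x. indicator torus_cube (x - l) * F x" l] by simp
  qed
  also have "\<dots> = (\<integral>\<^sup>+x. (\<integral>\<^sup>+l. indicator torus_cube x * F (x + l) \<partial>count_space int_lattice) \<partial>lborel)"
    by (rule nn_integral_lattice_swap(1)[symmetric]) (simp, measurable)
  also have "\<dots> = (\<integral>\<^sup>+x. indicator torus_cube x * (\<integral>\<^sup>+l. F (x + l) \<partial>count_space int_lattice) \<partial>lborel)"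
    by (simp add: nn_integral_cmult)
  finally show ?thesis .
qed

text \<open>Young's inequality for convolution of sequences, \<open>\<ell>\<^sub>q * \<ell>\<^sub>1 \<subseteq> \<ell>\<^sub>q\<close>, on each fibre \<open>x + \<int>\<^sup>d\<close>.\<close>

lemma lattice_convolution_le:
  fixes \<phi> :: "real^'d \<Rightarrow> ennreal" and e :: "real^'d \<Rightarrow> ennreal"
  assumes q: "q > 1" and \<phi>: "\<phi> \<in> borel_measurable borel"
    and fin: "(\<integral>\<^sup>+x. indicator torus_cube x * ennpowr (\<integral>\<^sup>+k. \<phi> (x + k) \<partial>count_space int_lattice) q \<partial>lborel) < top"
  shows "(\<integral>\<^sup>+x. ennpowr (\<integral>\<^sup>+k. e k * \<phi> (x + k) \<partial>count_space int_lattice) q \<partial>lborel)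
    \<le> (\<integral>\<^sup>+k. ennpowr (e k) q \<partial>count_space int_lattice) *
      (\<integral>\<^sup>+x. indicator torus_cube x * ennpowr (\<integral>\<^sup>+k. \<phi> (x + k) \<partial>count_space int_lattice) q \<partial>lborel)"
proof -
  let ?L = "int_lattice :: (real^'d) set"
  let ?S = "\<integral>\<^sup>+k. ennpowr (e k) q \<partial>count_space ?L"
  define T where "T x = (\<integral>\<^sup>+k. e k * \<phi> (x + k) \<partial>count_space ?L)" for x
  define \<Phi> where "\<Phi> x = (\<integral>\<^sup>+k. \<phi> (x + k) \<partial>count_space ?L)" for x
  have [measurable]: "\<phi> \<in> borel_measurable borel" by (rule \<phi>)
  have [measurable]: "T \<in> borel_measurable borel" "\<Phi> \<in> borel_measurable borel"
    unfolding T_def[abs_def] \<Phi>_def[abs_def] by (rule nn_integral_lattice_swap(2); simp)+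
  \<comment> \<open>Jensen on the fibre with weights \<open>\<phi> (x + r)\<close>, of total mass
    \<open>\<Phi> x\<close>; exchanging the sums over \<open>l\<close> and \<open>r\<close> then
    produces the factor \<open>?S\<close>.\<close>
  have pt: "(\<integral>\<^sup>+l. ennpowr (T (x + l)) q \<partial>count_space ?L) \<le> ?S * ennpowr (\<Phi> x) q" if fx: "\<Phi> x < top" for x
  proof -
    have T: "T (x + l) = (\<integral>\<^sup>+r. \<phi> (x + r) * e (r - l) \<partial>count_space ?L)" if "l \<in> ?L" for l
      unfolding T_def using nn_integral_bij_count_space[OF bij_lattice_add[OF that], of "\<lambda>r. \<phi> (x + r) * e (r - l)"]
      by (simp add: mult.commute add.assoc)
    have "(\<integral>\<^sup>+l. ennpowr (T (x + l)) q \<partial>count_space ?L)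
      \<le> (\<integral>\<^sup>+l. ennpowr (\<Phi> x) (q - 1) * (\<integral>\<^sup>+r. \<phi> (x + r) * ennpowr (e (r - l)) q \<partial>count_space ?L) \<partial>count_space ?L)"
      using ennpowr_nn_integral_le[OF q, of "\<lambda>r. \<phi> (x + r)" "count_space ?L"] fx
      by (intro nn_integral_mono) (simp add: T \<Phi>_def)
    also have "\<dots> = ennpowr (\<Phi> x) (q - 1) * (\<integral>\<^sup>+l. (\<integral>\<^sup>+r. \<phi> (x + r) * ennpowr (e (r - l)) q \<partial>count_space ?L) \<partial>count_space ?L)"
      by (rule nn_integral_cmult) simp
    also have "(\<integral>\<^sup>+l. (\<integral>\<^sup>+r. \<phi> (x + r) * ennpowr (e (r - l)) q \<partial>count_space ?L) \<partial>count_space ?L)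
      = (\<integral>\<^sup>+r. (\<integral>\<^sup>+l. \<phi> (x + r) * ennpowr (e (r - l)) q \<partial>count_space ?L) \<partial>count_space ?L)"
    proof -
      interpret P: pair_sigma_finite "count_space ?L" "count_space ?L"
        by (simp add: pair_sigma_finite_def sigma_finite_measure_count_space_countable)
      show ?thesis by (rule P.Fubini') (simp add: pair_measure_countable)
    qed
    also have "\<dots> = (\<integral>\<^sup>+r. \<phi> (x + r) * ?S \<partial>count_space ?L)"
    proof (rule nn_integral_cong)
      fix r assume "r \<in> space (count_space ?L)"
      then have "r \<in> ?L" by simp
      then show "(\<integral>\<^sup>+l. \<phi> (x + r) * ennpowr (e (r - l)) q \<partial>count_space ?L) = \<phi> (x + r) * ?S"
        using nn_integral_bij_count_space[OF bij_lattice_diff, of r "\<lambda>k. ennpowr (e k) q"]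
        by (simp add: nn_integral_cmult)
    qed
    also have "\<dots> = \<Phi> x * ?S" by (simp add: nn_integral_multc \<Phi>_def)
    also have "ennpowr (\<Phi> x) (q - 1) * (\<Phi> x * ?S) = ?S * ennpowr (\<Phi> x) q"
    proof -
      have "ennpowr (\<Phi> x) (q - 1) * \<Phi> x = ennpowr (\<Phi> x) q"
        using ennpowr_add[of "q - 1" 1 "\<Phi> x"] q by simp
      then show ?thesis by (simp add: mult.assoc[symmetric]) (simp add: mult.commute)
    qed
    finally show ?thesis .
  qed
  \<comment> \<open>Jensen needs finite total mass, and the finiteness of the periodization norm
    gives this for almost every \<open>x\<close> in the cube.\<close>
  have ae: "AE x in lborel. indicator torus_cube x * ennpowr (\<Phi> x) q \<noteq> top"
    using nn_integral_noteq_infinite[of "\<lambda>x. indicator torus_cube x * ennpowr (\<Phi> x) q" lborel] fin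
    by (simp add: \<Phi>_def[symmetric])
  have "(\<integral>\<^sup>+x. ennpowr (T x) q \<partial>lborel)
    \<le> (\<integral>\<^sup>+x. indicator torus_cube x * (\<integral>\<^sup>+l. ennpowr (T (x + l)) q \<partial>count_space ?L) \<partial>lborel)"
    by (rule nn_integral_le_sum_translates) measurable
  also have "\<dots> \<le> (\<integral>\<^sup>+x. ?S * (indicator torus_cube x * ennpowr (\<Phi> x) q) \<partial>lborel)"
  proof (rule nn_integral_mono_AE)
    show "AE x in lborel. indicator torus_cube x * (\<integral>\<^sup>+l. ennpowr (T (x + l)) q \<partial>count_space ?L)
      \<le> ?S * (indicator torus_cube x * ennpowr (\<Phi> x) q)"
      using ae
    proof eventually_elim
      case (elim x)
      show ?case
      proof (cases "x \<in> torus_cube")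
        case True
        then have "\<Phi> x < top" using elim by (auto simp: less_top[symmetric])
        from pt[OF this] show ?thesis using True by simp
      qed simp
    qed
  qed
  also have "\<dots> = ?S * (\<integral>\<^sup>+x. indicator torus_cube x * ennpowr (\<Phi> x) q \<partial>lborel)"
    by (rule nn_integral_cmult) measurable
  finally show ?thesis unfolding T_def \<Phi>_def .
qed

section \<open>The error series\<close>

text \<open>Linear substitution and Fubini are carried out for Borel functions over
  \<open>lborel\<close>, whereas the assumptions speak of Lebesgue measurable ones.\<close>

lemma ex_borel_representative:
  fixes g :: "real^'d \<Rightarrow> complex"
  assumes "g \<in> borel_measurable lebesgue"
  shows "\<exists>g'\<in>borel_measurable borel. AE x in lborel. g x = g' x"
proof -
  have m: "(\<lambda>x. Re (g x)) \<in> borel_measurable lebesgue" "(\<lambda>x. Im (g x)) \<in> borel_measurable lebesgue"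
    using assms unfolding borel_measurable_complex_iff by auto
  obtain a where a: "a \<in> borel_measurable lborel" "AE x in lborel. Re (g x) = a x"
    using completion_ex_borel_measurable_real[OF m(1)] by blast
  obtain b where b: "b \<in> borel_measurable lborel" "AE x in lborel. Im (g x) = b x"
    using completion_ex_borel_measurable_real[OF m(2)] by blast
  have "(\<lambda>x. Complex (a x) (b x)) \<in> borel_measurable borel"
    using a(1) b(1) by (subst borel_measurable_complex_iff) simp
  moreover have "AE x in lborel. g x = Complex (a x) (b x)"
    using a(2) b(2) by eventually_elim (simp add: complex_eq_iff)
  ultimately show ?thesis by (intro bexI)
qed

lemma borel_measurable_lebesgue_AE:
  fixes F E :: "real^'d \<Rightarrow> 'b::topological_space"
  assumes ae: "AE x in lebesgue. F x = E x" and E: "E \<in> borel_measurable lebesgue"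
  shows "F \<in> borel_measurable lebesgue"
proof (rule measurableI)
  fix S :: "'b set" assume "S \<in> sets borel"
  then have 1: "E -` S \<inter> space lebesgue \<in> sets lebesgue" by (rule measurable_sets[OF E])
  have 2: "AE x in lebesgue. x \<in> E -` S \<inter> space lebesgue \<longleftrightarrow> x \<in> F -` S \<inter> space lebesgue"
    using ae by eventually_elim simp
  show "F -` S \<inter> space lebesgue \<in> sets lebesgue"
    by (rule completion.in_sets_AE[OF 2 1]) simp
qed simp

text \<open>An invertible affine map pulls null sets back to null sets. This carries almost
  everywhere statements to the arguments \<open>mat_pow M j *v x + k\<close>.\<close>

lemma AE_lborel_matrix:
  fixes A :: "real^'d^'d"
  assumes "AE x in lborel. P x" and A: "det A \<noteq> 0"
  shows "AE x in lborel. P (A *v x + c)"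
proof -
  obtain N where N: "{x \<in> space lborel. \<not> P x} \<subseteq> N" "emeasure lborel N = 0" "N \<in> sets lborel"
    using assms(1) by (rule AE_E)
  have [measurable]: "N \<in> sets borel" using N(3) by simp
  have [measurable]: "(\<lambda>x. A *v x) \<in> borel \<rightarrow>\<^sub>M borel" by measurable
  have "(\<integral>\<^sup>+x. indicator N (x + c) \<partial>lborel) = (\<integral>\<^sup>+x. indicator N x \<partial>lborel)"
    by (rule nn_integral_lborel_translate) measurable
  then have "ennreal \<bar>det A\<bar> * (\<integral>\<^sup>+x. indicator N (A *v x + c) \<partial>lborel) = 0"
    using nn_integral_matrix[OF A, of "\<lambda>x. indicator N (x + c)"] N(2) by simp
  then have "(\<integral>\<^sup>+x. indicator N (A *v x + c) \<partial>lborel) = 0" using A by simp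
  then have "AE x in lborel. indicator N (A *v x + c) = (0::ennreal)"
    by (subst (asm) nn_integral_0_iff_AE) auto
  then show ?thesis by eventually_elim (use N(1) in \<open>auto simp: indicator_def split: if_splits\<close>)
qed

section \<open>Weak derivatives of top order with Borel representatives\<close>

lemma weak_deriv_borel:
  fixes f g :: "real^'d \<Rightarrow> complex"
  assumes w: "is_weak_deriv \<beta> f g" and f: "continuous_on UNIV f"
    and g: "g \<in> borel_measurable lebesgue" and g': "g' \<in> borel_measurable borel" "AE x in lborel. g x = g' x"
    and \<psi>: "test_function \<psi>"
  shows "(LINT x|lborel. mi_deriv \<beta> \<psi> x *\<^sub>R f x) = (-1) ^ mi_order \<beta> * (LINT x|lborel. \<psi> x *\<^sub>R g' x)"
proof -
  have Ck\<psi>: "Ck n \<psi>" for n using \<psi> by (simp add: test_function_def)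
  have [measurable]: "f \<in> borel_measurable borel" "mi_deriv \<beta> \<psi> \<in> borel_measurable borel" "\<psi> \<in> borel_measurable borel"
    using f mi_deriv_continuous[OF Ck\<psi>] Ck_continuous[OF Ck\<psi>] by (auto intro: borel_measurable_continuous_onI)
  have [measurable]: "g' \<in> borel_measurable borel" by (rule g')
  have m: "(\<lambda>x. \<psi> x *\<^sub>R g' x) \<in> borel_measurable lborel" by measurable
  have "(LINT x|lborel. mi_deriv \<beta> \<psi> x *\<^sub>R f x) = (LINT x|lebesgue. mi_deriv \<beta> \<psi> x *\<^sub>R f x)"
    by (rule integral_completion[symmetric]) measurable
  also have "\<dots> = (-1) ^ mi_order \<beta> * (LINT x|lebesgue. \<psi> x *\<^sub>R g x)"
    using w \<psi> by (simp add: is_weak_deriv_def)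
  also have "(LINT x|lebesgue. \<psi> x *\<^sub>R g x) = (LINT x|lebesgue. \<psi> x *\<^sub>R g' x)"
  proof (rule integral_cong_AE)
    have "\<psi> \<in> borel_measurable lebesgue" by (rule measurable_completion) simp
    then show "(\<lambda>x. \<psi> x *\<^sub>R g x) \<in> borel_measurable lebesgue" using g by (rule borel_measurable_scaleR)
    show "(\<lambda>x. \<psi> x *\<^sub>R g' x) \<in> borel_measurable lebesgue" using m by (rule measurable_completion)
    show "AE x in lebesgue. \<psi> x *\<^sub>R g x = \<psi> x *\<^sub>R g' x"
      using AE_completion[OF g'(2)] by eventually_elim simp
  qed
  also have "\<dots> = (LINT x|lborel. \<psi> x *\<^sub>R g' x)" using m by (rule integral_completion)
  finally show ?thesis .
qed

text \<open>Every summand is at most the largest one, and the power of the largest is among the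
  powers on the right.\<close>

lemma ennpowr_sum_le:
  assumes "finite I" "0 < q"
  shows "ennpowr (\<Sum>i\<in>I. a i) q \<le> ennpowr (of_nat (card I)) q * (\<Sum>i\<in>I. ennpowr (a i) q)"
proof (cases "I = {}")
  case False
  then have "Max (a ` I) \<in> a ` I" using assms(1) by (intro Max_in) auto
  then obtain i0 where i0: "i0 \<in> I" "Max (a ` I) = a i0" by auto
  have "(\<Sum>i\<in>I. a i) \<le> of_nat (card I) * a i0"
    using i0 assms(1) by (intro sum_bounded_above) (metis Max_ge finite_imageI imageI)
  then have "ennpowr (\<Sum>i\<in>I. a i) q \<le> ennpowr (of_nat (card I) * a i0) q"
    using assms(2) by (intro ennpowr_mono) auto
  also have "\<dots> = ennpowr (of_nat (card I)) q * ennpowr (a i0) q" using assms(2) by (rule ennpowr_mult)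
  also have "\<dots> \<le> ennpowr (of_nat (card I)) q * (\<Sum>i\<in>I. ennpowr (a i) q)"
    using i0(1) assms(1) by (intro mult_left_mono member_le_sum) auto
  finally show ?thesis .
qed simp

lemma Lp_norm_finite_exponent:
  assumes "p \<noteq> top"
  shows "Lp_norm \<mu> p f = ennpowr (\<integral>\<^sup>+x. ennpowr (ennreal (norm (f x))) (enn2real p) \<partial>\<mu>) (1 / enn2real p)"
  using assms by (simp add: Lp_norm_def Lp_enorm_def)

lemma sobolev_top_derivs_finite:
  fixes f :: "real^'d \<Rightarrow> complex"
  assumes S: "in_Sobolev (N + 1) p f" and f: "continuous_on UNIV f" and p: "p \<noteq> top" "0 < enn2real p"
  shows "\<exists>g. top_weak_derivs N f g \<and>
    (\<integral>\<^sup>+x. ennpowr (top_deriv_sum N g x) (enn2real p) \<partial>lborel) < top"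
proof -
  let ?q = "enn2real p"
  have "\<forall>\<beta>. \<exists>g. g \<in> borel_measurable borel \<and> (mi_order \<beta> = Suc N \<longrightarrow>
     (\<integral>\<^sup>+x. ennpowr (ennreal (norm (g x))) ?q \<partial>lborel) < top \<and>
     (\<forall>\<psi>. test_function \<psi> \<longrightarrow>
      (LINT x|lborel. mi_deriv \<beta> \<psi> x *\<^sub>R f x) = (-1) ^ Suc N * (LINT x|lborel. \<psi> x *\<^sub>R g x)))" (is "\<forall>\<beta>. \<exists>g. ?P \<beta> g")
  proof
    fix \<beta> :: "nat^'d"
    show "\<exists>g. ?P \<beta> g"
    proof (cases "mi_order \<beta> = Suc N")
      case True
      then obtain g0 where g0: "in_Lp lebesgue p g0" "is_weak_deriv \<beta> f g0"
        using S unfolding in_Sobolev_def by (metis Suc_eq_plus1 order_refl)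
      then have m: "g0 \<in> borel_measurable lebesgue" by (simp add: in_Lp_def)
      obtain g where g: "g \<in> borel_measurable borel" "AE x in lborel. g0 x = g x"
        using ex_borel_representative[OF m] by blast
      have "(\<integral>\<^sup>+x. ennpowr (ennreal (norm (g x))) ?q \<partial>lborel) = (\<integral>\<^sup>+x. ennpowr (ennreal (norm (g0 x))) ?q \<partial>lborel)"
        by (intro nn_integral_cong_AE eventually_mono[OF g(2)]) simp
      also have "\<dots> = (\<integral>\<^sup>+x. ennpowr (ennreal (norm (g0 x))) ?q \<partial>lebesgue)" by (simp add: nn_integral_completion)
      \<comment> \<open>An infinite integral would make the norm infinite, because
        \<open>ennpowr\<close> maps \<open>top\<close> to \<open>top\<close>.\<close>
      also have "\<dots> < top"
        using g0(1) unfolding in_Lp_def Lp_norm_finite_exponent[OF p(1)]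
        by (cases "(\<integral>\<^sup>+x. ennpowr (ennreal (norm (g0 x))) ?q \<partial>lebesgue) = top") (auto simp: less_top)
      finally show ?thesis
        using g weak_deriv_borel[OF g0(2) f m g] True by (intro exI[of _ g]) auto
    qed (auto intro!: exI[of _ "\<lambda>x. 0"])
  qed
  then have "\<exists>g. \<forall>\<beta>. ?P \<beta> (g \<beta>)" by (rule choice)
  then obtain g where "\<forall>\<beta>. ?P \<beta> (g \<beta>)" ..
  then have g: "?P \<beta> (g \<beta>)" for \<beta> by (rule spec)
  have [measurable]: "g \<beta> \<in> borel_measurable borel" for \<beta> using g by blast
  let ?S = "{\<beta> :: nat^'d. mi_order \<beta> = Suc N}"
  have "(\<integral>\<^sup>+x. ennpowr (top_deriv_sum N g x) ?q \<partial>lborel)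
    \<le> (\<integral>\<^sup>+x. ennpowr (of_nat (card ?S)) ?q * (\<Sum>\<beta>\<in>?S. ennpowr (ennreal (norm (g \<beta> x))) ?q) \<partial>lborel)"
    unfolding top_deriv_sum_def by (intro nn_integral_mono ennpowr_sum_le finite_mi_order_eq p)
  also have "\<dots> = ennpowr (of_nat (card ?S)) ?q * (\<Sum>\<beta>\<in>?S. (\<integral>\<^sup>+x. ennpowr (ennreal (norm (g \<beta> x))) ?q \<partial>lborel))"
    by (simp add: nn_integral_cmult nn_integral_sum)
  also have "\<dots> < top"
    using g by (intro ennreal_mult_less_top[THEN iffD2] disjI2 conjI ennpowr_less_top)
      (auto simp: of_nat_less_top finite_mi_order_eq)
  finally show ?thesis using g by (intro exI[of _ g]) (auto simp: top_weak_derivs_def)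
qed

lemma sobolev_top_derivs_infinite:
  fixes f :: "real^'d \<Rightarrow> complex"
  assumes S: "in_Sobolev (N + 1) top f" and f: "continuous_on UNIV f"
  shows "\<exists>g \<Gamma>. top_weak_derivs N f g \<and>
    0 \<le> \<Gamma> \<and> (\<forall>x. top_deriv_sum N g x \<le> ennreal \<Gamma>)"
proof -
  have "\<forall>\<beta>. \<exists>g b. g \<in> borel_measurable borel \<and> (mi_order \<beta> = Suc N \<longrightarrow>
     0 \<le> b \<and> (\<forall>x. norm (g x) \<le> b) \<and>
     (\<forall>\<psi>. test_function \<psi> \<longrightarrow>
      (LINT x|lborel. mi_deriv \<beta> \<psi> x *\<^sub>R f x) = (-1) ^ Suc N * (LINT x|lborel. \<psi> x *\<^sub>R g x)))" (is "\<forall>\<beta>. \<exists>g b. ?P \<beta> g b")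
  proof
    fix \<beta> :: "nat^'d"
    show "\<exists>g b. ?P \<beta> g b"
    proof (cases "mi_order \<beta> = Suc N")
      case True
      then obtain g0 where g0: "in_Lp lebesgue top g0" "is_weak_deriv \<beta> f g0"
        using S unfolding in_Sobolev_def by (metis Suc_eq_plus1 order_refl)
      then have m: "g0 \<in> borel_measurable lebesgue" by (simp add: in_Lp_def)
      obtain g where g: "g \<in> borel_measurable borel" "AE x in lborel. g0 x = g x"
        using ex_borel_representative[OF m] by blast
      let ?e = "esssup lebesgue (\<lambda>x. ennreal (norm (g0 x)))"
      define b where "b = enn2real ?e"
      have "?e < top" using g0(1) by (simp add: in_Lp_def Lp_norm_def Lp_enorm_def)
      then have e: "?e = ennreal b" by (simp add: b_def less_top)
      have "AE x in lebesgue. ennreal (norm (g0 x)) \<le> ennreal b"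
        unfolding e[symmetric] by (rule esssup_AE)
      then have bnd: "AE x in lborel. norm (g0 x) \<le> b"
        by (simp add: AE_completion_iff b_def)
      \<comment> \<open>Cutting off the values above the essential supremum changes the function on
        a null set only and makes the bound hold at every point.\<close>
      define g1 where "g1 x = (if norm (g x) \<le> b then g x else 0)" for x
      have g1: "g1 \<in> borel_measurable borel" using g(1) unfolding g1_def[abs_def] by measurable
      have "AE x in lborel. g0 x = g1 x"
        using g(2) bnd by eventually_elim (simp add: g1_def)
      with weak_deriv_borel[OF g0(2) f m g1] have
        "\<And>\<psi>. test_function \<psi> \<Longrightarrow> (LINT x|lborel. mi_deriv \<beta> \<psi> x *\<^sub>R f x) = (-1) ^ Suc N * (LINT x|lborel. \<psi> x *\<^sub>R g1 x)"
        using True by simp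
      moreover have "b \<ge> 0" by (simp add: b_def)
      moreover have "norm (g1 x) \<le> b" for x using \<open>b \<ge> 0\<close> by (simp add: g1_def)
      ultimately show ?thesis using g1 by (intro exI[of _ g1] exI[of _ b]) auto
    qed (auto intro!: exI[of _ "\<lambda>x. 0"])
  qed
  then have "\<exists>g. \<forall>\<beta>. \<exists>b. ?P \<beta> (g \<beta>) b" by (rule choice)
  then obtain g where "\<forall>\<beta>. \<exists>b. ?P \<beta> (g \<beta>) b" ..
  then have "\<exists>b. \<forall>\<beta>. ?P \<beta> (g \<beta>) (b \<beta>)" by (rule choice)
  then obtain b where "\<forall>\<beta>. ?P \<beta> (g \<beta>) (b \<beta>)" ..
  then have g: "?P \<beta> (g \<beta>) (b \<beta>)" for \<beta> by (rule spec)
  let ?S = "{\<beta> :: nat^'d. mi_order \<beta> = Suc N}"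
  have "top_deriv_sum N g x \<le> ennreal (\<Sum>\<beta>\<in>?S. b \<beta>)" for x
  proof -
    have "top_deriv_sum N g x \<le> (\<Sum>\<beta>\<in>?S. ennreal (b \<beta>))"
      unfolding top_deriv_sum_def using g by (intro sum_mono ennreal_leI) auto
    also have "\<dots> = ennreal (\<Sum>\<beta>\<in>?S. b \<beta>)" using g by (intro sum_ennreal) auto
    finally show ?thesis .
  qed
  moreover have "0 \<le> (\<Sum>\<beta>\<in>?S. b \<beta>)" using g by (intro sum_nonneg) auto
  ultimately show ?thesis using g by (intro exI[of _ g] exI[of _ "\<Sum>\<beta>\<in>?S. b \<beta>"]) (auto simp: top_weak_derivs_def)
qed

text \<open>All three conclusions come from absolute convergence almost everywhere, which is what
  \<open>fin\<close> provides through the Borel representative \<open>\<phi>0\<close>.\<close>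

lemma error_series_properties:
  fixes M :: "real^'d^'d" and \<phi> \<phi>0 :: "real^'d \<Rightarrow> complex"
  assumes M: "det M \<noteq> 0" and \<phi>0: "\<phi>0 \<in> borel_measurable borel" "AE x in lborel. \<phi> x = \<phi>0 x"
    and fin: "AE x in lborel. (\<integral>\<^sup>+k. ennreal (norm (eps M h N f j (- k))) * ennreal (norm (\<phi>0 (mat_pow M j *v x + k)))
      \<partial>count_space int_lattice) < top"
  shows "AE x in lebesgue. (\<lambda>k. eps M h N f j (- k) * phi_jk M \<phi> j k x) summable_on int_lattice"
    and "error_series M h N f \<phi> j \<in> borel_measurable lebesgue"
    and "AE x in lborel. ennreal (norm (error_series M h N f \<phi> j x)) \<le>
      (\<integral>\<^sup>+k. ennreal (norm (eps M h N f j (- k))) * ennreal (norm (\<phi>0 (mat_pow M j *v x + k)))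
      \<partial>count_space int_lattice)"
proof -
  let ?L = "int_lattice :: (real^'d) set" and ?A = "mat_pow M j"
  let ?F = "\<lambda>x k. eps M h N f j (- k) * phi_jk M \<phi> j k x"
  define G where "G x k = eps M h N f j (- k) * \<phi>0 (?A *v x + k)" for x k
  \<comment> \<open>Written as an integral over the lattice, the sum is Borel in \<open>x\<close>;
    the error series agrees with it almost everywhere and inherits measurability.\<close>
  define E where "E x = (LINT k|count_space ?L. G x k)" for x
  let ?T = "\<lambda>x. \<integral>\<^sup>+k. ennreal (norm (eps M h N f j (- k))) * ennreal (norm (\<phi>0 (?A *v x + k))) \<partial>count_space ?L"
  have T: "?T x = (\<integral>\<^sup>+k. ennreal (norm (G x k)) \<partial>count_space ?L)" for x
    by (simp add: G_def norm_mult ennreal_mult)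
  have [measurable]: "\<phi>0 \<in> borel_measurable borel" by (rule \<phi>0)
  have [measurable]: "(\<lambda>x. ?A *v x) \<in> borel \<rightarrow>\<^sub>M borel" by measurable
  have Em: "E \<in> borel_measurable borel"
  proof -
    interpret L: sigma_finite_measure "count_space ?L" by (rule sigma_finite_measure_count_space_countable) simp
    have "(\<lambda>(k, x). G x k) \<in> borel_measurable (count_space ?L \<Otimes>\<^sub>M (borel :: (real^'d) measure))"
    proof (rule measurable_pair_measure_countable1)
      fix k
      have "(\<lambda>x. G x k) \<in> borel_measurable borel" unfolding G_def by measurable
      then show "(\<lambda>x. case (k, x) of (k, x) \<Rightarrow> G x k) \<in> borel_measurable borel" by simp
    qed simp
    from measurable_compose[OF measurable_pair_swap' this]
    have "(\<lambda>(x, k). G x k) \<in> borel_measurable ((borel :: (real^'d) measure) \<Otimes>\<^sub>M count_space ?L)"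
      by (simp add: split_beta)
    then show ?thesis unfolding E_def[abs_def] by (rule L.borel_measurable_lebesgue_integral)
  qed
  have m0: "abs_det M > 0" using M by (simp add: abs_det_def)
  \<comment> \<open>There is one exceptional null set for each lattice point, and the lattice is
    countable.\<close>
  have "AE x in lborel. \<forall>k\<in>?L. \<phi> (?A *v x + k) = \<phi>0 (?A *v x + k)"
    using M by (intro AE_ball_countable[THEN iffD2] ballI AE_lborel_matrix[OF \<phi>0(2)]) (auto simp: det_mat_pow)
  with fin have good: "AE x in lborel. ?F x summable_on ?L \<and> error_series M h N f \<phi> j x = E x \<and>
      ennreal (norm (E x)) \<le> ?T x"
  proof eventually_elim
    case (elim x)
    let ?m = "abs_det M powr (real j / 2)"
    have F: "?F x k = ?m *\<^sub>R G x k" if "k \<in> ?L" for k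
      using elim(2) that by (simp add: phi_jk_def G_def)
    have "integrable (count_space ?L) (G x)"
      using elim(1) unfolding T by (intro integrableI_bounded) auto
    then have abs: "Infinite_Set_Sum.abs_summable_on (G x) ?L"
      by (simp add: Infinite_Set_Sum.abs_summable_on_def)
    then have "G x summable_on ?L"
      using abs_summable_equivalent abs_summable_summable by blast
    then have sm: "(\<lambda>k. ?m *\<^sub>R G x k) summable_on ?L" by (rule summable_on_scaleR_right)
    then have s1: "?F x summable_on ?L" using F by (subst summable_on_cong[of _ _ "\<lambda>k. ?m *\<^sub>R G x k"]) auto
    have "infsum (?F x) ?L = infsum (\<lambda>k. ?m *\<^sub>R G x k) ?L" using F by (intro infsum_cong) auto
    also have "\<dots> = ?m *\<^sub>R infsum (G x) ?L" by (rule infsum_scaleR_right)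
    also have "infsum (G x) ?L = E x"
      using infsetsum_infsum[OF abs] by (simp add: infsetsum_def E_def)
    finally have "error_series M h N f \<phi> j x = (abs_det M powr (- real j / 2) * ?m) *\<^sub>R E x"
      by (simp add: error_series_def)
    also have "abs_det M powr (- real j / 2) * ?m = 1"
      using m0 by (simp add: powr_add[symmetric])
    finally have "error_series M h N f \<phi> j x = E x" by simp
    moreover have "ennreal (norm (E x)) \<le> ?T x"
      unfolding T E_def by (rule norm_integral_le_nn_integral)
    ultimately show ?case using s1 by simp
  qed
  show "AE x in lebesgue. ?F x summable_on ?L"
    using AE_completion[OF good] by eventually_elim simp
  show "AE x in lborel. ennreal (norm (error_series M h N f \<phi> j x)) \<le> ?T x"
    using good by eventually_elim simp
  have "AE x in lebesgue. error_series M h N f \<phi> j x = E x"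
    using AE_completion[OF good] by eventually_elim simp
  moreover have "E \<in> borel_measurable lebesgue"
    using Em by (intro measurable_completion) simp
  ultimately show "error_series M h N f \<phi> j \<in> borel_measurable lebesgue"
    by (rule borel_measurable_lebesgue_AE)
qed

lemma periodization_le_infsum:
  fixes \<phi> \<phi>0 :: "real^'d \<Rightarrow> complex"
  assumes "AE x in lborel. \<phi> x = \<phi>0 x"
  shows "AE x in lborel. (\<integral>\<^sup>+k. ennreal (norm (\<phi>0 (x + k))) \<partial>count_space int_lattice)
    \<le> (\<Sum>\<^sub>\<infinity>k\<in>int_lattice. ennreal (norm (\<phi> (x + k))))"
proof -
  have "AE x in lborel. \<forall>k\<in>int_lattice. \<phi> (mat 1 *v x + k) = \<phi>0 (mat 1 *v x + k)"
    by (intro AE_ball_countable[THEN iffD2] ballI AE_lborel_matrix[OF assms]) auto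
  then show ?thesis
  proof eventually_elim
    case (elim x)
    have "(\<integral>\<^sup>+k. ennreal (norm (\<phi>0 (x + k))) \<partial>count_space int_lattice)
      = (\<integral>\<^sup>+k. ennreal (norm (\<phi> (x + k))) \<partial>count_space int_lattice)"
      using elim by (intro nn_integral_cong) simp
    also have "\<dots> \<le> (\<Sum>\<^sub>\<infinity>k\<in>int_lattice. ennreal (norm (\<phi> (x + k))))"
      by (intro nn_integral_count_space_le_infsum countable_int_lattice infinite_int_lattice)
    finally show ?case .
  qed
qed

section \<open>The norm of the error series\<close>

lemma nn_integral_dilate:
  fixes M :: "real^'d^'d"
  assumes M: "det M \<noteq> 0" and [measurable]: "u \<in> borel_measurable borel"
  shows "(\<integral>\<^sup>+x. u x \<partial>lborel) = ennreal (abs_det M ^ j) * (\<integral>\<^sup>+x. u (mat_pow M j *v x) \<partial>lborel)"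
    and "(\<integral>\<^sup>+x. u (mat_pow_neg M j *v x) \<partial>lborel) = ennreal (abs_det M ^ j) * (\<integral>\<^sup>+x. u x \<partial>lborel)"
proof -
  show "(\<integral>\<^sup>+x. u x \<partial>lborel) = ennreal (abs_det M ^ j) * (\<integral>\<^sup>+x. u (mat_pow M j *v x) \<partial>lborel)"
    using nn_integral_matrix[of "mat_pow M j" u] M by (simp add: det_mat_pow abs_det_def power_abs)
  let ?A = "mat_pow_neg M j"
  have "(\<integral>\<^sup>+x. u x \<partial>lborel) = ennreal \<bar>det ?A\<bar> * (\<integral>\<^sup>+x. u (?A *v x) \<partial>lborel)"
    using det_mat_pow_neg(1)[OF M] by (rule nn_integral_matrix) measurable
  then have "ennreal (abs_det M ^ j) * (\<integral>\<^sup>+x. u x \<partial>lborel)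
     = ennreal (abs_det M ^ j * \<bar>det ?A\<bar>) * (\<integral>\<^sup>+x. u (?A *v x) \<partial>lborel)"
    by (simp add: ennreal_mult'' mult.assoc)
  then show "(\<integral>\<^sup>+x. u (?A *v x) \<partial>lborel) = ennreal (abs_det M ^ j) * (\<integral>\<^sup>+x. u x \<partial>lborel)"
    by (simp add: det_mat_pow_neg(2)[OF M])
qed

abbreviation error_estimate ::
    "ennreal \<Rightarrow> real^'d^'d \<Rightarrow> real \<Rightarrow> nat \<Rightarrow> (real^'d \<Rightarrow> complex) \<Rightarrow> (real^'d \<Rightarrow> complex) \<Rightarrow> real \<Rightarrow> real \<Rightarrow> nat \<Rightarrow> bool" where
  "error_estimate p M h N f \<phi> \<theta> K j \<equiv>
    (AE x in lebesgue. (\<lambda>k. eps M h N f j (- k) * phi_jk M \<phi> j k x) summable_on int_lattice) \<and>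
    error_series M h N f \<phi> j \<in> borel_measurable lebesgue \<and>
    Lp_norm lebesgue p (error_series M h N f \<phi> j) \<le> ennreal (K * \<theta> powr (- real (j * (N + 1))))"

lemma error_bound_finite_exponent:
  fixes M :: "real^'d^'d" and f \<phi> :: "real^'d \<Rightarrow> complex" and p :: ennreal
  assumes p: "p \<noteq> top" "real CARD('d) < enn2real p" and h: "0 < h" and \<phi>: "in_calLp p \<phi>"
    and \<theta>: "\<theta> > 0" "\<And>ev. complex_eigenvalue M ev \<Longrightarrow> \<theta> < cmod ev"
    and S: "in_Sobolev (N + 1) p f" and C: "Ck N f"
  shows "\<exists>K::real. \<forall>j. error_estimate p M h N f \<phi> \<theta> K j"
proof -
  define q where "q = enn2real p"
  have "real CARD('d) \<ge> 1" by (simp add: Suc_le_eq)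
  then have q: "q > 1" "q > 0" "real CARD('d) < q" using p(2) unfolding q_def by linarith+
  let ?L = "int_lattice :: (real^'d) set"
  let ?P = "\<lambda>j. \<theta> powr (- real (j * (N + 1)))"
  have "\<not> complex_eigenvalue M 0" using \<theta> by force
  then have M: "det M \<noteq> 0" by (rule det_nonzero_if_not_eigenvalue_0)
  have m0: "abs_det M > 0" using M by (simp add: abs_det_def)
  obtain g where g: "top_weak_derivs N f g"
    "(\<integral>\<^sup>+x. ennpowr (top_deriv_sum N g x) q \<partial>lborel) < top"
    using sobolev_top_derivs_finite[OF S Ck_continuous[OF C]] p q unfolding q_def by blast
  have [measurable]: "top_deriv_sum N g \<in> borel_measurable borel" by (rule top_deriv_sum_measurable[OF g(1)])
  let ?\<Gamma> = "\<integral>\<^sup>+x. ennpowr (top_deriv_sum N g x) q \<partial>lborel"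
  have "\<phi> \<in> borel_measurable lebesgue" using \<phi> by (simp add: in_calLp_def in_Lp_def)
  then obtain \<phi>0 where \<phi>0: "\<phi>0 \<in> borel_measurable borel" "AE x in lborel. \<phi> x = \<phi>0 x"
    using ex_borel_representative by blast
  have [measurable]: "\<phi>0 \<in> borel_measurable borel" by (rule \<phi>0)
  let ?\<Phi> = "\<lambda>x. \<integral>\<^sup>+k. ennreal (norm (\<phi>0 (x + k))) \<partial>count_space ?L"
  let ?\<Psi> = "\<integral>\<^sup>+x. indicator torus_cube x * ennpowr (?\<Phi> x) q \<partial>lborel"
  have \<Psi>: "?\<Psi> < top"
  proof -
    let ?I = "\<lambda>x. \<Sum>\<^sub>\<infinity>k\<in>?L. ennreal (norm (\<phi> (x + k)))"
    have "?\<Psi> \<le> (\<integral>\<^sup>+x. ennpowr (?I x) q * indicator torus_cube x \<partial>lborel)"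
    proof (rule nn_integral_mono_AE)
      show "AE x in lborel. indicator torus_cube x * ennpowr (?\<Phi> x) q \<le> ennpowr (?I x) q * indicator torus_cube x"
        using periodization_le_infsum[OF \<phi>0(2)]
        by eventually_elim (use q in \<open>auto simp: indicator_def intro: ennpowr_mono\<close>)
    qed
    also have "\<dots> = (\<integral>\<^sup>+x. ennpowr (?I x) q * indicator torus_cube x \<partial>lebesgue)"
      by (simp add: nn_integral_completion)
    also have "\<dots> = (\<integral>\<^sup>+x. ennpowr (?I x) q \<partial>lebesgue_on torus_cube)"
      by (rule nn_integral_restrict_space[symmetric]) (simp add: torus_cube_def)
    also have "\<dots> < top"
    proof -
      have "ennpowr (\<integral>\<^sup>+x. ennpowr (?I x) q \<partial>lebesgue_on torus_cube) (1 / q) < top"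
        using \<phi> p by (simp add: in_calLp_def Lp_enorm_def q_def)
      then show ?thesis by (cases "(\<integral>\<^sup>+x. ennpowr (?I x) q \<partial>lebesgue_on torus_cube) = top") (auto simp: less_top)
    qed
    finally show ?thesis .
  qed
  obtain D where D: "D \<ge> 0" "\<And>j k. ennpowr (ennreal (norm (eps M h N f j k))) q \<le>
      ennreal (D * ?P j powr q) *
      (\<integral>\<^sup>+u. indicator (cball k (h + 1)) u * ennpowr (top_deriv_sum N g (mat_pow_neg M j *v u)) q \<partial>lborel)"
    using eps_bound_finite_exponent[OF \<theta> C g(1) h q(3)] by blast
  obtain n where n: "\<And>F::real^'d \<Rightarrow> ennreal. F \<in> borel_measurable borel \<Longrightarrow>
    (\<integral>\<^sup>+k. (\<integral>\<^sup>+u. indicator (cball k (h + 1)) u * F u \<partial>lborel) \<partial>count_space ?L) \<le> of_nat n * (\<integral>\<^sup>+u. F u \<partial>lborel)"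
    using lattice_sum_ball_integrals_le[of "h + 1"] by blast
  \<comment> \<open>The factors are the constant of the local estimate, the overlap number, the
    integral of the top derivatives and the periodization norm of \<open>\<phi>0\<close>; all are
    finite.\<close>
  define K where "K = enn2real (ennreal D * (of_nat n * ?\<Gamma>) * ?\<Psi>)"
  have K: "ennreal D * (of_nat n * ?\<Gamma>) * ?\<Psi> = ennreal K"
    unfolding K_def using g(2) \<Psi> by (simp add: ennreal_mult_less_top of_nat_less_top)
  have K0: "K \<ge> 0" by (simp add: K_def)
  show ?thesis
  proof (intro exI[of _ "K powr (1 / q)"] allI)
    fix j
    let ?e = "\<lambda>k. ennreal (norm (eps M h N f j (- k)))"
    define T where "T y = (\<integral>\<^sup>+k. ?e k * ennreal (norm (\<phi>0 (y + k))) \<partial>count_space ?L)" for y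
    have [measurable]: "T \<in> borel_measurable borel"
      unfolding T_def[abs_def] by (rule nn_integral_lattice_swap(2)) (simp, measurable)
    have [measurable]: "(\<lambda>u. (A :: real^'d^'d) *v u) \<in> borel \<rightarrow>\<^sub>M borel" for A by measurable
    let ?F = "\<lambda>u. ennpowr (top_deriv_sum N g (mat_pow_neg M j *v u)) q"
    have "(\<integral>\<^sup>+k. ennpowr (?e k) q \<partial>count_space ?L) = (\<integral>\<^sup>+k. ennpowr (ennreal (norm (eps M h N f j k))) q \<partial>count_space ?L)"
      by (rule nn_integral_bij_count_space[OF bij_lattice_minus])
    also have "\<dots> \<le> (\<integral>\<^sup>+k. ennreal (D * ?P j powr q) * (\<integral>\<^sup>+u. indicator (cball k (h + 1)) u * ?F u \<partial>lborel) \<partial>count_space ?L)"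
      by (intro nn_integral_mono D)
    also have "\<dots> = ennreal (D * ?P j powr q) * (\<integral>\<^sup>+k. (\<integral>\<^sup>+u. indicator (cball k (h + 1)) u * ?F u \<partial>lborel) \<partial>count_space ?L)"
      by (rule nn_integral_cmult) simp
    also have "\<dots> \<le> ennreal (D * ?P j powr q) * (of_nat n * (\<integral>\<^sup>+u. ?F u \<partial>lborel))"
      by (intro mult_left_mono n) measurable
    also have "(\<integral>\<^sup>+u. ?F u \<partial>lborel) = ennreal (abs_det M ^ j) * ?\<Gamma>"
      by (rule nn_integral_dilate(2)[OF M]) measurable
    finally have e: "(\<integral>\<^sup>+k. ennpowr (?e k) q \<partial>count_space ?L)
      \<le> ennreal (D * ?P j powr q) * (of_nat n * (ennreal (abs_det M ^ j) * ?\<Gamma>))" .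
    \<comment> \<open>The substitution on the left and the one in the integral of the top
      derivatives both contribute \<open>abs_det M ^ j\<close>; the common factor is cancelled at
      the end of this chain.\<close>
    have "ennreal (abs_det M ^ j) * (\<integral>\<^sup>+x. ennpowr (T (mat_pow M j *v x)) q \<partial>lborel) = (\<integral>\<^sup>+x. ennpowr (T x) q \<partial>lborel)"
      by (rule nn_integral_dilate(1)[OF M, symmetric]) measurable
    also have "\<dots> \<le> (\<integral>\<^sup>+k. ennpowr (?e k) q \<partial>count_space ?L) * ?\<Psi>"
      unfolding T_def using \<Psi> q(1) by (intro lattice_convolution_le) auto
    also have "\<dots> \<le> ennreal (D * ?P j powr q) * (of_nat n * (ennreal (abs_det M ^ j) * ?\<Gamma>)) * ?\<Psi>"
      by (rule mult_right_mono[OF e]) simp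
    also have "\<dots> = ennreal (abs_det M ^ j) * (ennreal (?P j powr q) * (ennreal D * (of_nat n * ?\<Gamma>) * ?\<Psi>))"
      using D(1) by (subst ennreal_mult) (simp_all add: mult_ac)
    also have "\<dots> = ennreal (abs_det M ^ j) * ennreal (K * ?P j powr q)"
      unfolding K using K0 by (simp add: ennreal_mult mult.commute)
    finally have Tq: "(\<integral>\<^sup>+x. ennpowr (T (mat_pow M j *v x)) q \<partial>lborel) \<le> ennreal (K * ?P j powr q)"
      using m0 by (subst (asm) ennreal_mult_le_mult_iff) auto
    then have "(\<integral>\<^sup>+x. ennpowr (T (mat_pow M j *v x)) q \<partial>lborel) < top"
      using ennreal_less_top by (rule le_less_trans)
    then have "AE x in lborel. ennpowr (T (mat_pow M j *v x)) q \<noteq> top"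
      using nn_integral_noteq_infinite[of "\<lambda>x. ennpowr (T (mat_pow M j *v x)) q" lborel] by simp
    then have "AE x in lborel. T (mat_pow M j *v x) < top"
      by eventually_elim (metis ennpowr_top less_top)
    note props = error_series_properties[OF M \<phi>0 this[unfolded T_def]]
    let ?E = "error_series M h N f \<phi> j"
    have "(\<integral>\<^sup>+x. ennpowr (ennreal (norm (?E x))) q \<partial>lebesgue) = (\<integral>\<^sup>+x. ennpowr (ennreal (norm (?E x))) q \<partial>lborel)"
      by (rule nn_integral_completion)
    also have "\<dots> \<le> (\<integral>\<^sup>+x. ennpowr (T (mat_pow M j *v x)) q \<partial>lborel)"
    proof (rule nn_integral_mono_AE)
      show "AE x in lborel. ennpowr (ennreal (norm (?E x))) q \<le> ennpowr (T (mat_pow M j *v x)) q"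
        using props(3) by eventually_elim (use q in \<open>auto simp: T_def intro: ennpowr_mono\<close>)
    qed
    also note Tq
    finally have "ennpowr (\<integral>\<^sup>+x. ennpowr (ennreal (norm (?E x))) q \<partial>lebesgue) (1 / q) \<le> ennpowr (ennreal (K * ?P j powr q)) (1 / q)"
      using q by (intro ennpowr_mono) auto
    also have "\<dots> = ennreal (K powr (1 / q) * ?P j)"
      using K0 q by (subst ennpowr_ennreal) (simp_all add: powr_mult powr_powr)
    finally have "Lp_norm lebesgue p ?E \<le> ennreal (K powr (1 / q) * ?P j)"
      unfolding Lp_norm_finite_exponent[OF p(1)] q_def .
    with props(1,2) show "error_estimate p M h N f \<phi> \<theta> (K powr (1 / q)) j" by blast
  qed
qed

text \<open>The sum over \<open>k\<close> is at most the supremum of the \<open>eps\<close> values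
  times the periodization of \<open>\<phi>0\<close>, which is essentially bounded.\<close>

lemma error_bound_infinite_exponent:
  fixes M :: "real^'d^'d" and f \<phi> :: "real^'d \<Rightarrow> complex"
  assumes h: "0 < h" and \<phi>: "in_calLp top \<phi>"
    and \<theta>: "\<theta> > 0" "\<And>ev. complex_eigenvalue M ev \<Longrightarrow> \<theta> < cmod ev"
    and S: "in_Sobolev (N + 1) top f" and C: "Ck N f"
  shows "\<exists>K::real. \<forall>j. error_estimate top M h N f \<phi> \<theta> K j"
proof -
  let ?L = "int_lattice :: (real^'d) set"
  let ?P = "\<lambda>j. \<theta> powr (- real (j * (N + 1)))"
  have "\<not> complex_eigenvalue M 0" using \<theta> by force
  then have M: "det M \<noteq> 0" by (rule det_nonzero_if_not_eigenvalue_0)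
  obtain g \<Gamma> where g: "top_weak_derivs N f g"
    "0 \<le> \<Gamma>" "\<And>x. top_deriv_sum N g x \<le> ennreal \<Gamma>"
    using sobolev_top_derivs_infinite[OF S Ck_continuous[OF C]] by blast
  have "\<phi> \<in> borel_measurable lebesgue" using \<phi> by (simp add: in_calLp_def in_Lp_def)
  then obtain \<phi>0 where \<phi>0: "\<phi>0 \<in> borel_measurable borel" "AE x in lborel. \<phi> x = \<phi>0 x"
    using ex_borel_representative by blast
  have [measurable]: "\<phi>0 \<in> borel_measurable borel" by (rule \<phi>0)
  define \<Phi> where "\<Phi> x = (\<integral>\<^sup>+k. ennreal (norm (\<phi>0 (x + k))) \<partial>count_space ?L)" for x
  let ?I = "\<lambda>x. \<Sum>\<^sub>\<infinity>k\<in>?L. ennreal (norm (\<phi> (x + k)))"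
  define b where "b = enn2real (esssup (lebesgue_on torus_cube) ?I)"
  have "esssup (lebesgue_on torus_cube) ?I < top" using \<phi> by (simp add: in_calLp_def Lp_enorm_def)
  then have b: "esssup (lebesgue_on torus_cube) ?I = ennreal b" "b \<ge> 0" by (simp_all add: b_def)
  have "AE x in lebesgue_on torus_cube. ?I x \<le> ennreal b"
    unfolding b(1)[symmetric] by (rule esssup_AE)
  then have "AE x in lebesgue. x \<in> torus_cube \<longrightarrow> ?I x \<le> ennreal b"
    by (subst (asm) AE_restrict_space_iff) (auto simp: torus_cube_def)
  then have "AE x in lborel. x \<in> torus_cube \<longrightarrow> ?I x \<le> ennreal b" by (simp only: AE_completion_iff)
  with periodization_le_infsum[OF \<phi>0(2)] have "AE x in lborel. x \<in> torus_cube \<longrightarrow> \<Phi> x \<le> ennreal b"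
    by eventually_elim (auto simp: \<Phi>_def intro: order_trans)
  \<comment> \<open>The bound is known on the cube only. It is stated for all lattice translates at
    once and then spread to the whole space by periodicity of \<open>\<Phi>\<close>.\<close>
  then have "AE x in lborel. \<forall>l\<in>?L. mat 1 *v x + (- l) \<in> torus_cube \<longrightarrow> \<Phi> (mat 1 *v x + (- l)) \<le> ennreal b"
    by (intro AE_ball_countable[THEN iffD2] ballI AE_lborel_matrix) auto
  then have \<Phi>b: "AE x in lborel. \<Phi> x \<le> ennreal b"
  proof eventually_elim
    case (elim x)
    obtain l where l: "l \<in> ?L" "x - l \<in> torus_cube" using ex_lattice_translate_in_torus by blast
    have "\<Phi> x = \<Phi> (x - l)"
      unfolding \<Phi>_def using nn_integral_bij_count_space[OF bij_lattice_add[OF l(1)], of "\<lambda>k. ennreal (norm (\<phi>0 (x - l + k)))"]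
      by simp
    with elim l show ?case by simp
  qed
  obtain D where D: "D \<ge> 0" "\<And>j k. norm (eps M h N f j k) \<le> D * ?P j"
    using eps_bound_infinite_exponent[OF \<theta> C g(1) h g(3,2)] by blast
  show ?thesis
  proof (intro exI[of _ "D * b"] allI)
    fix j
    let ?e = "\<lambda>k. ennreal (norm (eps M h N f j (- k)))"
    let ?T = "\<lambda>y. \<integral>\<^sup>+k. ?e k * ennreal (norm (\<phi>0 (y + k))) \<partial>count_space ?L"
    have T: "?T y \<le> ennreal (D * ?P j) * \<Phi> y" for y
    proof -
      have "?T y \<le> (\<integral>\<^sup>+k. ennreal (D * ?P j) * ennreal (norm (\<phi>0 (y + k))) \<partial>count_space ?L)"
        by (intro nn_integral_mono mult_right_mono ennreal_leI D) auto
      also have "\<dots> = ennreal (D * ?P j) * \<Phi> y" unfolding \<Phi>_def by (rule nn_integral_cmult) simp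
      finally show ?thesis .
    qed
    have "AE x in lborel. \<Phi> (mat_pow M j *v x + 0) \<le> ennreal b"
      using M by (intro AE_lborel_matrix[OF \<Phi>b]) (simp add: det_mat_pow)
    then have Tb: "AE x in lborel. ?T (mat_pow M j *v x) \<le> ennreal (D * b * ?P j)"
    proof eventually_elim
      case (elim x)
      have "?T (mat_pow M j *v x) \<le> ennreal (D * ?P j) * ennreal b"
        using elim by (intro order_trans[OF T] mult_left_mono) auto
      also have "\<dots> = ennreal (D * b * ?P j)" using D(1) b(2) by (simp add: ennreal_mult[symmetric] mult_ac)
      finally show ?case .
    qed
    then have "AE x in lborel. ?T (mat_pow M j *v x) < top"
      by eventually_elim (auto intro: le_less_trans)
    note props = error_series_properties[OF M \<phi>0 this]
    let ?E = "error_series M h N f \<phi> j"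
    have "AE x in lborel. ennreal (norm (?E x)) \<le> ennreal (D * b * ?P j)"
      using props(3) Tb by eventually_elim (rule order_trans)
    then have ae: "AE x in lebesgue. ennreal (norm (?E x)) \<le> ennreal (D * b * ?P j)"
      by (rule AE_completion)
    have "(\<lambda>x. ennreal (norm (?E x))) \<in> borel_measurable lebesgue" using props(2) by measurable
    then have "Lp_norm lebesgue top ?E \<le> ennreal (D * b * ?P j)"
      unfolding Lp_norm_def Lp_enorm_def using ae by (simp add: esssup_I)
    with props(1,2) show "error_estimate top M h N f \<phi> \<theta> (D * b) j" by blast
  qed
qed

text \<open>\<open>Ck N f\<close> expresses that \<open>f\<close> is the representative with
  continuous derivatives up to order \<open>N\<close>. Since \<open>infsum\<close> is 0 where a
  family is not summable, the norm bound has its intended meaning only together with the summability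
  clause.\<close>

theorem theorem11:
  fixes p :: ennreal
    and h :: real
    and N :: nat
    and M :: "real^'d^'d"
    and f \<phi> :: "real^'d \<Rightarrow> complex"
  assumes "of_nat CARD('d) < p"
    and "0 < h"
    and "1 \<le> N"
    and "in_calLp p \<phi>"
    and "dilation_matrix M"
    and "in_Sobolev (N + 1) p f"
    and "Ck N f"
  shows "\<forall>\<theta>>0. (\<forall>ev. complex_eigenvalue M ev \<longrightarrow> \<theta> < cmod ev) \<longrightarrow>
    (\<exists>C::real. \<forall>j::nat.
       (AE x in lebesgue.
          (\<lambda>k. eps M h N f j (- k) * phi_jk M \<phi> j k x) summable_on int_lattice) \<and>
       in_Lp lebesgue p (error_series M h N f \<phi> j) \<and>
       Lp_norm lebesgue p (error_series M h N f \<phi> j)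
         \<le> ennreal (C * \<theta> powr (- real (j * (N + 1)))))"
proof (intro allI impI)
  fix \<theta> :: real
  assume \<theta>: "\<theta> > 0" "\<forall>ev. complex_eigenvalue M ev \<longrightarrow> \<theta> < cmod ev"
  have "\<exists>K::real. \<forall>j. error_estimate p M h N f \<phi> \<theta> K j"
  proof (cases "p = top")
    case True
    then show ?thesis
      using error_bound_infinite_exponent[of h \<phi> \<theta> M N f] assms \<theta> by blast
  next
    case False
    then obtain r where r: "p = ennreal r" "r \<ge> 0" by (cases p) auto
    have "ennreal (real CARD('d)) < ennreal r" using assms(1) r by (simp add: ennreal_of_nat_eq_real_of_nat)
    then have "real CARD('d) < enn2real p" using r by (simp add: ennreal_less_iff)
    then show ?thesis
      using error_bound_finite_exponent[of p h \<phi> \<theta> M N f] False assms \<theta> by blast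
  qed
  then obtain K :: real where K: "\<And>j. error_estimate p M h N f \<phi> \<theta> K j"
    by blast
  moreover have "Lp_norm lebesgue p (error_series M h N f \<phi> j) < \<infinity>" for j
    using K[of j] by (auto simp: infinity_ennreal_def intro: le_less_trans)
  ultimately show "\<exists>C::real. \<forall>j::nat.
       (AE x in lebesgue.
          (\<lambda>k. eps M h N f j (- k) * phi_jk M \<phi> j k x) summable_on int_lattice) \<and>
       in_Lp lebesgue p (error_series M h N f \<phi> j) \<and>
       Lp_norm lebesgue p (error_series M h N f \<phi> j)
         \<le> ennreal (C * \<theta> powr (- real (j * (N + 1))))"
    unfolding in_Lp_def by blast
qed

end
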